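(* Let $N\ge 1$, $M\ge 0$ be integers, let $a_0,\dots,a_N,b_0,\dots,b_M$ be real constants with $a_N\ne 0$, and let $x$ be a causal Laplace-transformable excitation (in the sense of the context). Then the total (general) solution of the linear differential equation $$\sum_{n=0}^N a_n y^{(n)}(t)=\sum_{m=0}^M b_m x^{(m)}(t)$$ on $\mathbb R$ is $$y(t)=L^{-1}\left\{\frac{\sum_{m=0}^M b_m s^m}{\sum_{n=0}^N a_n s^n}\cdot L\{x(t)\}\right\}+L_{\rm d}^{-1}\left\{\frac{\sum_{\mu=1}^N a_\mu\sum_{\nu=0}^{\mu-1}y_{\rm s}^{(\mu-1-\nu)}(0)\,s^{\nu}}{\sum_{n=0}^N a_n s^n}\right\},$$ where the initial values $y_{\rm s}(0),y_{\rm s}'(0),\dots,y_{\rm s}^{(N-1)}(0)$ are arbitrary real constants. Here the first term is the evoked response $y_{\rm e}$ to $x$ (the causal solution of the equation), and the second term is the spontaneous response $y_{\rm s}$, i.e. the solution on all of $\mathbb R$ of the homogeneous equation $\sum_{n=0}^N a_n y_{\rm s}^{(n)}=0$ having the prescribed initial values $y_{\rm s}^{(\nu)}(0)$, $\nu=0,\dots,N-1$.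
   Context: Equations and derivatives are understood in the sense of distributions on $\mathbb R$. A distribution is causal if its support lies in $[0,\infty)$. A real causal distribution $g$ (in particular a locally integrable function vanishing for $t<0$) is Laplace-transformable if there is $\sigma_0\ge 0$ such that $e^{-\sigma t}g$ is tempered for all $\sigma>\sigma_0$. Its Laplace transform is $L\{g\}(s)=\langle g,e^{-st}\rangle$ for $\operatorname{Re}s>\sigma_0$ (with $e^{-st}$ modified away from a neighbourhood of $[0,\infty)$), which is $\int_0^\infty g(t)e^{-st}\,dt$ for functions of exponential order. For a function $F$ that is the Laplace transform (on some right half-plane) of a causal Laplace-transformable distribution, $L^{-1}\{F\}$ denotes that (unique) causal distribution. $u$ is the unit step function ($u(t)=0$ for $t<0$, $u(t)=1$ for $t>0$). For a strictly proper real rational function $G(s)$ one has $L^{-1}\{G\}=u\cdot g$ for a unique real-analytic function $g$ on $\mathbb R$ (a combination of polynomials times exponentials), and $L_{\rm d}^{-1}\{G\}:=g$, i.e. inverse transformation followed by extrapolation into $t\le 0$ (cancellation of the factor $u(t)$). *)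

theory Defs
  imports "HOL-Analysis.Analysis"
begin

section \<open>Test functions and distributions on the real line\<close>

text \<open>
  All signals of the theory are real, so distributions are real-valued functionals on real-valued
  test functions; complex exponentials are paired through their real and imaginary parts.
\<close>

definition smooth :: "(real \<Rightarrow> real) \<Rightarrow> bool" where
  "smooth \<phi> \<longleftrightarrow> (\<forall>k t. (deriv ^^ k) \<phi> differentiable (at t))"

definition supp :: "(real \<Rightarrow> real) \<Rightarrow> real set" where
  "supp \<phi> = closure {t. \<phi> t \<noteq> 0}"

definition test_functions :: "(real \<Rightarrow> real) set" where
  "test_functions = {\<phi>. smooth \<phi> \<and> compact (supp \<phi>)}"

definition linear_functional_on ::
    "(real \<Rightarrow> real) set \<Rightarrow> ((real \<Rightarrow> real) \<Rightarrow> real) \<Rightarrow> bool" where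
  "linear_functional_on V T \<longleftrightarrow>
     (\<forall>\<phi>\<in>V. \<forall>\<psi>\<in>V. T (\<lambda>t. \<phi> t + \<psi> t) = T \<phi> + T \<psi>) \<and>
     (\<forall>c. \<forall>\<phi>\<in>V. T (\<lambda>t. c * \<phi> t) = c * T \<phi>)"

definition Cn_norm :: "nat \<Rightarrow> (real \<Rightarrow> real) \<Rightarrow> real" where
  "Cn_norm n \<phi> = (\<Sum>k\<le>n. SUP t. \<bar>(deriv ^^ k) \<phi> t\<bar>)"

lemma smooth_deriv_eq:
  assumes "smooth \<phi>"
  shows "((deriv ^^ k) \<phi> has_real_derivative (deriv ^^ Suc k) \<phi> t) (at t)"
  using assms by (auto simp: smooth_def DERIV_deriv_iff_real_differentiable)

lemma smooth_deriv: "smooth \<phi> \<Longrightarrow> smooth (deriv \<phi>)"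
  unfolding smooth_def by (metis funpow_Suc_right o_apply)

lemma supp_deriv_subset: "supp (deriv \<phi>) \<subseteq> supp \<phi>"
proof -
  have "deriv \<phi> t = 0" if "t \<notin> supp \<phi>" for t
  proof -
    have "eventually (\<lambda>s. s \<in> - supp \<phi>) (nhds t)"
      using that by (intro eventually_nhds_in_open) (auto simp: supp_def)
    then have ev: "eventually (\<lambda>s. \<phi> s = 0) (nhds t)"
    proof (rule eventually_mono)
      fix s assume "s \<in> - supp \<phi>"
      then show "\<phi> s = 0"
        using closure_subset[of "{t. \<phi> t \<noteq> 0}"] by (auto simp: supp_def)
    qed
    then have "deriv \<phi> t = deriv (\<lambda>_. 0) t"
      by (intro deriv_cong_ev) auto
    then show ?thesis by simp
  qed
  then have "{t. deriv \<phi> t \<noteq> 0} \<subseteq> supp \<phi>" by blast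
  then show ?thesis
    unfolding supp_def[of "deriv \<phi>"] by (rule closure_minimal) (simp add: supp_def)
qed

lemma test_functions_deriv:
  assumes "\<phi> \<in> test_functions" shows "deriv \<phi> \<in> test_functions"
proof -
  have "compact (supp \<phi> \<inter> supp (deriv \<phi>))"
    using assms by (intro compact_Int_closed) (auto simp: test_functions_def supp_def)
  moreover have "supp \<phi> \<inter> supp (deriv \<phi>) = supp (deriv \<phi>)"
    using supp_deriv_subset by blast
  ultimately show ?thesis
    using assms smooth_deriv by (auto simp: test_functions_def)
qed

lemma test_functions_funpow_deriv:
  "\<phi> \<in> test_functions \<Longrightarrow> (deriv ^^ k) \<phi> \<in> test_functions"
  by (induction k) (auto intro: test_functions_deriv)

lemma smooth_funpow_deriv_add:
  assumes "smooth \<phi>" "smooth \<psi>"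
  shows "(deriv ^^ k) (\<lambda>t. \<phi> t + \<psi> t) = (\<lambda>t. (deriv ^^ k) \<phi> t + (deriv ^^ k) \<psi> t)"
proof (induction k)
  case (Suc k)
  have "deriv (\<lambda>t. (deriv ^^ k) \<phi> t + (deriv ^^ k) \<psi> t) t
      = (deriv ^^ Suc k) \<phi> t + (deriv ^^ Suc k) \<psi> t" for t
    by (intro DERIV_imp_deriv DERIV_add smooth_deriv_eq assms)
  then show ?case by (simp add: Suc.IH fun_eq_iff)
qed simp

lemma smooth_funpow_deriv_cmult:
  assumes "smooth \<phi>"
  shows "(deriv ^^ k) (\<lambda>t. c * \<phi> t) = (\<lambda>t. c * (deriv ^^ k) \<phi> t)"
proof (induction k)
  case (Suc k)
  have "deriv (\<lambda>t. c * (deriv ^^ k) \<phi> t) t = c * (deriv ^^ Suc k) \<phi> t" for t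
    by (intro DERIV_imp_deriv DERIV_cmult smooth_deriv_eq assms)
  then show ?case by (simp add: Suc.IH fun_eq_iff)
qed simp

lemma test_functionsI_supp:
  assumes "smooth \<phi>" "compact K" "supp \<phi> \<subseteq> K" shows "\<phi> \<in> test_functions"
  using assms compact_Int_closed[of K "supp \<phi>"]
  by (simp add: test_functions_def supp_def Int_absorb1)

lemma test_functions_add:
  assumes "\<phi> \<in> test_functions" "\<psi> \<in> test_functions"
  shows "(\<lambda>t. \<phi> t + \<psi> t) \<in> test_functions"
proof (rule test_functionsI_supp)
  show "smooth (\<lambda>t. \<phi> t + \<psi> t)"
    using assms smooth_funpow_deriv_add[of \<phi> \<psi>] by (auto simp: test_functions_def smooth_def)
  show "supp (\<lambda>t. \<phi> t + \<psi> t) \<subseteq> supp \<phi> \<union> supp \<psi>"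
    unfolding supp_def closure_Un[symmetric] by (intro closure_mono) auto
  show "compact (supp \<phi> \<union> supp \<psi>)"
    using assms by (auto simp: test_functions_def)
qed

lemma test_functions_cmult:
  assumes "\<phi> \<in> test_functions"
  shows "(\<lambda>t. c * \<phi> t) \<in> test_functions"
proof (rule test_functionsI_supp)
  show "smooth (\<lambda>t. c * \<phi> t)"
    using assms smooth_funpow_deriv_cmult[of \<phi>] by (auto simp: test_functions_def smooth_def)
  show "supp (\<lambda>t. c * \<phi> t) \<subseteq> supp \<phi>"
    unfolding supp_def by (intro closure_mono) auto
  show "compact (supp \<phi>)"
    using assms by (auto simp: test_functions_def)
qed

lemma not_in_supp: "t \<notin> supp \<phi> \<Longrightarrow> \<phi> t = 0"
  using closure_subset[of "{t. \<phi> t \<noteq> 0}"] by (auto simp: supp_def)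

lemma test_functions_continuous:
  assumes "\<phi> \<in> test_functions" shows "continuous_on S \<phi>"
proof -
  have "\<phi> differentiable (at t)" for t
    using assms smooth_deriv_eq[of \<phi> 0 t]
    by (auto simp: test_functions_def real_differentiable_def)
  then show ?thesis
    by (meson continuous_at_imp_continuous_on differentiable_imp_continuous_within)
qed

lemma test_functions_bdd:
  assumes "\<phi> \<in> test_functions"
  shows "bdd_above (range (\<lambda>t. \<bar>\<phi> t\<bar>))"
proof -
  have cont: "continuous_on (supp \<phi>) \<phi>"
    using assms by (rule test_functions_continuous)
  have "compact (\<phi> ` supp \<phi>)"
    using assms cont by (intro compact_continuous_image) (auto simp: test_functions_def)
  then obtain B where B: "\<And>t. t \<in> supp \<phi> \<Longrightarrow> \<bar>\<phi> t\<bar> \<le> B"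
    using compact_imp_bounded[of "\<phi> ` supp \<phi>"] by (auto simp: bounded_iff)
  have "\<bar>\<phi> t\<bar> \<le> max B 0" for t
  proof (cases "t \<in> supp \<phi>")
    case True then show ?thesis using B by (simp add: le_max_iff_disj)
  next
    case False
    then show ?thesis by (simp add: not_in_supp)
  qed
  then show ?thesis by (auto simp: bdd_above_def)
qed

lemma test_functions_sup_nonneg:
  assumes "\<phi> \<in> test_functions" shows "0 \<le> (SUP t. \<bar>(deriv ^^ k) \<phi> t\<bar>)"
proof -
  have "\<bar>(deriv ^^ k) \<phi> 0\<bar> \<le> (SUP t. \<bar>(deriv ^^ k) \<phi> t\<bar>)"
    by (rule cSUP_upper[OF UNIV_I test_functions_bdd[OF test_functions_funpow_deriv[OF assms]]])
  then show ?thesis by linarith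
qed

lemma Cn_norm_nonneg: "\<phi> \<in> test_functions \<Longrightarrow> 0 \<le> Cn_norm n \<phi>"
  unfolding Cn_norm_def by (intro sum_nonneg test_functions_sup_nonneg)

lemma Cn_norm_mono: "\<phi> \<in> test_functions \<Longrightarrow> m \<le> n \<Longrightarrow> Cn_norm m \<phi> \<le> Cn_norm n \<phi>"
  unfolding Cn_norm_def by (intro sum_mono2) (auto intro: test_functions_sup_nonneg)

lemma Cn_norm_deriv: "\<phi> \<in> test_functions \<Longrightarrow> Cn_norm n (deriv \<phi>) \<le> Cn_norm (Suc n) \<phi>"
proof -
  assume \<phi>: "\<phi> \<in> test_functions"
  have "Cn_norm n (deriv \<phi>) = (\<Sum>k\<le>n. SUP t. \<bar>(deriv ^^ Suc k) \<phi> t\<bar>)"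
    unfolding Cn_norm_def by (simp add: funpow_swap1)
  moreover have "Cn_norm (Suc n) \<phi>
      = (SUP t. \<bar>(deriv ^^ 0) \<phi> t\<bar>) + (\<Sum>k\<le>n. SUP t. \<bar>(deriv ^^ Suc k) \<phi> t\<bar>)"
    unfolding Cn_norm_def by (rule sum.atMost_Suc_shift)
  ultimately show ?thesis using test_functions_sup_nonneg[OF \<phi>, of 0] by linarith
qed

lemma test_function_abs_le_Cn_norm:
  assumes "\<phi> \<in> test_functions" shows "\<bar>\<phi> t\<bar> \<le> Cn_norm 0 \<phi>"
  unfolding Cn_norm_def
  using cSUP_upper[OF UNIV_I test_functions_bdd[OF assms], of t] by simp

text \<open>
  Functionals are normalised to be \<open>0\<close> outside the test functions, so that equality in the type is
  equality of distributions.
\<close>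

definition is_distribution :: "((real \<Rightarrow> real) \<Rightarrow> real) \<Rightarrow> bool" where
  "is_distribution T \<longleftrightarrow>
     linear_functional_on test_functions T \<and>
     (\<forall>K. compact K \<longrightarrow>
        (\<exists>C n. \<forall>\<phi>\<in>test_functions. supp \<phi> \<subseteq> K \<longrightarrow> \<bar>T \<phi>\<bar> \<le> C * Cn_norm n \<phi>)) \<and>
     (\<forall>\<phi>. \<phi> \<notin> test_functions \<longrightarrow> T \<phi> = 0)"

lemma is_distributionI:
  assumes "linear_functional_on test_functions T"
    and "\<And>K. compact K \<Longrightarrow>
      \<exists>C n. \<forall>\<phi>\<in>test_functions. supp \<phi> \<subseteq> K \<longrightarrow> \<bar>T \<phi>\<bar> \<le> C * Cn_norm n \<phi>"
    and "\<And>\<phi>. \<phi> \<notin> test_functions \<Longrightarrow> T \<phi> = 0"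
  shows "is_distribution T"
  unfolding is_distribution_def using assms by (intro conjI allI impI)

lemma is_distribution_add:
  assumes "is_distribution T" "\<phi> \<in> test_functions" "\<psi> \<in> test_functions"
  shows "T (\<lambda>t. \<phi> t + \<psi> t) = T \<phi> + T \<psi>"
  using assms by (simp add: is_distribution_def linear_functional_on_def)

lemma is_distribution_cmult:
  assumes "is_distribution T" "\<phi> \<in> test_functions"
  shows "T (\<lambda>t. c * \<phi> t) = c * T \<phi>"
  using assms by (simp add: is_distribution_def linear_functional_on_def)

lemma is_distribution_outside:
  assumes "is_distribution T" "\<phi> \<notin> test_functions" shows "T \<phi> = 0"
  using assms by (simp add: is_distribution_def)

lemma is_distribution_bound:
  assumes "is_distribution T" "compact K"
  shows "\<exists>C n. C \<ge> 0 \<and>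
    (\<forall>\<phi>\<in>test_functions. supp \<phi> \<subseteq> K \<longrightarrow> \<bar>T \<phi>\<bar> \<le> C * Cn_norm n \<phi>)"
proof -
  have "\<exists>C n. \<forall>\<phi>\<in>test_functions. supp \<phi> \<subseteq> K \<longrightarrow> \<bar>T \<phi>\<bar> \<le> C * Cn_norm n \<phi>"
    using assms by (simp add: is_distribution_def)
  then obtain C n where
    *: "\<forall>\<phi>\<in>test_functions. supp \<phi> \<subseteq> K \<longrightarrow> \<bar>T \<phi>\<bar> \<le> C * Cn_norm n \<phi>"
    by (elim exE)
  have "\<bar>T \<phi>\<bar> \<le> max C 0 * Cn_norm n \<phi>" if "\<phi> \<in> test_functions" "supp \<phi> \<subseteq> K" for \<phi>
  proof -
    have "C * Cn_norm n \<phi> \<le> max C 0 * Cn_norm n \<phi>"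
      by (intro mult_right_mono Cn_norm_nonneg that) simp
    moreover have "\<bar>T \<phi>\<bar> \<le> C * Cn_norm n \<phi>" using * that by simp
    ultimately show ?thesis by linarith
  qed
  then show ?thesis by (intro exI[of _ "max C 0"] exI[of _ n]) simp
qed

lemma is_distribution_zero: "is_distribution (\<lambda>_. 0)"
proof (rule is_distributionI)
  show "linear_functional_on test_functions (\<lambda>_. 0)"
    by (simp add: linear_functional_on_def)
  fix K :: "real set"
  have "\<forall>\<phi>\<in>test_functions. supp \<phi> \<subseteq> K \<longrightarrow> \<bar>0::real\<bar> \<le> 0 * Cn_norm 0 \<phi>" by simp
  then show "\<exists>C n. \<forall>\<phi>\<in>test_functions. supp \<phi> \<subseteq> K \<longrightarrow> \<bar>0::real\<bar> \<le> C * Cn_norm n \<phi>" by blast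
qed simp

lemma is_distribution_plus:
  assumes S: "is_distribution S" and T: "is_distribution T"
  shows "is_distribution (\<lambda>\<phi>. S \<phi> + T \<phi>)"
proof (rule is_distributionI)
  show "linear_functional_on test_functions (\<lambda>\<phi>. S \<phi> + T \<phi>)"
    by (simp add: linear_functional_on_def is_distribution_add[OF S] is_distribution_add[OF T]
        is_distribution_cmult[OF S] is_distribution_cmult[OF T] distrib_left)
  show "S \<phi> + T \<phi> = 0" if "\<phi> \<notin> test_functions" for \<phi>
    using that by (simp add: is_distribution_outside[OF S] is_distribution_outside[OF T])
  fix K :: "real set" assume K: "compact K"
  obtain C m where C: "C \<ge> 0"
      "\<forall>\<phi>\<in>test_functions. supp \<phi> \<subseteq> K \<longrightarrow> \<bar>S \<phi>\<bar> \<le> C * Cn_norm m \<phi>"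
    using is_distribution_bound[OF S K] by (elim exE conjE)
  obtain D n where D: "D \<ge> 0"
      "\<forall>\<phi>\<in>test_functions. supp \<phi> \<subseteq> K \<longrightarrow> \<bar>T \<phi>\<bar> \<le> D * Cn_norm n \<phi>"
    using is_distribution_bound[OF T K] by (elim exE conjE)
  have "\<bar>S \<phi> + T \<phi>\<bar> \<le> (C + D) * Cn_norm (max m n) \<phi>"
    if \<phi>: "\<phi> \<in> test_functions" "supp \<phi> \<subseteq> K" for \<phi>
  proof -
    have "C * Cn_norm m \<phi> \<le> C * Cn_norm (max m n) \<phi>"
      by (intro mult_left_mono Cn_norm_mono \<phi> C) auto
    moreover have "D * Cn_norm n \<phi> \<le> D * Cn_norm (max m n) \<phi>"
      by (intro mult_left_mono Cn_norm_mono \<phi> D) auto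
    ultimately show ?thesis
      using bspec[OF C(2) \<phi>(1)] bspec[OF D(2) \<phi>(1)] \<phi>(2) unfolding distrib_right by linarith
  qed
  then show "\<exists>C n. \<forall>\<phi>\<in>test_functions. supp \<phi> \<subseteq> K \<longrightarrow> \<bar>S \<phi> + T \<phi>\<bar> \<le> C * Cn_norm n \<phi>"
    by (intro exI[of _ "C + D"] exI[of _ "max m n"] ballI impI)
qed

lemma is_distribution_scale:
  assumes T: "is_distribution T"
  shows "is_distribution (\<lambda>\<phi>. c * T \<phi>)"
proof (rule is_distributionI)
  show "linear_functional_on test_functions (\<lambda>\<phi>. c * T \<phi>)"
    by (simp add: linear_functional_on_def is_distribution_add[OF T] is_distribution_cmult[OF T]
        distrib_left mult.left_commute)
  show "c * T \<phi> = 0" if "\<phi> \<notin> test_functions" for \<phi>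
    using that by (simp add: is_distribution_outside[OF T])
  fix K :: "real set" assume K: "compact K"
  obtain C m where C: "C \<ge> 0"
      "\<forall>\<phi>\<in>test_functions. supp \<phi> \<subseteq> K \<longrightarrow> \<bar>T \<phi>\<bar> \<le> C * Cn_norm m \<phi>"
    using is_distribution_bound[OF T K] by (elim exE conjE)
  have "\<bar>c * T \<phi>\<bar> \<le> (\<bar>c\<bar> * C) * Cn_norm m \<phi>"
    if \<phi>: "\<phi> \<in> test_functions" "supp \<phi> \<subseteq> K" for \<phi>
    using mult_left_mono[OF mp[OF bspec[OF C(2) \<phi>(1)] \<phi>(2)], of "\<bar>c\<bar>"]
    by (simp add: abs_mult mult.assoc)
  then show "\<exists>C n. \<forall>\<phi>\<in>test_functions. supp \<phi> \<subseteq> K \<longrightarrow> \<bar>c * T \<phi>\<bar> \<le> C * Cn_norm n \<phi>"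
    by (intro exI[of _ "\<bar>c\<bar> * C"] exI[of _ m] ballI impI)
qed

lemma is_distribution_deriv:
  assumes T: "is_distribution T"
  shows "is_distribution (\<lambda>\<phi>. if \<phi> \<in> test_functions then - T (deriv \<phi>) else 0)"
    (is "is_distribution ?D")
proof (rule is_distributionI)
  show "linear_functional_on test_functions ?D"
    unfolding linear_functional_on_def
  proof (intro conjI ballI allI)
    fix \<phi> \<psi> assume \<phi>: "\<phi> \<in> test_functions" and \<psi>: "\<psi> \<in> test_functions"
    have "deriv (\<lambda>t. \<phi> t + \<psi> t) = (\<lambda>t. deriv \<phi> t + deriv \<psi> t)"
      using smooth_funpow_deriv_add[of \<phi> \<psi> 1] \<phi> \<psi> by (simp add: test_functions_def)
    moreover have "T (\<lambda>t. deriv \<phi> t + deriv \<psi> t) = T (deriv \<phi>) + T (deriv \<psi>)"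
      by (intro is_distribution_add[OF T] test_functions_deriv \<phi> \<psi>)
    ultimately show "?D (\<lambda>t. \<phi> t + \<psi> t) = ?D \<phi> + ?D \<psi>"
      using test_functions_add[OF \<phi> \<psi>] \<phi> \<psi> by simp
  next
    fix c \<phi> assume \<phi>: "\<phi> \<in> test_functions"
    have "deriv (\<lambda>t. c * \<phi> t) = (\<lambda>t. c * deriv \<phi> t)"
      using smooth_funpow_deriv_cmult[of \<phi> 1] \<phi> by (simp add: test_functions_def)
    moreover have "T (\<lambda>t. c * deriv \<phi> t) = c * T (deriv \<phi>)"
      by (intro is_distribution_cmult[OF T] test_functions_deriv \<phi>)
    ultimately show "?D (\<lambda>t. c * \<phi> t) = c * ?D \<phi>"
      using test_functions_cmult[OF \<phi>] \<phi> by simp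
  qed
  fix K :: "real set" assume K: "compact K"
  obtain C m where C: "C \<ge> 0"
      "\<forall>\<phi>\<in>test_functions. supp \<phi> \<subseteq> K \<longrightarrow> \<bar>T \<phi>\<bar> \<le> C * Cn_norm m \<phi>"
    using is_distribution_bound[OF T K] by (elim exE conjE)
  have "\<bar>?D \<phi>\<bar> \<le> C * Cn_norm (Suc m) \<phi>" if \<phi>: "\<phi> \<in> test_functions" "supp \<phi> \<subseteq> K" for \<phi>
  proof -
    have "\<bar>T (deriv \<phi>)\<bar> \<le> C * Cn_norm m (deriv \<phi>)"
      using bspec[OF C(2) test_functions_deriv[OF \<phi>(1)]]
        subset_trans[OF supp_deriv_subset \<phi>(2)] by simp
    also have "\<dots> \<le> C * Cn_norm (Suc m) \<phi>"
      by (intro mult_left_mono Cn_norm_deriv \<phi> C)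
    finally show ?thesis using \<phi> by simp
  qed
  then show "\<exists>C n. \<forall>\<phi>\<in>test_functions. supp \<phi> \<subseteq> K \<longrightarrow> \<bar>?D \<phi>\<bar> \<le> C * Cn_norm n \<phi>"
    by (intro exI[of _ C] exI[of _ "Suc m"] ballI impI)
qed simp

typedef distr = "{T. is_distribution T}" morphisms pairing Abs_distr
proof
  show "(\<lambda>_. 0) \<in> {T. is_distribution T}"
    by (simp add: is_distribution_zero)
qed

setup_lifting type_definition_distr

instantiation distr :: real_vector
begin

lift_definition zero_distr :: distr is "\<lambda>_. 0"
  by (rule is_distribution_zero)

lift_definition plus_distr :: "distr \<Rightarrow> distr \<Rightarrow> distr" is "\<lambda>S T \<phi>. S \<phi> + T \<phi>"
  by (rule is_distribution_plus)

lift_definition scaleR_distr :: "real \<Rightarrow> distr \<Rightarrow> distr" is "\<lambda>c T \<phi>. c * T \<phi>"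
  by (rule is_distribution_scale)

definition uminus_distr :: "distr \<Rightarrow> distr" where
  "uminus_distr T = (- 1) *\<^sub>R T"

definition minus_distr :: "distr \<Rightarrow> distr \<Rightarrow> distr" where
  "minus_distr S T = S + (- T)"

instance
proof
  fix S T U :: distr and c d :: real
  show "S + T + U = S + (T + U)" by transfer (simp add: add.assoc)
  show "S + T = T + S" by transfer (simp add: add.commute)
  show "0 + T = T" by transfer simp
  show "- T + T = 0" unfolding uminus_distr_def by transfer simp
  show "S - T = S + - T" by (rule minus_distr_def)
  show "c *\<^sub>R (S + T) = c *\<^sub>R S + c *\<^sub>R T" by transfer (simp add: distrib_left)
  show "(c + d) *\<^sub>R T = c *\<^sub>R T + d *\<^sub>R T" by transfer (simp add: distrib_right)
  show "c *\<^sub>R d *\<^sub>R T = (c * d) *\<^sub>R T" by transfer (simp add: mult.assoc)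
  show "1 *\<^sub>R T = T" by transfer simp
qed

end

lift_definition distr_deriv :: "distr \<Rightarrow> distr"
  is "\<lambda>T \<phi>. if \<phi> \<in> test_functions then - T (deriv \<phi>) else 0"
  by (rule is_distribution_deriv)

definition locally_integrable :: "(real \<Rightarrow> real) \<Rightarrow> bool" where
  "locally_integrable f \<longleftrightarrow> (\<forall>K. compact K \<longrightarrow> set_integrable lborel K f)"

lemma locally_integrable_times_test:
  assumes f: "locally_integrable f" and \<phi>: "\<phi> \<in> test_functions"
    and K: "compact K" "supp \<phi> \<subseteq> K"
  shows "integrable lborel (\<lambda>t. f t * \<phi> t)"
    and "\<bar>LBINT t. f t * \<phi> t\<bar> \<le> (LBINT t:K. \<bar>f t\<bar>) * Cn_norm 0 \<phi>"
proof -
  have fK: "integrable lborel (\<lambda>t. indicator K t * f t)"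
    using f K by (simp add: locally_integrable_def set_integrable_def)
  have eq: "f t * \<phi> t = (indicator K t * f t) * \<phi> t" for t
    using K not_in_supp[of t \<phi>] by (auto simp: indicator_def)
  have le: "\<bar>f t * \<phi> t\<bar> \<le> indicator K t * \<bar>f t\<bar> * Cn_norm 0 \<phi>" for t
    unfolding eq abs_mult
    using test_function_abs_le_Cn_norm[OF \<phi>, of t] by (intro mult_mono) auto
  have dom: "integrable lborel (\<lambda>t. indicator K t * \<bar>f t\<bar> * Cn_norm 0 \<phi>)"
    using integrable_norm[OF fK] by (simp add: abs_mult)
  have meas: "(\<lambda>t. f t * \<phi> t) \<in> borel_measurable lborel"
    unfolding eq
    using borel_measurable_times[OF borel_measurable_integrable[OF fK], of \<phi>]
      borel_measurable_continuous_onI[OF test_functions_continuous[OF \<phi>]] by simp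
  show int: "integrable lborel (\<lambda>t. f t * \<phi> t)"
    using le by (intro Bochner_Integration.integrable_bound[OF dom meas])
      (auto intro!: AE_I2 order_trans[OF _ abs_ge_self])
  have "\<bar>LBINT t. f t * \<phi> t\<bar> \<le> (LBINT t. \<bar>f t * \<phi> t\<bar>)"
    using integral_norm_bound[of lborel "\<lambda>t. f t * \<phi> t"] by simp
  also have "\<dots> \<le> (LBINT t. indicator K t * \<bar>f t\<bar> * Cn_norm 0 \<phi>)"
    using int dom le by (intro integral_mono) auto
  also have "\<dots> = (LBINT t:K. \<bar>f t\<bar>) * Cn_norm 0 \<phi>"
    by (simp add: set_lebesgue_integral_def)
  finally show "\<bar>LBINT t. f t * \<phi> t\<bar> \<le> (LBINT t:K. \<bar>f t\<bar>) * Cn_norm 0 \<phi>" .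
qed

lemma is_distribution_of_fun:
  "is_distribution
     (\<lambda>\<phi>. if locally_integrable f \<and> \<phi> \<in> test_functions then LBINT t. f t * \<phi> t else 0)"
    (is "is_distribution ?T")
proof (rule is_distributionI)
  have int: "integrable lborel (\<lambda>t. f t * \<phi> t)"
    if "locally_integrable f" "\<phi> \<in> test_functions" for \<phi>
    using locally_integrable_times_test(1)[OF that, of "supp \<phi>"] that
    by (simp add: test_functions_def)
  show "linear_functional_on test_functions ?T"
    unfolding linear_functional_on_def
  proof (intro conjI ballI allI)
    fix \<phi> \<psi> assume "\<phi> \<in> test_functions" "\<psi> \<in> test_functions"
    then show "?T (\<lambda>t. \<phi> t + \<psi> t) = ?T \<phi> + ?T \<psi>"
      by (simp add: test_functions_add distrib_left int)
  next
    fix c \<phi> assume "\<phi> \<in> test_functions"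
    then show "?T (\<lambda>t. c * \<phi> t) = c * ?T \<phi>"
      by (simp add: test_functions_cmult mult.left_commute)
  qed
  fix K :: "real set" assume K: "compact K"
  have "\<bar>?T \<phi>\<bar> \<le> (LBINT t:K. \<bar>f t\<bar>) * Cn_norm 0 \<phi>"
    if "\<phi> \<in> test_functions" "supp \<phi> \<subseteq> K" for \<phi>
  proof (cases "locally_integrable f")
    case True
    then show ?thesis
      using locally_integrable_times_test(2)[OF True that(1) K that(2)] that by simp
  next
    case False
    have "0 \<le> (LBINT t:K. \<bar>f t\<bar>)"
      unfolding set_lebesgue_integral_def by (intro Bochner_Integration.integral_nonneg) auto
    then show ?thesis using False Cn_norm_nonneg[OF that(1)] by simp
  qed
  then show "\<exists>C n. \<forall>\<phi>\<in>test_functions. supp \<phi> \<subseteq> K \<longrightarrow> \<bar>?T \<phi>\<bar> \<le> C * Cn_norm n \<phi>"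
    by (intro exI[of _ "LBINT t:K. \<bar>f t\<bar>"] exI[of _ 0] ballI impI)
qed simp

text \<open>The regular distribution \<open>\<phi> \<mapsto> \<integral> f \<phi>\<close> of a locally integrable function (and the junk value
  \<open>0\<close> for other functions).\<close>

lift_definition distr_of_fun :: "(real \<Rightarrow> real) \<Rightarrow> distr"
  is "\<lambda>f \<phi>. if locally_integrable f \<and> \<phi> \<in> test_functions then LBINT t. f t * \<phi> t else 0"
  by (rule is_distribution_of_fun)

definition distr_support :: "distr \<Rightarrow> real set" where
  "distr_support T =
     - \<Union>{U. open U \<and> (\<forall>\<phi>\<in>test_functions. supp \<phi> \<subseteq> U \<longrightarrow> pairing T \<phi> = 0)}"

definition causal :: "distr \<Rightarrow> bool" where
  "causal T \<longleftrightarrow> distr_support T \<subseteq> {0..}"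


section \<open>Tempered distributions and the Laplace transform\<close>

definition schwartz :: "(real \<Rightarrow> real) set" where
  "schwartz = {\<phi>. smooth \<phi> \<and> (\<forall>j k. bounded (range (\<lambda>t. t ^ j * (deriv ^^ k) \<phi> t)))}"

definition schwartz_norm :: "nat \<Rightarrow> (real \<Rightarrow> real) \<Rightarrow> real" where
  "schwartz_norm n \<phi> = (\<Sum>j\<le>n. \<Sum>k\<le>n. SUP t. \<bar>t ^ j * (deriv ^^ k) \<phi> t\<bar>)"

definition tempered_functional :: "((real \<Rightarrow> real) \<Rightarrow> real) \<Rightarrow> bool" where
  "tempered_functional G \<longleftrightarrow>
     linear_functional_on schwartz G \<and>
     (\<exists>C n. \<forall>\<phi>\<in>schwartz. \<bar>G \<phi>\<bar> \<le> C * schwartz_norm n \<phi>)"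

text \<open>\<open>G\<close> is the (unique, since test functions are dense in the Schwartz space) extension of
  \<open>e\<^sup>-\<^sup>\<sigma>\<^sup>t T\<close> to a tempered distribution.\<close>

definition tempered_extension :: "distr \<Rightarrow> real \<Rightarrow> ((real \<Rightarrow> real) \<Rightarrow> real) \<Rightarrow> bool" where
  "tempered_extension T \<sigma> G \<longleftrightarrow>
     tempered_functional G \<and>
     (\<forall>\<phi>\<in>test_functions. G \<phi> = pairing T (\<lambda>t. exp (- \<sigma> * t) * \<phi> t))"

definition laplace_transformable :: "distr \<Rightarrow> bool" where
  "laplace_transformable T \<longleftrightarrow>
     causal T \<and> (\<exists>\<sigma>\<^sub>0\<ge>0. \<forall>\<sigma>>\<sigma>\<^sub>0. \<exists>G. tempered_extension T \<sigma> G)"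

text \<open>
  \<open>\<langle>T, e\<^sup>-\<^sup>s\<^sup>t\<rangle> = \<langle>e\<^sup>-\<^sup>\<sigma>\<^sup>t T, e\<^sup>-\<^sup>(\<^sup>s\<^sup>-\<^sup>\<sigma>\<^sup>)\<^sup>t\<rangle>\<close> for any \<open>\<sigma> < Re s\<close> for which \<open>e\<^sup>-\<^sup>\<sigma>\<^sup>t T\<close> is tempered; the
  exponential on the right is replaced by a Schwartz function \<open>\<psi>\<^sub>1 + i \<psi>\<^sub>2\<close> that agrees with it on a
  neighbourhood of \<open>[0,\<infinity>)\<close>. For causal \<open>T\<close> the value does not depend on the choices.
\<close>

definition has_laplace :: "distr \<Rightarrow> complex \<Rightarrow> complex \<Rightarrow> bool" where
  "has_laplace T s z \<longleftrightarrow>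
     (\<exists>\<sigma> G \<psi>\<^sub>1 \<psi>\<^sub>2 \<epsilon>.
        \<sigma> < Re s \<and> tempered_extension T \<sigma> G \<and> \<psi>\<^sub>1 \<in> schwartz \<and> \<psi>\<^sub>2 \<in> schwartz \<and> \<epsilon> > 0 \<and>
        (\<forall>t>-\<epsilon>. Complex (\<psi>\<^sub>1 t) (\<psi>\<^sub>2 t) = exp (- (s - of_real \<sigma>) * of_real t)) \<and>
        z = Complex (G \<psi>\<^sub>1) (G \<psi>\<^sub>2))"

definition laplace :: "distr \<Rightarrow> complex \<Rightarrow> complex" where
  "laplace T s = (THE z. has_laplace T s z)"

definition laplace_pair :: "distr \<Rightarrow> (complex \<Rightarrow> complex) \<Rightarrow> bool" where
  "laplace_pair T F \<longleftrightarrow>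
     laplace_transformable T \<and> (\<exists>\<sigma>. \<forall>s. Re s > \<sigma> \<longrightarrow> laplace T s = F s)"

definition inverse_laplace :: "(complex \<Rightarrow> complex) \<Rightarrow> distr" where
  "inverse_laplace F = (THE T. laplace_pair T F)"

definition unit_step :: "real \<Rightarrow> real" where
  "unit_step t = (if t < 0 then 0 else 1)"

definition real_analytic :: "(real \<Rightarrow> real) \<Rightarrow> bool" where
  "real_analytic g \<longleftrightarrow>
     (\<forall>t\<^sub>0. \<exists>c. \<exists>r>0. \<forall>t. \<bar>t - t\<^sub>0\<bar> < r \<longrightarrow> (\<lambda>n. c n * (t - t\<^sub>0) ^ n) sums g t)"

text \<open>The extrapolated inverse transform \<open>L\<^sub>d\<^sup>-\<^sup>1\<close>; meaningful in particular for strictly proper real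
  rational functions.\<close>

definition inverse_laplace_d :: "(complex \<Rightarrow> complex) \<Rightarrow> real \<Rightarrow> real" where
  "inverse_laplace_d F =
     (THE g. real_analytic g \<and> inverse_laplace F = distr_of_fun (\<lambda>t. unit_step t * g t))"

text \<open>\<open>N\<close>-fold differentiability is only there to give the initial values a meaning; the equation itself
  is understood in the sense of distributions.\<close>

definition homogeneous_ivp_solution ::
    "nat \<Rightarrow> (nat \<Rightarrow> real) \<Rightarrow> (nat \<Rightarrow> real) \<Rightarrow> (real \<Rightarrow> real) \<Rightarrow> bool" where
  "homogeneous_ivp_solution N a c z \<longleftrightarrow>
     (\<forall>k<N. \<forall>t. (deriv ^^ k) z differentiable (at t)) \<and>
     (\<Sum>n=0..N. a n *\<^sub>R (distr_deriv ^^ n) (distr_of_fun z)) = 0 \<and>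
     (\<forall>\<nu><N. (deriv ^^ \<nu>) z 0 = c \<nu>)"

end

theory Submission
  imports Defs "HOL-Complex_Analysis.Cauchy_Integral_Formula"
begin

text \<open>
  Why the theorem holds. Write \<open>A(D)\<close> for the operator on the left-hand side and \<open>B(D)\<close> for the one on
  the right. Three facts have to be supplied: a causal solution of \<open>A(D) y = w\<close> that is again
  Laplace-transformable, the uniqueness of the inverse Laplace transform, and the fact that every
  distribution annihilated by \<open>A(D)\<close> is a classical solution.

  Evoked response. Let \<open>e\<close> be the solution of the homogeneous equation with initial values
  \<open>0, \<dots>, 0, 1 / a\<^sub>N\<close>, so that \<open>u e\<close> is the causal fundamental solution. The convolution of a causal
  distribution \<open>T\<close> with \<open>u e\<close> is defined by transposition: a test function \<open>\<phi>\<close> is sent to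
  \<open>K \<phi> (t) = \<integral>\<^sub>0\<^sup>\<infinity> e(\<tau>) \<phi>(t + \<tau>) d\<tau>\<close>, and \<open>T\<close> is applied to \<open>K \<phi>\<close> after a cutoff to the left of the
  origin, which causality makes harmless. Since \<open>e\<close> grows at most exponentially, \<open>K\<close> becomes, after
  multiplication of the kernel by \<open>e\<^sup>-\<^sup>\<sigma>\<^sup>\<tau>\<close>, a continuous operator on the Schwartz space for every large
  \<open>\<sigma>\<close>; hence the convolution is Laplace-transformable (\<open>causal_solution_exists\<close>). Its transform need not
  be computed from the kernel: the rule \<open>L{D T} = s L{T}\<close> (\<open>laplace_pair_distr_deriv\<close>) and the equation
  itself give \<open>A(s) L{y} = L{w}\<close>, and \<open>A\<close> has no zeros far to the right.

  Uniqueness. By causality the transform at \<open>\<sigma> + k\<close>, \<open>k = 1, 2, \<dots>\<close>, is a tempered functional applied to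
  exponentials \<open>e\<^sup>-\<^sup>k\<^sup>t\<close> cut off on the left. In the variable \<open>e\<^sup>-\<^sup>t\<close> their combinations are polynomials
  without constant term, and Weierstrass approximation shows that they approximate every test function
  on the half-line in each Schwartz seminorm (\<open>exp_poly_approx\<close>). So a vanishing transform forces the
  distribution to vanish (\<open>laplace_eq_0_imp\<close>).

  Homogeneous equation. A distribution annihilated by \<open>A(D)\<close> vanishes on the range of the adjoint
  \<open>A(-D)\<close> on test functions, and \<open>K\<close> is almost an inverse of \<open>A(-D)\<close>: far to the left \<open>K \<phi>\<close> is a
  combination of solutions whose coefficients are the integrals of \<open>\<phi>\<close> against a basis of solutions.
  Removing that tail shows that these \<open>N\<close> integrals determine the value at \<open>\<phi>\<close>
  (\<open>homogeneous_distr_solution\<close>).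

  Spontaneous response. The solution \<open>z\<close> with initial values \<open>c\<close> is given by its Taylor series, whose
  coefficients are produced by the companion matrix; it is entire and of exponential growth. Since
  \<open>D(u z) = u z' + z(0) \<delta>\<close>, transforming \<open>u A(D) z = 0\<close> yields the rational function of the theorem
  (\<open>laplace_pair_initial_values\<close>), and \<open>z\<close> is the only analytic function with that causal part because
  an analytic function that vanishes on an interval is zero (\<open>real_analytic_zero\<close>). The total solution
  and the uniqueness of the causal one follow by subtracting the evoked response.
\<close>

section \<open>Smooth functions\<close>

text \<open>Closure under products and inverses is an induction on the order of differentiability, for which
  the derivative has to be a parameter rather than an iterate of \<open>deriv\<close>.\<close>

primrec cdiff :: "nat \<Rightarrow> (real \<Rightarrow> real) \<Rightarrow> bool" where
  "cdiff 0 f \<longleftrightarrow> True"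
| "cdiff (Suc k) f \<longleftrightarrow> (\<exists>f'. (\<forall>t. (f has_real_derivative f' t) (at t)) \<and> cdiff k f')"

lemma cdiff_Suc_deriv:
  "cdiff (Suc k) f \<longleftrightarrow> (\<forall>t. f differentiable (at t)) \<and> cdiff k (deriv f)"
proof
  assume "cdiff (Suc k) f"
  then obtain f' where f': "\<forall>t. (f has_real_derivative f' t) (at t)" "cdiff k f'" by auto
  then have "deriv f = f'" by (auto intro!: ext DERIV_imp_deriv)
  then show "(\<forall>t. f differentiable (at t)) \<and> cdiff k (deriv f)"
    using f' by (auto simp: real_differentiable_def)
next
  assume "(\<forall>t. f differentiable (at t)) \<and> cdiff k (deriv f)"
  then show "cdiff (Suc k) f"
    unfolding cdiff.simps by (intro exI[of _ "deriv f"]) (simp add: DERIV_deriv_iff_real_differentiable)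
qed

lemma smooth_iff_cdiff: "smooth f \<longleftrightarrow> (\<forall>k. cdiff k f)"
proof -
  have eq: "cdiff k f \<longleftrightarrow> (\<forall>j<k. \<forall>t. (deriv ^^ j) f differentiable (at t))" for k
  proof (induction k arbitrary: f)
    case (Suc k)
    have "(\<forall>j<Suc k. \<forall>t. (deriv ^^ j) f differentiable (at t)) \<longleftrightarrow>
       (\<forall>t. f differentiable (at t)) \<and> (\<forall>j<k. \<forall>t. (deriv ^^ j) (deriv f) differentiable (at t))"
      by (auto simp: less_Suc_eq_0_disj funpow_Suc_right simp del: funpow.simps(2))
    then show ?case unfolding cdiff_Suc_deriv Suc.IH by blast
  qed simp
  show ?thesis unfolding smooth_def eq by blast
qed

lemma cdiff_antimono: "cdiff (Suc k) f \<Longrightarrow> cdiff k f"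
  by (induction k arbitrary: f) auto

lemma smoothI_cdiff: "(\<And>k. cdiff k f) \<Longrightarrow> smooth f"
  by (simp add: smooth_iff_cdiff)

lemma smoothD_cdiff: "smooth f \<Longrightarrow> cdiff k f"
  by (simp add: smooth_iff_cdiff)

lemma smooth_has_deriv: "smooth f \<Longrightarrow> (f has_real_derivative deriv f t) (at t)"
  using smooth_deriv_eq[of f 0 t] by simp

lemma smooth_continuous: "smooth f \<Longrightarrow> continuous_on S f"
  by (meson DERIV_isCont continuous_at_imp_continuous_on smooth_has_deriv)

lemma smooth_funpow_deriv: "smooth f \<Longrightarrow> smooth ((deriv ^^ k) f)"
  by (induction k) (auto intro: smooth_deriv)

lemma smooth_of_deriv:
  assumes "\<And>t. (f has_real_derivative f' t) (at t)" "smooth f'"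
  shows "smooth f"
proof (rule smoothI_cdiff)
  fix k show "cdiff k f"
    using assms by (cases k) (auto intro: smoothD_cdiff)
qed

lemma cdiff_const: "cdiff k (\<lambda>_. c)"
proof (induction k arbitrary: c)
  case (Suc k)
  then show ?case by (auto intro!: exI[of _ "\<lambda>_. 0"])
qed simp

lemma smooth_const: "smooth (\<lambda>_. c)"
  by (intro smoothI_cdiff cdiff_const)

lemma cdiff_add: "cdiff k f \<Longrightarrow> cdiff k g \<Longrightarrow> cdiff k (\<lambda>t. f t + g t)"
proof (induction k arbitrary: f g)
  case (Suc k)
  then obtain f' g' where "\<forall>t. (f has_real_derivative f' t) (at t)" "cdiff k f'"
    "\<forall>t. (g has_real_derivative g' t) (at t)" "cdiff k g'" by auto
  then show ?case
    by (auto intro!: exI[of _ "\<lambda>t. f' t + g' t"] DERIV_add Suc.IH)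
qed simp

lemma smooth_add: "smooth f \<Longrightarrow> smooth g \<Longrightarrow> smooth (\<lambda>t. f t + g t)"
  by (simp add: smooth_iff_cdiff cdiff_add)

lemma cdiff_mult: "cdiff k f \<Longrightarrow> cdiff k g \<Longrightarrow> cdiff k (\<lambda>t. f t * g t)"
proof (induction k arbitrary: f g)
  case (Suc k)
  then obtain f' g' where *: "\<forall>t. (f has_real_derivative f' t) (at t)" "cdiff k f'"
    "\<forall>t. (g has_real_derivative g' t) (at t)" "cdiff k g'" by auto
  have "cdiff k (\<lambda>t. f' t * g t + f t * g' t)"
    using * Suc.prems by (intro cdiff_add Suc.IH cdiff_antimono[of k f] cdiff_antimono[of k g])
  moreover have "((\<lambda>t. f t * g t) has_real_derivative f' t * g t + f t * g' t) (at t)" for t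
    using DERIV_mult[OF spec[OF *(1), of t] spec[OF *(3), of t]] by (simp add: ac_simps)
  ultimately show ?case
    unfolding cdiff.simps by (intro exI[of _ "\<lambda>t. f' t * g t + f t * g' t"] conjI allI)
qed simp

lemma smooth_mult: "smooth f \<Longrightarrow> smooth g \<Longrightarrow> smooth (\<lambda>t. f t * g t)"
  by (simp add: smooth_iff_cdiff cdiff_mult)

lemma smooth_cmult: "smooth f \<Longrightarrow> smooth (\<lambda>t. c * f t)"
  by (intro smooth_mult smooth_const)

lemma smooth_diff:
  assumes "smooth f" "smooth g" shows "smooth (\<lambda>t. f t - g t)"
  using smooth_add[OF assms(1) smooth_cmult[OF assms(2), of "-1"]] by simp

lemma smooth_sum: "(\<And>i. i \<in> I \<Longrightarrow> smooth (f i)) \<Longrightarrow> smooth (\<lambda>t. \<Sum>i\<in>I. f i t)"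
  by (induction I rule: infinite_finite_induct) (auto intro: smooth_const smooth_add)

lemma smooth_inverse:
  assumes "smooth f" "\<And>t. f t \<noteq> 0" shows "smooth (\<lambda>t. inverse (f t))"
proof (rule smoothI_cdiff)
  fix k show "cdiff k (\<lambda>t. inverse (f t))"
  proof (induction k)
    case (Suc k)
    let ?g = "\<lambda>t. - 1 * (deriv f t * (inverse (f t) * inverse (f t)))"
    have "cdiff k ?g"
      by (intro cdiff_mult cdiff_const Suc.IH smoothD_cdiff smooth_deriv assms)
    moreover have "((\<lambda>t. inverse (f t)) has_real_derivative ?g t) (at t)" for t
      using DERIV_inverse'[OF smooth_has_deriv[OF assms(1), of t] assms(2)]
      by (simp add: ac_simps)
    ultimately show ?case unfolding cdiff.simps by (intro exI[of _ ?g] conjI allI)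
  qed simp
qed

lemma funpow_deriv_affine:
  assumes "smooth f"
  shows "(deriv ^^ k) (\<lambda>t. f (a * t + b)) = (\<lambda>t. a ^ k * (deriv ^^ k) f (a * t + b))"
proof (induction k)
  case (Suc k)
  have "deriv (\<lambda>t. a ^ k * (deriv ^^ k) f (a * t + b)) t
      = a ^ Suc k * (deriv ^^ Suc k) f (a * t + b)" for t
  proof (rule DERIV_imp_deriv)
    have "((\<lambda>t. (deriv ^^ k) f (a * t + b)) has_real_derivative
        (deriv ^^ Suc k) f (a * t + b) * a) (at t)"
      by (rule DERIV_chain2[OF smooth_deriv_eq[OF assms]]) (auto intro!: derivative_eq_intros)
    from DERIV_cmult[OF this, of "a ^ k"]
    show "((\<lambda>t. a ^ k * (deriv ^^ k) f (a * t + b)) has_real_derivative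
        a ^ Suc k * (deriv ^^ Suc k) f (a * t + b)) (at t)"
      by (simp add: ac_simps)
  qed
  then show ?case by (simp add: Suc.IH fun_eq_iff)
qed simp

lemma smooth_affine:
  assumes "smooth f" shows "smooth (\<lambda>t. f (a * t + b))"
proof -
  have "((\<lambda>t. a ^ k * (deriv ^^ k) f (a * t + b)) has_real_derivative
      a ^ k * ((deriv ^^ Suc k) f (a * t + b) * a)) (at t)" for k t
    by (intro DERIV_cmult DERIV_chain2[OF smooth_deriv_eq[OF assms]])
      (auto intro!: derivative_eq_intros)
  then show ?thesis
    unfolding smooth_def funpow_deriv_affine[OF assms] real_differentiable_def by blast
qed

lemma funpow_deriv_mult:
  assumes f: "smooth f" and g: "smooth g"
  shows "(deriv ^^ k) (\<lambda>t. f t * g t)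
    = (\<lambda>t. \<Sum>i\<le>k. real (k choose i) * ((deriv ^^ i) f t * (deriv ^^ (k - i)) g t))"
proof (induction k)
  case (Suc k)
  let ?h = "\<lambda>i j t. (deriv ^^ i) f t * (deriv ^^ j) g t"
  have "deriv (\<lambda>t. \<Sum>i\<le>k. real (k choose i) * ?h i (k - i) t) t
      = (\<Sum>i\<le>Suc k. real (Suc k choose i) * ?h i (Suc k - i) t)" for t
  proof (rule DERIV_imp_deriv)
    have d: "(?h i j has_real_derivative ?h (Suc i) j t + ?h i (Suc j) t) (at t)" for i j
      using DERIV_mult[OF smooth_deriv_eq[OF f, of i t] smooth_deriv_eq[OF g, of j t]]
      by (simp add: ac_simps)
    have "((\<lambda>t. \<Sum>i\<le>k. real (k choose i) * ?h i (k - i) t) has_real_derivative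
        (\<Sum>i\<le>k. real (k choose i) * (?h (Suc i) (k - i) t + ?h i (Suc (k - i)) t))) (at t)"
      by (intro DERIV_sum DERIV_cmult d)
    also have "(\<Sum>i\<le>k. real (k choose i) * (?h (Suc i) (k - i) t + ?h i (Suc (k - i)) t))
       = (\<Sum>i\<le>k. real (k choose i) * ?h (Suc i) (Suc k - Suc i) t)
         + (\<Sum>i\<le>k. real (k choose i) * ?h i (Suc k - i) t)"
      unfolding sum.distrib[symmetric]
      by (intro sum.cong refl) (simp add: distrib_left Suc_diff_le)
    also have "(\<Sum>i\<le>k. real (k choose i) * ?h i (Suc k - i) t)
        = (\<Sum>i\<le>Suc k. real (k choose i) * ?h i (Suc k - i) t)"
      by (simp add: binomial_eq_0)
    also have "\<dots> = ?h 0 (Suc k) t + (\<Sum>i\<le>k. real (k choose Suc i) * ?h (Suc i) (Suc k - Suc i) t)"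
      by (subst sum.atMost_Suc_shift) simp
    also have "(\<Sum>i\<le>k. real (k choose i) * ?h (Suc i) (Suc k - Suc i) t) + \<dots>
       = ?h 0 (Suc k) t + (\<Sum>i\<le>k. real (Suc k choose Suc i) * ?h (Suc i) (Suc k - Suc i) t)"
      by (simp add: sum.distrib[symmetric] distrib_right add.assoc[symmetric])
    also have "\<dots> = (\<Sum>i\<le>Suc k. real (Suc k choose i) * ?h i (Suc k - i) t)"
      by (subst sum.atMost_Suc_shift) simp
    finally show "((\<lambda>t. \<Sum>i\<le>k. real (k choose i) * ?h i (k - i) t) has_real_derivative
        (\<Sum>i\<le>Suc k. real (Suc k choose i) * ?h i (Suc k - i) t)) (at t)" .
  qed
  then show ?case by (simp only: funpow.simps o_apply Suc.IH fun_eq_iff) simp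
qed simp

text \<open>The weight \<open>w\<close> is carried along because the Schwartz seminorms and the estimates near infinity
  only control the products of the weight with pairs of derivatives.\<close>

lemma funpow_deriv_mult_bound:
  assumes "smooth f" "smooth g" "w \<ge> 0"
    and c: "\<And>i. i \<le> k \<Longrightarrow> w * (\<bar>(deriv ^^ i) f t\<bar> * \<bar>(deriv ^^ (k - i)) g t\<bar>) \<le> c"
  shows "w * \<bar>(deriv ^^ k) (\<lambda>t. f t * g t) t\<bar> \<le> 2 ^ k * c"
proof -
  have "w * \<bar>(deriv ^^ k) (\<lambda>t. f t * g t) t\<bar>
      \<le> w * (\<Sum>i\<le>k. \<bar>real (k choose i) * ((deriv ^^ i) f t * (deriv ^^ (k - i)) g t)\<bar>)"
    unfolding funpow_deriv_mult[OF assms(1,2)] by (intro mult_left_mono sum_abs assms)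
  also have "\<dots> = (\<Sum>i\<le>k. real (k choose i) * (w * (\<bar>(deriv ^^ i) f t\<bar> * \<bar>(deriv ^^ (k - i)) g t\<bar>)))"
    by (simp add: sum_distrib_left abs_mult ac_simps)
  also have "\<dots> \<le> (\<Sum>i\<le>k. real (k choose i) * c)"
    using c by (intro sum_mono mult_left_mono) auto
  also have "\<dots> = real (\<Sum>i\<le>k. k choose i) * c" by (simp add: sum_distrib_right)
  also have "\<dots> = 2 ^ k * c" by (simp only: choose_row_sum) simp
  finally show ?thesis .
qed

lemma funpow_deriv_const: "(deriv ^^ k) (\<lambda>_. c) = (\<lambda>_. if k = 0 then c else 0)"
  by (induction k) auto

lemma funpow_deriv_eventually_cong:
  assumes "open U" "t \<in> U" "\<And>t. t \<in> U \<Longrightarrow> f t = g t"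
  shows "(deriv ^^ k) f t = (deriv ^^ k) g t"
proof -
  have "\<forall>t\<in>U. (deriv ^^ k) f t = (deriv ^^ k) g t"
  proof (induction k)
    case (Suc k)
    show ?case
    proof
      fix t assume "t \<in> U"
      then have "eventually (\<lambda>t. (deriv ^^ k) f t = (deriv ^^ k) g t) (nhds t)"
        using Suc by (intro eventually_mono[OF eventually_nhds_in_open[OF assms(1)]]) auto
      then show "(deriv ^^ Suc k) f t = (deriv ^^ Suc k) g t"
        by (simp add: deriv_cong_ev)
    qed
  qed (use assms in auto)
  then show ?thesis using assms by blast
qed

lemma test_functions_mult_smooth:
  assumes "smooth f" "\<phi> \<in> test_functions" shows "(\<lambda>t. f t * \<phi> t) \<in> test_functions"
proof (rule test_functionsI_supp)
  show "smooth (\<lambda>t. f t * \<phi> t)"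
    using assms by (intro smooth_mult) (auto simp: test_functions_def)
  show "compact (supp \<phi>)" using assms by (simp add: test_functions_def)
  show "supp (\<lambda>t. f t * \<phi> t) \<subseteq> supp \<phi>"
    unfolding supp_def by (intro closure_mono) auto
qed

lemma supp_subset_closed: "closed S \<Longrightarrow> (\<And>t. t \<notin> S \<Longrightarrow> f t = 0) \<Longrightarrow> supp f \<subseteq> S"
  unfolding supp_def by (intro closure_minimal) auto

lemma test_functions_vanishI:
  assumes "smooth f" "\<And>t. t < a \<Longrightarrow> f t = 0" "\<And>t. t > b \<Longrightarrow> f t = 0"
  shows "f \<in> test_functions"
proof (rule test_functionsI_supp[OF assms(1) compact_Icc])
  show "supp f \<subseteq> {a..b}"
    by (rule supp_subset_closed) (use assms(2,3) in \<open>auto simp: not_le\<close>)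
qed

lemma test_functions_vanishE:
  assumes "\<phi> \<in> test_functions"
  obtains R where "R > 0" "\<And>t. \<bar>t\<bar> > R \<Longrightarrow> \<phi> t = 0"
proof -
  have "bounded (supp \<phi>)" using assms by (simp add: test_functions_def compact_imp_bounded)
  then obtain R where R: "R > 0" "\<forall>t\<in>supp \<phi>. \<bar>t\<bar> \<le> R" by (auto simp: bounded_pos)
  show ?thesis
  proof (rule that[OF R(1)])
    fix t assume "\<bar>t\<bar> > R"
    then show "\<phi> t = 0" using R(2) by (intro not_in_supp) force
  qed
qed

lemma test_smooth: "\<phi> \<in> test_functions \<Longrightarrow> smooth \<phi>"
  by (simp add: test_functions_def)

lemma test_functions_sum: "(\<And>i. i \<in> I \<Longrightarrow> \<phi> i \<in> test_functions) \<Longrightarrow> (\<lambda>t. \<Sum>i\<in>I. \<phi> i t) \<in> test_functions"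
proof (induction I rule: infinite_finite_induct)
  case (insert i I)
  then show ?case using test_functions_add[of "\<phi> i" "\<lambda>t. \<Sum>i\<in>I. \<phi> i t"] by simp
qed (auto intro: test_functions_vanishI smooth_const)

lemma test_functions_diff:
  assumes "\<phi> \<in> test_functions" "\<psi> \<in> test_functions"
  shows "(\<lambda>t. \<phi> t - \<psi> t) \<in> test_functions"
  using test_functions_add[OF assms(1) test_functions_cmult[OF assms(2), of "-1"]] by simp


section \<open>Cutoff functions\<close>

text \<open>The negative powers of \<open>t\<close> make this family closed under differentiation up to linear
  combinations, so that smoothness at the origin is a single induction for all members.\<close>

definition flat_exp :: "nat \<Rightarrow> real \<Rightarrow> real" where
  "flat_exp m t = (if t \<le> 0 then 0 else (1 / t) ^ m * exp (- (1 / t)))"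

lemma flat_exp_tendsto_0: "(flat_exp m \<longlongrightarrow> 0) (at_right 0)"
proof -
  have "((\<lambda>t::real. (1 / t) ^ m / exp (1 / t)) \<longlongrightarrow> 0) (at_right 0)"
    using filterlim_compose[OF tendsto_power_div_exp_0 filterlim_inverse_at_top_right, of m]
    by (simp add: inverse_eq_divide)
  moreover have "eventually (\<lambda>t. (1 / t) ^ m / exp (1 / t) = flat_exp m t) (at_right 0)"
    unfolding eventually_at_right_field flat_exp_def by (auto simp: exp_minus field_simps intro!: exI[of _ 1])
  ultimately show ?thesis by (rule Lim_transform_eventually)
qed

lemma flat_exp_deriv:
  "(flat_exp m has_real_derivative flat_exp (m + 2) t - real m * flat_exp (m + 1) t) (at t)"
proof -
  consider "t < 0" | "t = 0" | "t > 0" by linarith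
  then show ?thesis
  proof cases
    case 1
    have "(flat_exp m has_real_derivative 0) (at t)"
      by (rule has_field_derivative_transform_within_open[of "\<lambda>_. 0" _ _ "{..<0}"])
         (use 1 in \<open>auto simp: flat_exp_def\<close>)
    then show ?thesis using 1 by (simp add: flat_exp_def)
  next
    case 2
    have "((\<lambda>h. flat_exp m h / h) \<longlongrightarrow> 0) (at 0)"
    proof (rule filterlim_split_at)
      show "((\<lambda>h. flat_exp m h / h) \<longlongrightarrow> 0) (at_left 0)"
        by (rule tendsto_eventually) (auto simp: flat_exp_def eventually_at_left_field intro!: exI[of _ "-1"])
      have "flat_exp m h / h = flat_exp (Suc m) h" if "h > 0" for h
        using that by (simp add: flat_exp_def)
      then have "eventually (\<lambda>h. flat_exp (Suc m) h = flat_exp m h / h) (at_right 0)"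
        by (auto simp: eventually_at_right_field intro!: exI[of _ 1])
      then show "((\<lambda>h. flat_exp m h / h) \<longlongrightarrow> 0) (at_right 0)"
        by (rule Lim_transform_eventually[OF flat_exp_tendsto_0])
    qed
    then show ?thesis using 2 by (simp add: has_field_derivative_iff flat_exp_def)
  next
    case 3
    have "((\<lambda>t. (1 / t) ^ m * exp (- (1 / t))) has_real_derivative
        (1 / t) ^ (m + 2) * exp (- (1 / t)) - real m * ((1 / t) ^ (m + 1) * exp (- (1 / t)))) (at t)"
    proof (cases m)
      case (Suc n)
      have w: "((\<lambda>t. 1 / t) has_real_derivative - ((1 / t) * (1 / t))) (at t)"
        using 3 by (auto intro!: derivative_eq_intros)
      show ?thesis
        unfolding Suc
        by (rule DERIV_cong[OF DERIV_mult[OF DERIV_power_Suc[OF w] DERIV_fun_exp[OF DERIV_minus[OF w]]]])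
           (simp add: algebra_simps)
    qed (use 3 in \<open>auto intro!: derivative_eq_intros simp: power2_eq_square\<close>)
    then have "(flat_exp m has_real_derivative
        (1 / t) ^ (m + 2) * exp (- (1 / t)) - real m * ((1 / t) ^ (m + 1) * exp (- (1 / t)))) (at t)"
      by (rule has_field_derivative_transform_within_open[of _ _ _ "{0<..}"])
         (use 3 in \<open>auto simp: flat_exp_def\<close>)
    then show ?thesis using 3 by (simp add: flat_exp_def)
  qed
qed

lemma smooth_flat_exp: "smooth (flat_exp m)"
proof (rule smoothI_cdiff)
  fix k show "cdiff k (flat_exp m)"
  proof (induction k arbitrary: m)
    case (Suc k)
    have "cdiff k (\<lambda>t. flat_exp (m + 2) t + - real m * flat_exp (m + 1) t)"
      by (intro cdiff_add cdiff_mult cdiff_const Suc)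
    then show ?case using flat_exp_deriv[of m]
      by (auto intro!: exI[of _ "\<lambda>t. flat_exp (m + 2) t - real m * flat_exp (m + 1) t"])
  qed simp
qed

text \<open>The denominator is positive everywhere because the two flat functions vanish on disjoint
  half-lines.\<close>

definition smooth_step :: "real \<Rightarrow> real" where
  "smooth_step t = flat_exp 0 t * inverse (flat_exp 0 t + flat_exp 0 (1 - t))"

lemma smooth_step_denom: "flat_exp 0 t + flat_exp 0 (1 - t) > 0"
  by (auto simp: flat_exp_def add_pos_pos)

lemma smooth_smooth_step: "smooth smooth_step"
proof -
  have "smooth (\<lambda>t. flat_exp 0 (1 - t))"
    using smooth_affine[OF smooth_flat_exp, of 0 "-1" 1] by simp
  then have "smooth (\<lambda>t. flat_exp 0 t * inverse (flat_exp 0 t + flat_exp 0 (1 - t)))"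
    using smooth_step_denom[THEN less_imp_neq, THEN not_sym]
    by (intro smooth_mult smooth_inverse smooth_add smooth_flat_exp)
  then show ?thesis unfolding smooth_step_def[abs_def] .
qed

lemma smooth_step_eq_0: "t \<le> 0 \<Longrightarrow> smooth_step t = 0"
  by (simp add: smooth_step_def flat_exp_def)

lemma smooth_step_eq_1: "t \<ge> 1 \<Longrightarrow> smooth_step t = 1"
  by (simp add: smooth_step_def flat_exp_def)

lemma smooth_step_nonneg: "smooth_step t \<ge> 0"
  using smooth_step_denom[of t] by (auto simp: smooth_step_def flat_exp_def)

definition plateau :: "real \<Rightarrow> real" where
  "plateau t = smooth_step (2 + t) * smooth_step (2 - t)"

lemma smooth_plateau: "smooth plateau"
  using smooth_mult[OF smooth_affine[OF smooth_smooth_step, of 1 2]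
      smooth_affine[OF smooth_smooth_step, of "-1" 2]]
  by (simp add: plateau_def[abs_def] add.commute)

lemma plateau_eq_1: "\<bar>t\<bar> \<le> 1 \<Longrightarrow> plateau t = 1"
  by (simp add: plateau_def smooth_step_eq_1)

lemma plateau_eq_0: "\<bar>t\<bar> \<ge> 2 \<Longrightarrow> plateau t = 0"
  by (auto simp: plateau_def smooth_step_eq_0 abs_if split: if_splits)

lemma plateau_nonneg: "plateau t \<ge> 0"
  by (simp add: plateau_def smooth_step_nonneg)

lemma test_functions_plateau: "plateau \<in> test_functions"
  by (rule test_functions_vanishI[OF smooth_plateau, of "-2" 2]) (auto intro: plateau_eq_0)

lemma test_functions_plateau_affine:
  assumes "\<delta> > 0" shows "(\<lambda>t. plateau ((t - c) / \<delta>)) \<in> test_functions"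
proof (rule test_functions_vanishI)
  show "smooth (\<lambda>t. plateau ((t - c) / \<delta>))"
    using smooth_affine[OF smooth_plateau, of "1 / \<delta>" "- c / \<delta>"] by (simp add: diff_divide_distrib)
  have far: "plateau ((t - c) / \<delta>) = 0" if "\<bar>t - c\<bar> > 2 * \<delta>" for t
    using that assms by (intro plateau_eq_0) (simp add: pos_le_divide_eq)
  show "plateau ((t - c) / \<delta>) = 0" if "t < c - 2 * \<delta>" for t
    using that by (intro far) linarith
  show "plateau ((t - c) / \<delta>) = 0" if "t > c + 2 * \<delta>" for t
    using that by (intro far) linarith
qed

text \<open>Equal to \<open>1\<close> on a neighbourhood of \<open>[0,\<infinity>)\<close>, which is all that a causal distribution sees.\<close>

definition causal_cutoff :: "real \<Rightarrow> real" where
  "causal_cutoff t = smooth_step (2 * t + 2)"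

lemma smooth_causal_cutoff: "smooth causal_cutoff"
  unfolding causal_cutoff_def[abs_def] by (rule smooth_affine[OF smooth_smooth_step])

lemma causal_cutoff_eq_0: "t \<le> -1 \<Longrightarrow> causal_cutoff t = 0"
  by (simp add: causal_cutoff_def smooth_step_eq_0)

lemma causal_cutoff_eq_1: "t \<ge> -1/2 \<Longrightarrow> causal_cutoff t = 1"
  by (simp add: causal_cutoff_def smooth_step_eq_1)

lemma test_functions_deriv_bounded:
  assumes "\<phi> \<in> test_functions" shows "\<exists>B. \<forall>k\<le>n. \<forall>t. \<bar>(deriv ^^ k) \<phi> t\<bar> \<le> B"
proof -
  have "\<forall>k. \<exists>B. \<forall>t. \<bar>(deriv ^^ k) \<phi> t\<bar> \<le> B"
    using test_functions_bdd[OF test_functions_funpow_deriv[OF assms]] by (auto simp: bdd_above_def)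
  then obtain B where B: "\<And>k t. \<bar>(deriv ^^ k) \<phi> t\<bar> \<le> B k" by metis
  have "\<bar>(deriv ^^ k) \<phi> t\<bar> \<le> (\<Sum>i\<le>n. B i)" if "k \<le> n" for k t
  proof -
    have "B i \<ge> 0" for i using B[of i 0] by linarith
    then have "B k \<le> (\<Sum>i\<le>n. B i)" using that by (intro member_le_sum) auto
    then show ?thesis using B[of k t] by linarith
  qed
  then show ?thesis by blast
qed

text \<open>To the left of \<open>1\<close> the cutoff coincides with a test function, and to the right of \<open>0\<close> it is
  constant.\<close>

lemma causal_cutoff_deriv_bounded: "\<exists>B\<ge>1. \<forall>k\<le>n. \<forall>t. \<bar>(deriv ^^ k) causal_cutoff t\<bar> \<le> B"
proof -
  have test: "(\<lambda>t. causal_cutoff t * plateau t) \<in> test_functions"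
    by (intro test_functions_mult_smooth smooth_causal_cutoff test_functions_plateau)
  obtain B where B: "\<forall>k\<le>n. \<forall>t. \<bar>(deriv ^^ k) (\<lambda>t. causal_cutoff t * plateau t) t\<bar> \<le> B"
    using test_functions_deriv_bounded[OF test, of n] by blast
  have "\<bar>(deriv ^^ k) causal_cutoff t\<bar> \<le> max 1 B" if "k \<le> n" for k t
  proof (cases "t < 1")
    case True
    have "(deriv ^^ k) causal_cutoff t = (deriv ^^ k) (\<lambda>t. causal_cutoff t * plateau t) t"
    proof (rule funpow_deriv_eventually_cong[of "{..<1}"])
      fix t :: real assume "t \<in> {..<1}"
      then show "causal_cutoff t = causal_cutoff t * plateau t"
        using causal_cutoff_eq_0[of t] plateau_eq_1[of t] by (cases "t \<le> -1") auto
    qed (use True in auto)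
    then show ?thesis using B that by (simp add: le_max_iff_disj)
  next
    case False
    have "(deriv ^^ k) causal_cutoff t = (deriv ^^ k) (\<lambda>_. 1) t"
      by (rule funpow_deriv_eventually_cong[of "{0<..}"]) (use False in \<open>auto intro: causal_cutoff_eq_1\<close>)
    then show ?thesis by (simp add: funpow_deriv_const le_max_iff_disj)
  qed
  then show ?thesis by (intro exI[of _ "max 1 B"]) auto
qed
section \<open>Causal distributions\<close>

lemma is_distribution_pairing: "is_distribution (pairing T)"
  using pairing[of T] by simp

lemma pairing_add:
  "\<phi> \<in> test_functions \<Longrightarrow> \<psi> \<in> test_functions \<Longrightarrow> pairing T (\<lambda>t. \<phi> t + \<psi> t) = pairing T \<phi> + pairing T \<psi>"
  by (rule is_distribution_add[OF is_distribution_pairing])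

lemma pairing_cmult: "\<phi> \<in> test_functions \<Longrightarrow> pairing T (\<lambda>t. c * \<phi> t) = c * pairing T \<phi>"
  by (rule is_distribution_cmult[OF is_distribution_pairing])

lemma pairing_diff:
  assumes "\<phi> \<in> test_functions" "\<psi> \<in> test_functions"
  shows "pairing T (\<lambda>t. \<phi> t - \<psi> t) = pairing T \<phi> - pairing T \<psi>"
  using pairing_add[OF assms(1) test_functions_cmult[OF assms(2), of "-1"]]
    pairing_cmult[OF assms(2), of T "-1"] by simp

lemma pairing_sum:
  "(\<And>i. i \<in> I \<Longrightarrow> \<phi> i \<in> test_functions) \<Longrightarrow>
    pairing T (\<lambda>t. \<Sum>i\<in>I. \<phi> i t) = (\<Sum>i\<in>I. pairing T (\<phi> i))"
proof (induction I rule: infinite_finite_induct)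
  case (insert i I)
  then show ?case
    using pairing_add[of "\<phi> i" "\<lambda>t. \<Sum>i\<in>I. \<phi> i t" T] test_functions_sum[of I \<phi>] by simp
qed (use pairing_cmult[OF test_functions_plateau, of _ 0] in auto)

lemma distr_eqI: "(\<And>\<phi>. \<phi> \<in> test_functions \<Longrightarrow> pairing S \<phi> = pairing T \<phi>) \<Longrightarrow> S = T"
  using is_distribution_outside[OF is_distribution_pairing]
  by (metis pairing_inject ext)

text \<open>The support is defined through open null sets; that their union is a null set needs a partition
  of unity. On the line it suffices to glue two overlapping intervals, and Bolzano's bisection
  principle does the rest.\<close>

lemma causal_pairing_eq_0:
  assumes T: "causal T" and \<phi>: "\<phi> \<in> test_functions" and \<epsilon>: "\<epsilon> > 0"
    and van: "\<And>t. t > - \<epsilon> \<Longrightarrow> \<phi> t = 0"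
  shows "pairing T \<phi> = 0"
proof -
  define P where "P a b \<longleftrightarrow> (\<exists>\<delta>>0. \<forall>\<phi>\<in>test_functions.
      (\<forall>t. \<phi> t \<noteq> 0 \<longrightarrow> a - \<delta> < t \<and> t < b + \<delta>) \<longrightarrow> pairing T \<phi> = 0)" for a b
  obtain R where R: "R > 0" "\<And>t. \<bar>t\<bar> > R \<Longrightarrow> \<phi> t = 0"
    using test_functions_vanishE[OF \<phi>] by blast
  have "P (- R - \<epsilon>) (- \<epsilon>)"
  proof (rule Bolzano)
    show "- R - \<epsilon> \<le> - \<epsilon>" using R by simp
  next
    fix a b c assume ab: "P a b" and bc: "P b c"
    obtain d where d: "d > 0" "\<And>\<phi>. \<phi> \<in> test_functions \<Longrightarrow>
        (\<And>t. \<phi> t \<noteq> 0 \<Longrightarrow> a - d < t \<and> t < b + d) \<Longrightarrow> pairing T \<phi> = 0"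
      using ab unfolding P_def by blast
    obtain e where e: "e > 0" "\<And>\<phi>. \<phi> \<in> test_functions \<Longrightarrow>
        (\<And>t. \<phi> t \<noteq> 0 \<Longrightarrow> b - e < t \<and> t < c + e) \<Longrightarrow> pairing T \<phi> = 0"
      using bc unfolding P_def by blast
    define \<delta> where "\<delta> = min d e"
    have \<delta>: "\<delta> > 0" "\<delta> \<le> d" "\<delta> \<le> e" using d e by (auto simp: \<delta>_def)
    \<comment> \<open>the transition from \<open>0\<close> to \<open>1\<close> takes place inside the overlap of the two intervals\<close>
    define \<eta> where "\<eta> t = smooth_step ((t - b) / \<delta>)" for t
    have \<eta>: "smooth \<eta>"
      using smooth_affine[OF smooth_smooth_step, of "1 / \<delta>" "- b / \<delta>"]
      by (simp add: \<eta>_def[abs_def] diff_divide_distrib)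
    have "pairing T \<phi> = 0" if \<phi>: "\<phi> \<in> test_functions"
      and supp: "\<forall>t. \<phi> t \<noteq> 0 \<longrightarrow> a - \<delta> < t \<and> t < c + \<delta>" for \<phi>
    proof -
      have test: "(\<lambda>t. \<eta> t * \<phi> t) \<in> test_functions" "(\<lambda>t. (1 - \<eta> t) * \<phi> t) \<in> test_functions"
        by (auto intro!: test_functions_mult_smooth \<eta> \<phi> smooth_diff smooth_const)
      have "pairing T (\<lambda>t. \<eta> t * \<phi> t) = 0"
      proof (rule e(2)[OF test(1)])
        fix t assume "\<eta> t * \<phi> t \<noteq> 0"
        then have "\<phi> t \<noteq> 0" "(t - b) / \<delta> > 0"
          using smooth_step_eq_0[of "(t - b) / \<delta>"] by (force simp: \<eta>_def)+
        moreover have "t > b" using \<open>(t - b) / \<delta> > 0\<close> \<delta>(1) by (simp add: zero_less_divide_iff)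
        ultimately show "b - e < t \<and> t < c + e" using supp \<delta> e(1) by force
      qed
      moreover have "pairing T (\<lambda>t. (1 - \<eta> t) * \<phi> t) = 0"
      proof (rule d(2)[OF test(2)])
        fix t assume "(1 - \<eta> t) * \<phi> t \<noteq> 0"
        then have "\<phi> t \<noteq> 0" "(t - b) / \<delta> < 1"
          using smooth_step_eq_1[of "(t - b) / \<delta>"] by (force simp: \<eta>_def)+
        moreover have "t < b + \<delta>" using \<open>(t - b) / \<delta> < 1\<close> \<delta>(1) by (simp add: divide_less_eq)
        ultimately show "a - d < t \<and> t < b + d" using supp \<delta> by force
      qed
      ultimately show "pairing T \<phi> = 0"
        using pairing_add[OF test, of T] by (simp add: algebra_simps)
    qed
    then show "P a c" using \<delta>(1) unfolding P_def by blast
  next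
    fix x assume x: "- R - \<epsilon> \<le> x" "x \<le> - \<epsilon>"
    then have "x \<notin> distr_support T" using T \<epsilon> by (force simp: causal_def)
    then obtain U where U: "open U" "x \<in> U"
      "\<And>\<phi>. \<phi> \<in> test_functions \<Longrightarrow> supp \<phi> \<subseteq> U \<Longrightarrow> pairing T \<phi> = 0"
      by (auto simp: distr_support_def)
    obtain r where r: "r > 0" "cball x r \<subseteq> U" using U open_contains_cball by blast
    have "P a b" if ab: "a \<le> x \<and> x \<le> b \<and> b - a < r / 2" for a b
    proof -
      have "pairing T \<phi> = 0" if \<phi>: "\<phi> \<in> test_functions"
        and supp: "\<forall>t. \<phi> t \<noteq> 0 \<longrightarrow> a - r / 2 < t \<and> t < b + r / 2" for \<phi>
      proof (rule U(3)[OF \<phi>])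
        have "supp \<phi> \<subseteq> {a - r / 2..b + r / 2}"
        proof (rule supp_subset_closed)
          fix t assume "t \<notin> {a - r / 2..b + r / 2}"
          then show "\<phi> t = 0" using spec[OF supp, of t] by auto
        qed simp
        also have "\<dots> \<subseteq> cball x r" using ab by (auto simp: dist_real_def)
        finally show "supp \<phi> \<subseteq> U" using r by blast
      qed
      then show ?thesis using r unfolding P_def by (intro exI[of _ "r / 2"]) auto
    qed
    then show "\<exists>d>0. \<forall>a b. a \<le> x \<and> x \<le> b \<and> b - a < d \<longrightarrow> P a b"
      using r by (intro exI[of _ "r / 2"]) auto
  qed
  then obtain \<delta> where \<delta>: "\<delta> > 0" "\<And>\<phi>. \<phi> \<in> test_functions \<Longrightarrow>
      (\<And>t. \<phi> t \<noteq> 0 \<Longrightarrow> - R - \<epsilon> - \<delta> < t \<and> t < - \<epsilon> + \<delta>) \<Longrightarrow> pairing T \<phi> = 0"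
    unfolding P_def by blast
  show ?thesis
  proof (rule \<delta>(2)[OF \<phi>])
    fix t assume t: "\<phi> t \<noteq> 0"
    then have "\<bar>t\<bar> \<le> R" "t \<le> - \<epsilon>" using R(2)[of t] van[of t] by force+
    then show "- R - \<epsilon> - \<delta> < t \<and> t < - \<epsilon> + \<delta>" using \<delta>(1) \<epsilon> by auto
  qed
qed

lemma causal_pairing_cong:
  assumes "causal T" "\<phi> \<in> test_functions" "\<psi> \<in> test_functions" "\<epsilon> > 0"
    and "\<And>t. t > - \<epsilon> \<Longrightarrow> \<phi> t = \<psi> t"
  shows "pairing T \<phi> = pairing T \<psi>"
  using causal_pairing_eq_0[OF assms(1) test_functions_diff[OF assms(2,3)] assms(4)]
    pairing_diff[OF assms(2,3), of T] assms(5) by simp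

lemma causalI:
  assumes "\<And>\<phi> \<epsilon>. \<phi> \<in> test_functions \<Longrightarrow> \<epsilon> > 0 \<Longrightarrow> (\<And>t. t > - \<epsilon> \<Longrightarrow> \<phi> t = 0) \<Longrightarrow> pairing T \<phi> = 0"
  shows "causal T"
proof -
  have "pairing T \<phi> = 0" if \<phi>: "\<phi> \<in> test_functions" "supp \<phi> \<subseteq> {..<0}" for \<phi>
  proof -
    obtain \<epsilon> where \<epsilon>: "\<epsilon> > 0" "\<And>t. t \<in> supp \<phi> \<Longrightarrow> t \<le> - \<epsilon>"
    proof (cases "supp \<phi> = {}")
      case False
      then obtain m where m: "m \<in> supp \<phi>" "\<And>t. t \<in> supp \<phi> \<Longrightarrow> t \<le> m"
        using compact_attains_sup[of "supp \<phi>"] \<phi>(1) by (auto simp: test_functions_def)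
      then show ?thesis using \<phi>(2) by (intro that[of "- m"]) auto
    qed (auto intro: that[of 1])
    show ?thesis
    proof (rule assms[OF \<phi>(1) \<epsilon>(1)])
      fix t assume "t > - \<epsilon>"
      then show "\<phi> t = 0" using \<epsilon>(2)[of t] by (intro not_in_supp) auto
    qed
  qed
  then have "{..<0} \<subseteq> \<Union>{U. open U \<and> (\<forall>\<phi>\<in>test_functions. supp \<phi> \<subseteq> U \<longrightarrow> pairing T \<phi> = 0)}"
    by (intro Union_upper) auto
  then have "- \<Union>{U. open U \<and> (\<forall>\<phi>\<in>test_functions. supp \<phi> \<subseteq> U \<longrightarrow> pairing T \<phi> = 0)} \<subseteq> - {..<0}"
    by (simp only: Compl_subset_Compl_iff)
  then show ?thesis unfolding causal_def distr_support_def by (simp add: Compl_lessThan)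
qed

lemma pairing_distr_deriv: "\<phi> \<in> test_functions \<Longrightarrow> pairing (distr_deriv T) \<phi> = - pairing T (deriv \<phi>)"
  by (simp add: distr_deriv.rep_eq)

lemma pairing_plus: "pairing (S + T) \<phi> = pairing S \<phi> + pairing T \<phi>"
  by (simp add: plus_distr.rep_eq)

lemma pairing_scaleR: "pairing (c *\<^sub>R T) \<phi> = c * pairing T \<phi>"
  by (simp add: scaleR_distr.rep_eq)

lemma pairing_zero: "pairing 0 \<phi> = 0"
  by (simp add: zero_distr.rep_eq)

lemma pairing_distr_sum: "pairing (\<Sum>i\<in>I. T i) \<phi> = (\<Sum>i\<in>I. pairing (T i) \<phi>)"
  by (induction I rule: infinite_finite_induct) (auto simp: pairing_plus pairing_zero)

lemma causal_plus:
  assumes "causal S" "causal T" shows "causal (S + T)"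
proof (rule causalI)
  fix \<phi> and \<epsilon> :: real
  assume \<phi>: "\<phi> \<in> test_functions" "\<epsilon> > 0" "\<And>t. t > - \<epsilon> \<Longrightarrow> \<phi> t = 0"
  then show "pairing (S + T) \<phi> = 0"
    using causal_pairing_eq_0[OF assms(1) \<phi>] causal_pairing_eq_0[OF assms(2) \<phi>]
    by (simp add: pairing_plus)
qed

lemma causal_scaleR:
  assumes "causal T" shows "causal (c *\<^sub>R T)"
proof (rule causalI)
  fix \<phi> and \<epsilon> :: real
  assume \<phi>: "\<phi> \<in> test_functions" "\<epsilon> > 0" "\<And>t. t > - \<epsilon> \<Longrightarrow> \<phi> t = 0"
  then show "pairing (c *\<^sub>R T) \<phi> = 0"
    using causal_pairing_eq_0[OF assms \<phi>] by (simp add: pairing_scaleR)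
qed

lemma deriv_vanish:
  assumes "\<And>t. t > - \<epsilon> \<Longrightarrow> \<phi> t = 0" "t > - \<epsilon>" shows "deriv \<phi> t = (0::real)"
  using funpow_deriv_eventually_cong[of "{- \<epsilon> <..}" t \<phi> "\<lambda>_. 0" 1] assms by simp

lemma causal_distr_deriv:
  assumes "causal T" shows "causal (distr_deriv T)"
proof (rule causalI)
  fix \<phi> and \<epsilon> :: real
  assume \<phi>: "\<phi> \<in> test_functions" "\<epsilon> > 0" "\<And>t. t > - \<epsilon> \<Longrightarrow> \<phi> t = 0"
  then have "pairing T (deriv \<phi>) = 0"
    by (intro causal_pairing_eq_0[OF assms test_functions_deriv \<phi>(2)]) (auto intro: deriv_vanish)
  then show "pairing (distr_deriv T) \<phi> = 0" using \<phi> by (simp add: pairing_distr_deriv)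
qed


section \<open>Schwartz functions and tempered functionals\<close>

text \<open>An upper bound for all seminorms up to order \<open>n\<close> is easier to propagate through products than
  the sum of suprema, and is equivalent to it up to a constant.\<close>

definition schwartz_bound :: "nat \<Rightarrow> (real \<Rightarrow> real) \<Rightarrow> real \<Rightarrow> bool" where
  "schwartz_bound n \<phi> B \<longleftrightarrow> (\<forall>j\<le>n. \<forall>k\<le>n. \<forall>t. \<bar>t ^ j * (deriv ^^ k) \<phi> t\<bar> \<le> B)"

lemma schwartz_boundD:
  "schwartz_bound n \<phi> B \<Longrightarrow> j \<le> n \<Longrightarrow> k \<le> n \<Longrightarrow> \<bar>t\<bar> ^ j * \<bar>(deriv ^^ k) \<phi> t\<bar> \<le> B"
  by (simp add: schwartz_bound_def abs_mult power_abs)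

lemma schwartz_boundI:
  "(\<And>j k t. j \<le> n \<Longrightarrow> k \<le> n \<Longrightarrow> \<bar>t\<bar> ^ j * \<bar>(deriv ^^ k) \<phi> t\<bar> \<le> B) \<Longrightarrow> schwartz_bound n \<phi> B"
  by (simp add: schwartz_bound_def abs_mult power_abs)

lemma schwartz_bound_nonneg: "schwartz_bound n \<phi> B \<Longrightarrow> 0 \<le> B"
  using schwartz_boundD[of n \<phi> B 0 0 0] by simp

lemma schwartz_smooth: "\<phi> \<in> schwartz \<Longrightarrow> smooth \<phi>"
  by (simp add: schwartz_def)

lemma schwartz_bdd:
  "\<phi> \<in> schwartz \<Longrightarrow> bdd_above (range (\<lambda>t. \<bar>t ^ j * (deriv ^^ k) \<phi> t\<bar>))"
  unfolding schwartz_def bounded_iff bdd_above_def by (auto simp: image_iff)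

lemma schwartz_bound_norm:
  assumes "\<phi> \<in> schwartz" shows "schwartz_bound n \<phi> (schwartz_norm n \<phi>)"
  unfolding schwartz_bound_def
proof (intro allI impI)
  fix j k and t :: real assume jk: "j \<le> n" "k \<le> n"
  let ?s = "\<lambda>j k. SUP t. \<bar>t ^ j * (deriv ^^ k) \<phi> t\<bar>"
  have upper: "\<bar>t ^ j * (deriv ^^ k) \<phi> t\<bar> \<le> ?s j k" for j k t
    by (rule cSUP_upper[OF UNIV_I schwartz_bdd[OF assms]])
  have nonneg: "0 \<le> ?s j k" for j k
    using upper[of 0 j k] by linarith
  have "\<bar>t ^ j * (deriv ^^ k) \<phi> t\<bar> \<le> ?s j k" by (rule upper)
  also have "\<dots> \<le> (\<Sum>k\<le>n. ?s j k)"
    using jk nonneg by (intro member_le_sum) auto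
  also have "\<dots> \<le> (\<Sum>j\<le>n. \<Sum>k\<le>n. ?s j k)"
    using jk nonneg by (intro member_le_sum[of j _ "\<lambda>j. \<Sum>k\<le>n. ?s j k"]) (auto intro!: sum_nonneg)
  finally show "\<bar>t ^ j * (deriv ^^ k) \<phi> t\<bar> \<le> schwartz_norm n \<phi>"
    by (simp add: schwartz_norm_def)
qed

lemma schwartz_norm_le:
  assumes "schwartz_bound n \<phi> B" shows "schwartz_norm n \<phi> \<le> (real n + 1)\<^sup>2 * B"
proof -
  have "(SUP t. \<bar>t ^ j * (deriv ^^ k) \<phi> t\<bar>) \<le> B" if "j \<le> n" "k \<le> n" for j k
    using assms that by (intro cSUP_least) (auto simp: schwartz_bound_def)
  then have "schwartz_norm n \<phi> \<le> (\<Sum>j\<le>n. \<Sum>k\<le>n. B)"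
    unfolding schwartz_norm_def by (intro sum_mono) auto
  then show ?thesis by (simp add: power2_eq_square algebra_simps)
qed

lemma schwartzI:
  assumes "smooth \<phi>" "\<And>n. \<exists>B. schwartz_bound n \<phi> B" shows "\<phi> \<in> schwartz"
proof -
  have "bounded (range (\<lambda>t. t ^ j * (deriv ^^ k) \<phi> t))" for j k
  proof -
    obtain B where "schwartz_bound (max j k) \<phi> B" using assms(2) by blast
    then show ?thesis by (auto simp: schwartz_bound_def bounded_iff intro!: exI[of _ B])
  qed
  then show ?thesis using assms(1) by (simp add: schwartz_def)
qed

lemma tempered_functional_iff:
  "tempered_functional G \<longleftrightarrow> linear_functional_on schwartz G \<and>
     (\<exists>C\<ge>0. \<exists>n. \<forall>\<phi>\<in>schwartz. \<forall>B. schwartz_bound n \<phi> B \<longrightarrow> \<bar>G \<phi>\<bar> \<le> C * B)"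
proof -
  have "(\<exists>C n. \<forall>\<phi>\<in>schwartz. \<bar>G \<phi>\<bar> \<le> C * schwartz_norm n \<phi>) \<longleftrightarrow>
    (\<exists>C\<ge>0. \<exists>n. \<forall>\<phi>\<in>schwartz. \<forall>B. schwartz_bound n \<phi> B \<longrightarrow> \<bar>G \<phi>\<bar> \<le> C * B)" (is "?L \<longleftrightarrow> ?R")
  proof
    assume ?L
    then obtain C n where C: "\<And>\<phi>. \<phi> \<in> schwartz \<Longrightarrow> \<bar>G \<phi>\<bar> \<le> C * schwartz_norm n \<phi>" by blast
    have "\<bar>G \<phi>\<bar> \<le> (\<bar>C\<bar> * (real n + 1)\<^sup>2) * B" if "\<phi> \<in> schwartz" "schwartz_bound n \<phi> B" for \<phi> B
    proof -
      have "0 \<le> schwartz_norm n \<phi>"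
        using schwartz_bound_nonneg[OF schwartz_bound_norm[OF that(1)]] .
      then have "\<bar>G \<phi>\<bar> \<le> \<bar>C\<bar> * schwartz_norm n \<phi>"
        using C[OF that(1)] mult_right_mono[of C "\<bar>C\<bar>" "schwartz_norm n \<phi>"] by linarith
      also have "\<dots> \<le> \<bar>C\<bar> * ((real n + 1)\<^sup>2 * B)"
        by (intro mult_left_mono schwartz_norm_le that) auto
      finally show ?thesis by (simp add: mult.assoc)
    qed
    then show ?R by (intro exI[of _ "\<bar>C\<bar> * (real n + 1)\<^sup>2"] conjI exI[of _ n]) auto
  next
    assume ?R
    then show ?L using schwartz_bound_norm by blast
  qed
  then show ?thesis by (simp add: tempered_functional_def)
qed

lemma tempered_functionalE:
  assumes "tempered_functional G"
  obtains C n where "C \<ge> 0" "\<And>\<phi> B. \<phi> \<in> schwartz \<Longrightarrow> schwartz_bound n \<phi> B \<Longrightarrow> \<bar>G \<phi>\<bar> \<le> C * B"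
  using assms unfolding tempered_functional_iff by blast

lemma tempered_add:
  "tempered_functional G \<Longrightarrow> \<phi> \<in> schwartz \<Longrightarrow> \<psi> \<in> schwartz \<Longrightarrow> G (\<lambda>t. \<phi> t + \<psi> t) = G \<phi> + G \<psi>"
  by (simp add: tempered_functional_def linear_functional_on_def)

lemma tempered_cmult:
  "tempered_functional G \<Longrightarrow> \<phi> \<in> schwartz \<Longrightarrow> G (\<lambda>t. c * \<phi> t) = c * G \<phi>"
  by (simp add: tempered_functional_def linear_functional_on_def)

lemma schwartz_bound_add:
  assumes "smooth \<phi>" "smooth \<psi>" "schwartz_bound n \<phi> A" "schwartz_bound n \<psi> B"
  shows "schwartz_bound n (\<lambda>t. \<phi> t + \<psi> t) (A + B)"
proof (rule schwartz_boundI)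
  fix j k and t :: real assume jk: "j \<le> n" "k \<le> n"
  have "\<bar>t\<bar> ^ j * \<bar>(deriv ^^ k) (\<lambda>t. \<phi> t + \<psi> t) t\<bar>
      \<le> \<bar>t\<bar> ^ j * (\<bar>(deriv ^^ k) \<phi> t\<bar> + \<bar>(deriv ^^ k) \<psi> t\<bar>)"
    unfolding smooth_funpow_deriv_add[OF assms(1,2)] by (intro mult_left_mono abs_triangle_ineq) auto
  then show "\<bar>t\<bar> ^ j * \<bar>(deriv ^^ k) (\<lambda>t. \<phi> t + \<psi> t) t\<bar> \<le> A + B"
    using schwartz_boundD[OF assms(3) jk, of t] schwartz_boundD[OF assms(4) jk, of t]
    by (simp add: distrib_left)
qed

lemma schwartz_add:
  assumes "\<phi> \<in> schwartz" "\<psi> \<in> schwartz" shows "(\<lambda>t. \<phi> t + \<psi> t) \<in> schwartz"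
proof (rule schwartzI)
  show "smooth (\<lambda>t. \<phi> t + \<psi> t)" using assms by (simp add: smooth_add schwartz_smooth)
  show "\<exists>B. schwartz_bound n (\<lambda>t. \<phi> t + \<psi> t) B" for n
    using schwartz_bound_add[OF schwartz_smooth schwartz_smooth schwartz_bound_norm schwartz_bound_norm, OF assms assms]
    by blast
qed

text \<open>The power \<open>q\<close> lets a multiplier that is small relative to \<open>\<bar>t\<bar> ^ q\<close> only far from the origin
  still count as small.\<close>

lemma schwartz_bound_mult:
  assumes "smooth \<mu>" "smooth \<phi>" "schwartz_bound (n + q) \<phi> B" "M \<ge> 0"
    and M: "\<And>i t. i \<le> n \<Longrightarrow> \<bar>(deriv ^^ i) \<mu> t\<bar> \<le> M * \<bar>t\<bar> ^ q"
  shows "schwartz_bound n (\<lambda>t. \<mu> t * \<phi> t) (2 ^ n * (M * B))"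
proof (rule schwartz_boundI)
  fix j k and t :: real assume jk: "j \<le> n" "k \<le> n"
  have B: "B \<ge> 0" using assms(3) by (rule schwartz_bound_nonneg)
  have "\<bar>t\<bar> ^ j * \<bar>(deriv ^^ k) (\<lambda>t. \<mu> t * \<phi> t) t\<bar> \<le> 2 ^ k * (M * B)"
  proof (rule funpow_deriv_mult_bound[OF assms(1,2)])
    fix i assume i: "i \<le> k"
    have "\<bar>t\<bar> ^ j * (\<bar>(deriv ^^ i) \<mu> t\<bar> * \<bar>(deriv ^^ (k - i)) \<phi> t\<bar>)
        \<le> \<bar>t\<bar> ^ j * ((M * \<bar>t\<bar> ^ q) * \<bar>(deriv ^^ (k - i)) \<phi> t\<bar>)"
      using i jk by (intro mult_left_mono mult_right_mono M) auto
    also have "\<dots> = M * (\<bar>t\<bar> ^ (j + q) * \<bar>(deriv ^^ (k - i)) \<phi> t\<bar>)"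
      by (simp add: power_add ac_simps)
    also have "\<dots> \<le> M * B"
      using jk by (intro mult_left_mono schwartz_boundD[OF assms(3)] assms(4)) auto
    finally show "\<bar>t\<bar> ^ j * (\<bar>(deriv ^^ i) \<mu> t\<bar> * \<bar>(deriv ^^ (k - i)) \<phi> t\<bar>) \<le> M * B" .
  qed simp
  also have "\<dots> \<le> 2 ^ n * (M * B)"
    using jk B assms(4) by (intro mult_right_mono power_increasing) auto
  finally show "\<bar>t\<bar> ^ j * \<bar>(deriv ^^ k) (\<lambda>t. \<mu> t * \<phi> t) t\<bar> \<le> 2 ^ n * (M * B)" .
qed

definition bounded_smooth :: "(real \<Rightarrow> real) \<Rightarrow> bool" where
  "bounded_smooth \<mu> \<longleftrightarrow> smooth \<mu> \<and> (\<forall>n. \<exists>M\<ge>0. \<forall>k\<le>n. \<forall>t. \<bar>(deriv ^^ k) \<mu> t\<bar> \<le> M)"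

lemma bounded_smooth_schwartz_bound:
  assumes "bounded_smooth \<mu>"
  obtains M where "M \<ge> 0" "\<And>\<phi> B. smooth \<phi> \<Longrightarrow> schwartz_bound n \<phi> B \<Longrightarrow>
    schwartz_bound n (\<lambda>t. \<mu> t * \<phi> t) (M * B)"
proof -
  obtain M where M: "M \<ge> 0" "\<forall>k\<le>n. \<forall>t. \<bar>(deriv ^^ k) \<mu> t\<bar> \<le> M"
    using assms unfolding bounded_smooth_def by blast
  show thesis
  proof (rule that[of "2 ^ n * M"])
    fix \<phi> B assume "smooth \<phi>" "schwartz_bound n \<phi> B"
    then show "schwartz_bound n (\<lambda>t. \<mu> t * \<phi> t) (2 ^ n * M * B)"
      using schwartz_bound_mult[of \<mu> \<phi> n 0 B M] assms M by (simp add: bounded_smooth_def mult.assoc)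
  qed (use M in simp)
qed

lemma schwartz_mult:
  assumes "bounded_smooth \<mu>" "\<phi> \<in> schwartz" shows "(\<lambda>t. \<mu> t * \<phi> t) \<in> schwartz"
proof (rule schwartzI)
  show "smooth (\<lambda>t. \<mu> t * \<phi> t)"
    using assms(1) by (intro smooth_mult schwartz_smooth[OF assms(2)]) (simp add: bounded_smooth_def)
  fix n
  obtain M where "\<And>\<phi> B. smooth \<phi> \<Longrightarrow> schwartz_bound n \<phi> B \<Longrightarrow>
    schwartz_bound n (\<lambda>t. \<mu> t * \<phi> t) (M * B)"
    using bounded_smooth_schwartz_bound[OF assms(1), of n] by blast
  then show "\<exists>B. schwartz_bound n (\<lambda>t. \<mu> t * \<phi> t) B"
    using schwartz_bound_norm[OF assms(2)] schwartz_smooth[OF assms(2)] by blast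
qed

lemma bounded_smooth_const: "bounded_smooth (\<lambda>_. c)"
  unfolding bounded_smooth_def
  by (auto simp: funpow_deriv_const intro!: smooth_const exI[of _ "\<bar>c\<bar>"])

lemma schwartz_cmult: "\<phi> \<in> schwartz \<Longrightarrow> (\<lambda>t. c * \<phi> t) \<in> schwartz"
  by (rule schwartz_mult[OF bounded_smooth_const])

lemma schwartz_diff: "\<phi> \<in> schwartz \<Longrightarrow> \<psi> \<in> schwartz \<Longrightarrow> (\<lambda>t. \<phi> t - \<psi> t) \<in> schwartz"
  using schwartz_add[of \<phi> "\<lambda>t. -1 * \<psi> t"] schwartz_cmult[of \<psi> "-1"] by simp

lemma tempered_diff:
  "tempered_functional G \<Longrightarrow> \<phi> \<in> schwartz \<Longrightarrow> \<psi> \<in> schwartz \<Longrightarrow> G (\<lambda>t. \<phi> t - \<psi> t) = G \<phi> - G \<psi>"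
  using tempered_add[of G \<phi> "\<lambda>t. -1 * \<psi> t"] tempered_cmult[of G \<psi> "-1"] schwartz_cmult[of \<psi> "-1"]
  by simp

lemma schwartz_bound_deriv: "schwartz_bound (Suc n) \<phi> B \<Longrightarrow> schwartz_bound n (deriv \<phi>) B"
  by (rule schwartz_boundI)
    (use schwartz_boundD[of "Suc n" \<phi> B _ "Suc _"] in \<open>simp add: funpow_swap1\<close>)

lemma schwartz_deriv:
  assumes "\<phi> \<in> schwartz" shows "deriv \<phi> \<in> schwartz"
proof (rule schwartzI)
  show "smooth (deriv \<phi>)" using assms by (simp add: smooth_deriv schwartz_smooth)
  show "\<exists>B. schwartz_bound n (deriv \<phi>) B" for n
    using schwartz_bound_deriv[OF schwartz_bound_norm[OF assms]] by blast
qed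

lemma funpow_deriv_vanish_outside:
  assumes "\<And>t. \<bar>t\<bar> > R \<Longrightarrow> \<phi> t = 0" "\<bar>t\<bar> > R" shows "(deriv ^^ k) \<phi> t = (0::real)"
proof -
  have "(deriv ^^ k) \<phi> t = (deriv ^^ k) (\<lambda>_. 0) t"
    by (rule funpow_deriv_eventually_cong[of "{t. \<bar>t\<bar> > R}"])
       (use assms in \<open>auto intro!: open_Collect_less continuous_intros\<close>)
  then show ?thesis by (simp add: funpow_deriv_const)
qed

lemma funpow_deriv_le_Cn_norm:
  assumes "\<phi> \<in> test_functions" "k \<le> n" shows "\<bar>(deriv ^^ k) \<phi> t\<bar> \<le> Cn_norm n \<phi>"
proof -
  have "\<bar>(deriv ^^ k) \<phi> t\<bar> \<le> (SUP t. \<bar>(deriv ^^ k) \<phi> t\<bar>)"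
    by (rule cSUP_upper[OF UNIV_I test_functions_bdd[OF test_functions_funpow_deriv[OF assms(1)]]])
  also have "\<dots> \<le> Cn_norm n \<phi>"
    unfolding Cn_norm_def using assms
    by (intro member_le_sum[of k _ "\<lambda>k. SUP t. \<bar>(deriv ^^ k) \<phi> t\<bar>"]) (auto intro: test_functions_sup_nonneg)
  finally show ?thesis .
qed

lemma funpow_deriv_exp: "(deriv ^^ k) (\<lambda>t. exp (\<sigma> * t)) = (\<lambda>t::real. \<sigma> ^ k * exp (\<sigma> * t))"
proof (induction k)
  case (Suc k)
  have "deriv (\<lambda>t. \<sigma> ^ k * exp (\<sigma> * t)) t = \<sigma> ^ Suc k * exp (\<sigma> * t)" for t
    by (rule DERIV_imp_deriv) (auto intro!: derivative_eq_intros)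
  then show ?case by (simp add: Suc fun_eq_iff)
qed simp

lemma smooth_exp: "smooth (\<lambda>t. exp (\<sigma> * t))"
proof -
  have "((\<lambda>t. \<sigma> ^ k * exp (\<sigma> * t)) has_real_derivative \<sigma> ^ k * (exp (\<sigma> * t) * \<sigma>)) (at t)" for k t
    by (auto intro!: derivative_eq_intros)
  then show ?thesis unfolding smooth_def funpow_deriv_exp real_differentiable_def by blast
qed

lemma schwartz_bound_exp_test:
  assumes \<phi>: "\<phi> \<in> test_functions" and R: "R \<ge> 1" "\<And>t. \<bar>t\<bar> > R \<Longrightarrow> \<phi> t = 0"
  shows "schwartz_bound n (\<lambda>t. exp (\<sigma> * t) * \<phi> t)
    (2 ^ n * (R ^ n * ((1 + \<bar>\<sigma>\<bar>) ^ n * exp (\<bar>\<sigma>\<bar> * R)) * Cn_norm n \<phi>))"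
proof (rule schwartz_boundI)
  fix j k and t :: real assume jk: "j \<le> n" "k \<le> n"
  let ?c = "R ^ n * ((1 + \<bar>\<sigma>\<bar>) ^ n * exp (\<bar>\<sigma>\<bar> * R)) * Cn_norm n \<phi>"
  have c: "0 \<le> ?c" using R(1) Cn_norm_nonneg[OF \<phi>] by simp
  have "\<bar>t\<bar> ^ j * \<bar>(deriv ^^ k) (\<lambda>t. exp (\<sigma> * t) * \<phi> t) t\<bar> \<le> 2 ^ k * ?c"
  proof (rule funpow_deriv_mult_bound[OF smooth_exp test_smooth[OF \<phi>]])
    fix i assume i: "i \<le> k"
    show "\<bar>t\<bar> ^ j * (\<bar>(deriv ^^ i) (\<lambda>t. exp (\<sigma> * t)) t\<bar> * \<bar>(deriv ^^ (k - i)) \<phi> t\<bar>) \<le> ?c"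
    proof (cases "\<bar>t\<bar> > R")
      case True
      then have "(deriv ^^ (k - i)) \<phi> t = 0" using R(2) by (rule funpow_deriv_vanish_outside[rotated])
      then show ?thesis using c by simp
    next
      case False
      have "\<bar>t\<bar> ^ j \<le> R ^ j" using False by (intro power_mono) auto
      also have "\<dots> \<le> R ^ n" using R(1) jk by (intro power_increasing) auto
      finally have 1: "\<bar>t\<bar> ^ j \<le> R ^ n" .
      have "\<bar>\<sigma>\<bar> ^ i \<le> (1 + \<bar>\<sigma>\<bar>) ^ i" by (intro power_mono) auto
      also have "\<dots> \<le> (1 + \<bar>\<sigma>\<bar>) ^ n" using i jk by (intro power_increasing) auto
      finally have 2: "\<bar>\<sigma>\<bar> ^ i \<le> (1 + \<bar>\<sigma>\<bar>) ^ n" .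
      have "\<sigma> * t \<le> \<bar>\<sigma>\<bar> * \<bar>t\<bar>" by (metis abs_ge_self abs_mult)
      also have "\<dots> \<le> \<bar>\<sigma>\<bar> * R" using False by (intro mult_left_mono) auto
      finally have 3: "exp (\<sigma> * t) \<le> exp (\<bar>\<sigma>\<bar> * R)" by simp
      have 4: "\<bar>(deriv ^^ i) (\<lambda>t. exp (\<sigma> * t)) t\<bar> \<le> (1 + \<bar>\<sigma>\<bar>) ^ n * exp (\<bar>\<sigma>\<bar> * R)"
        unfolding funpow_deriv_exp abs_mult power_abs using 2 3 by (intro mult_mono) auto
      have 5: "\<bar>(deriv ^^ (k - i)) \<phi> t\<bar> \<le> Cn_norm n \<phi>"
        using jk by (intro funpow_deriv_le_Cn_norm \<phi>) auto
      have "\<bar>t\<bar> ^ j * (\<bar>(deriv ^^ i) (\<lambda>t. exp (\<sigma> * t)) t\<bar> * \<bar>(deriv ^^ (k - i)) \<phi> t\<bar>)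
          \<le> R ^ n * (((1 + \<bar>\<sigma>\<bar>) ^ n * exp (\<bar>\<sigma>\<bar> * R)) * Cn_norm n \<phi>)"
        using 1 4 5 R(1) by (intro mult_mono) auto
      then show ?thesis by (simp add: mult.assoc)
    qed
  qed simp
  also have "\<dots> \<le> 2 ^ n * ?c"
    using jk c by (intro mult_right_mono power_increasing) auto
  finally show "\<bar>t\<bar> ^ j * \<bar>(deriv ^^ k) (\<lambda>t. exp (\<sigma> * t) * \<phi> t) t\<bar> \<le> 2 ^ n * ?c" .
qed

lemma test_functions_exp: "\<phi> \<in> test_functions \<Longrightarrow> (\<lambda>t. exp (\<sigma> * t) * \<phi> t) \<in> test_functions"
  by (intro test_functions_mult_smooth smooth_exp)

lemma test_imp_schwartz:
  assumes "\<phi> \<in> test_functions" shows "\<phi> \<in> schwartz"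
proof (rule schwartzI)
  obtain R where R: "R > 0" "\<And>t. \<bar>t\<bar> > R \<Longrightarrow> \<phi> t = 0"
    using test_functions_vanishE[OF assms] by blast
  show "\<exists>B. schwartz_bound n \<phi> B" for n
    using schwartz_bound_exp_test[OF assms, of "max 1 R" n 0] R(2) by auto
qed (rule test_smooth[OF assms])

lemma is_distribution_tempered:
  assumes G: "tempered_functional G"
  shows "is_distribution (\<lambda>\<phi>. if \<phi> \<in> test_functions then G (\<lambda>t. exp (\<sigma> * t) * \<phi> t) else 0)"
    (is "is_distribution ?T")
proof (rule is_distributionI)
  have S: "(\<lambda>t. exp (\<sigma> * t) * \<phi> t) \<in> schwartz" if "\<phi> \<in> test_functions" for \<phi>
    using that by (intro test_imp_schwartz test_functions_exp)
  show "linear_functional_on test_functions ?T"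
    unfolding linear_functional_on_def
  proof (intro conjI ballI allI)
    fix \<phi> \<psi> assume \<phi>: "\<phi> \<in> test_functions" and \<psi>: "\<psi> \<in> test_functions"
    then show "?T (\<lambda>t. \<phi> t + \<psi> t) = ?T \<phi> + ?T \<psi>"
      using tempered_add[OF G S[OF \<phi>] S[OF \<psi>]] test_functions_add[OF \<phi> \<psi>]
      by (simp add: distrib_left)
  next
    fix c \<phi> assume \<phi>: "\<phi> \<in> test_functions"
    then show "?T (\<lambda>t. c * \<phi> t) = c * ?T \<phi>"
      using tempered_cmult[OF G S[OF \<phi>], of c] test_functions_cmult[OF \<phi>, of c]
      by (simp add: mult.left_commute)
  qed
  fix K :: "real set" assume "compact K"
  then obtain R where R: "\<forall>t\<in>K. \<bar>t\<bar> \<le> R" using compact_imp_bounded[of K] by (auto simp: bounded_iff)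
  obtain C n where C: "C \<ge> 0" "\<And>\<phi> B. \<phi> \<in> schwartz \<Longrightarrow> schwartz_bound n \<phi> B \<Longrightarrow> \<bar>G \<phi>\<bar> \<le> C * B"
    using tempered_functionalE[OF G] by blast
  let ?R = "max 1 R"
  have "\<bar>?T \<phi>\<bar> \<le> (C * (2 ^ n * (?R ^ n * ((1 + \<bar>\<sigma>\<bar>) ^ n * exp (\<bar>\<sigma>\<bar> * ?R))))) * Cn_norm n \<phi>"
    if \<phi>: "\<phi> \<in> test_functions" "supp \<phi> \<subseteq> K" for \<phi>
  proof -
    have "\<phi> t = 0" if "\<bar>t\<bar> > ?R" for t
      using that \<phi>(2) R by (intro not_in_supp) force
    from C(2)[OF S[OF \<phi>(1)] schwartz_bound_exp_test[OF \<phi>(1) _ this]]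
    show ?thesis using \<phi> by (simp add: mult.assoc)
  qed
  then show "\<exists>C n. \<forall>\<phi>\<in>test_functions. supp \<phi> \<subseteq> K \<longrightarrow> \<bar>?T \<phi>\<bar> \<le> C * Cn_norm n \<phi>" by blast
qed simp

text \<open>Test functions are dense in the Schwartz space: cutting off at distance \<open>R\<close> costs a seminorm one
  power of \<open>t\<close> more, divided by \<open>R\<close>.\<close>

lemma tempered_eq_0:
  assumes G: "tempered_functional G" and 0: "\<And>\<phi>. \<phi> \<in> test_functions \<Longrightarrow> G \<phi> = 0"
    and \<phi>: "\<phi> \<in> schwartz"
  shows "G \<phi> = 0"
proof -
  obtain C n where C: "C \<ge> 0" "\<And>\<phi> B. \<phi> \<in> schwartz \<Longrightarrow> schwartz_bound n \<phi> B \<Longrightarrow> \<bar>G \<phi>\<bar> \<le> C * B"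
    using tempered_functionalE[OF G] by blast
  obtain B where B: "\<forall>k\<le>n. \<forall>t. \<bar>(deriv ^^ k) plateau t\<bar> \<le> B"
    using test_functions_deriv_bounded[OF test_functions_plateau] by blast
  have B0: "B \<ge> 0" using B[rule_format, of 0 0] by linarith
  define A where "A = schwartz_norm (n + 1) \<phi>"
  have bound: "\<bar>G \<phi>\<bar> \<le> C * (2 ^ n * ((1 + B) * A)) / R" if R: "R \<ge> 1" for R
  proof -
    define \<rho> where "\<rho> t = plateau ((1 / R) * t + 0)" for t
    have \<rho>: "smooth \<rho>" unfolding \<rho>_def[abs_def] by (rule smooth_affine[OF smooth_plateau])
    have \<rho>_test: "(\<lambda>t. \<rho> t * \<phi> t) \<in> test_functions"
    proof (rule test_functions_vanishI[of _ "-2 * R" "2 * R"])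
      show "smooth (\<lambda>t. \<rho> t * \<phi> t)" by (intro smooth_mult \<rho> schwartz_smooth \<phi>)
      have "\<rho> t = 0" if "\<bar>t\<bar> > 2 * R" for t
        unfolding \<rho>_def using that R by (intro plateau_eq_0) (simp add: abs_mult field_simps)
      then show "\<rho> t * \<phi> t = 0" if "t < - 2 * R" for t using that R by simp
      show "\<rho> t * \<phi> t = 0" if "t > 2 * R" for t
        using that R \<open>\<And>t. \<bar>t\<bar> > 2 * R \<Longrightarrow> \<rho> t = 0\<close> by simp
    qed
    have \<mu>: "smooth (\<lambda>t. 1 - \<rho> t)" by (intro smooth_diff smooth_const \<rho>)
    have "\<bar>(deriv ^^ i) (\<lambda>t. 1 - \<rho> t) t\<bar> \<le> ((1 + B) / R) * \<bar>t\<bar> ^ 1" if i: "i \<le> n" for i t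
    proof (cases "\<bar>t\<bar> < R")
      case True
      have "(deriv ^^ i) (\<lambda>t. 1 - \<rho> t) t = (deriv ^^ i) (\<lambda>_. 0) t"
      proof (rule funpow_deriv_eventually_cong[of "{- R <..< R}"])
        fix t assume "t \<in> {- R <..< R}"
        then have "\<bar>(1 / R) * t + 0\<bar> \<le> 1" using R by (simp add: abs_if field_simps)
        then show "1 - \<rho> t = 0" unfolding \<rho>_def by (simp add: plateau_eq_1)
      qed (use True in auto)
      then show ?thesis using B0 R by (simp add: funpow_deriv_const)
    next
      case False
      have "(deriv ^^ i) (\<lambda>t. 1 - \<rho> t) t = (deriv ^^ i) (\<lambda>_. 1) t + -1 * (deriv ^^ i) \<rho> t"
        using smooth_funpow_deriv_add[OF smooth_const smooth_cmult[OF \<rho>], of i 1 "-1"]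
          smooth_funpow_deriv_cmult[OF \<rho>, of i "-1"] by simp
      also have "\<bar>\<dots>\<bar> \<le> 1 + \<bar>(deriv ^^ i) \<rho> t\<bar>" by (auto simp: funpow_deriv_const)
      also have "\<bar>(deriv ^^ i) \<rho> t\<bar> \<le> 1 * B"
        unfolding \<rho>_def[abs_def] funpow_deriv_affine[OF smooth_plateau] abs_mult
        using R B i by (intro mult_mono) (auto simp: power_le_one divide_le_eq)
      also have "1 + 1 * B \<le> (1 + B) * (\<bar>t\<bar> / R)"
        using False R B0 mult_left_mono[of 1 "\<bar>t\<bar> / R" "1 + B"] by simp
      finally show ?thesis by simp
    qed
    then have "schwartz_bound n (\<lambda>t. (1 - \<rho> t) * \<phi> t) (2 ^ n * (((1 + B) / R) * A))"
      using R B0 unfolding A_def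
      by (intro schwartz_bound_mult[OF \<mu> schwartz_smooth[OF \<phi>] schwartz_bound_norm[OF \<phi>]]) auto
    moreover have eq: "(\<lambda>t. (1 - \<rho> t) * \<phi> t) = (\<lambda>t. \<phi> t - \<rho> t * \<phi> t)" by (simp add: algebra_simps)
    moreover have "(\<lambda>t. \<phi> t - \<rho> t * \<phi> t) \<in> schwartz"
      by (intro schwartz_diff \<phi> test_imp_schwartz \<rho>_test)
    ultimately have "\<bar>G (\<lambda>t. \<phi> t - \<rho> t * \<phi> t)\<bar> \<le> C * (2 ^ n * (((1 + B) / R) * A))"
      by (intro C(2)) auto
    moreover have "G (\<lambda>t. \<phi> t - \<rho> t * \<phi> t) = G \<phi>"
      using tempered_diff[OF G \<phi> test_imp_schwartz[OF \<rho>_test]] 0[OF \<rho>_test] by simp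
    ultimately show ?thesis by simp
  qed
  have "((\<lambda>R. C * (2 ^ n * ((1 + B) * A)) / R) \<longlongrightarrow> 0) at_top"
    by (intro tendsto_divide_0[OF tendsto_const] filterlim_at_top_imp_at_infinity filterlim_ident)
  then have "\<bar>G \<phi>\<bar> \<le> 0"
    by (rule tendsto_lowerbound) (auto intro!: bound eventually_mono[OF eventually_ge_at_top[of 1]])
  then show ?thesis by simp
qed
section \<open>Bounded multipliers and cut-off exponentials\<close>

lemma bounded_smoothI:
  assumes "smooth \<mu>" "\<And>n. \<exists>M. \<forall>k\<le>n. \<forall>t. \<bar>(deriv ^^ k) \<mu> t\<bar> \<le> M"
  shows "bounded_smooth \<mu>"
proof -
  have "\<exists>M\<ge>0. \<forall>k\<le>n. \<forall>t. \<bar>(deriv ^^ k) \<mu> t\<bar> \<le> M" for n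
  proof -
    obtain M where M: "\<forall>k\<le>n. \<forall>t. \<bar>(deriv ^^ k) \<mu> t\<bar> \<le> M" using assms(2) by blast
    have "\<bar>\<mu> 0\<bar> \<le> M" using M[rule_format, of 0 0] by simp
    then show ?thesis using M by (intro exI[of _ M]) auto
  qed
  then show ?thesis using assms(1) by (simp add: bounded_smooth_def)
qed

lemma bounded_smooth_smooth: "bounded_smooth \<mu> \<Longrightarrow> smooth \<mu>"
  by (simp add: bounded_smooth_def)

lemma bounded_smooth_causal_cutoff: "bounded_smooth causal_cutoff"
  using causal_cutoff_deriv_bounded by (intro bounded_smoothI smooth_causal_cutoff) blast

lemma schwartz_bounded_smooth:
  assumes "\<phi> \<in> schwartz" shows "bounded_smooth \<phi>"
proof (rule bounded_smoothI[OF schwartz_smooth[OF assms]])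
  fix n
  have "\<bar>(deriv ^^ k) \<phi> t\<bar> \<le> schwartz_norm n \<phi>" if "k \<le> n" for k t
    using schwartz_boundD[OF schwartz_bound_norm[OF assms], of 0 n k t] that by simp
  then show "\<exists>M. \<forall>k\<le>n. \<forall>t. \<bar>(deriv ^^ k) \<phi> t\<bar> \<le> M" by blast
qed

lemma bounded_smooth_one_minus_affine:
  assumes "bounded_smooth \<mu>" shows "bounded_smooth (\<lambda>t. 1 - \<mu> (a * t + b))"
proof (rule bounded_smoothI)
  have \<mu>: "smooth \<mu>" using assms by (rule bounded_smooth_smooth)
  show "smooth (\<lambda>t. 1 - \<mu> (a * t + b))" by (intro smooth_diff smooth_const smooth_affine \<mu>)
  fix n
  obtain M where M: "M \<ge> 0" "\<forall>k\<le>n. \<forall>t. \<bar>(deriv ^^ k) \<mu> t\<bar> \<le> M"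
    using assms unfolding bounded_smooth_def by blast
  have "\<bar>(deriv ^^ k) (\<lambda>t. 1 - \<mu> (a * t + b)) t\<bar> \<le> 1 + (1 + \<bar>a\<bar>) ^ n * M" if "k \<le> n" for k t
  proof -
    have "(deriv ^^ k) (\<lambda>t. 1 - \<mu> (a * t + b)) t = (deriv ^^ k) (\<lambda>_. 1) t + -1 * (a ^ k * (deriv ^^ k) \<mu> (a * t + b))"
      using smooth_funpow_deriv_add[OF smooth_const smooth_cmult[OF smooth_affine[OF \<mu>]], of k 1 "-1" a b]
        smooth_funpow_deriv_cmult[OF smooth_affine[OF \<mu>], of k "-1" a b]
      by (simp add: funpow_deriv_affine[OF \<mu>])
    also have "\<bar>\<dots>\<bar> \<le> 1 + \<bar>a ^ k * (deriv ^^ k) \<mu> (a * t + b)\<bar>" by (auto simp: funpow_deriv_const)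
    also have "\<bar>a ^ k * (deriv ^^ k) \<mu> (a * t + b)\<bar> \<le> (1 + \<bar>a\<bar>) ^ n * M"
    proof -
      have "\<bar>a\<bar> ^ k \<le> (1 + \<bar>a\<bar>) ^ k" by (intro power_mono) auto
      also have "\<dots> \<le> (1 + \<bar>a\<bar>) ^ n" using that by (intro power_increasing) auto
      finally show ?thesis unfolding abs_mult power_abs using M that by (intro mult_mono) auto
    qed
    finally show ?thesis by simp
  qed
  then show "\<exists>M. \<forall>k\<le>n. \<forall>t. \<bar>(deriv ^^ k) (\<lambda>t. 1 - \<mu> (a * t + b)) t\<bar> \<le> M" by blast
qed

lemma power_le_fact_exp:
  fixes x :: real
  assumes "x \<ge> 0" shows "x ^ n \<le> fact n * exp x"
proof -
  have "x ^ n /\<^sub>R fact n = (\<Sum>i\<in>{n}. x ^ i /\<^sub>R fact i)" by simp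
  also have "\<dots> \<le> (\<Sum>i. x ^ i /\<^sub>R fact i)"
    using assms by (intro sum_le_suminf summable_exp_generic) auto
  finally show ?thesis by (simp add: exp_def divide_inverse[symmetric] field_simps)
qed

text \<open>The shift by \<open>2\<close> in the proof makes the base of the power at least \<open>1\<close>, so that the highest power
  dominates all the others.\<close>

lemma power_exp_decay_bounded:
  assumes "\<alpha> > 0"
  obtains D :: real where "D \<ge> 0" "\<And>j t. j \<le> n \<Longrightarrow> t \<ge> -1 \<Longrightarrow> \<bar>t\<bar> ^ j * exp (- \<alpha> * t) \<le> D"
proof (rule that[of "fact n * exp (2 * \<alpha>) / \<alpha> ^ n"])
  fix j :: nat and t :: real assume j: "j \<le> n" and t: "t \<ge> -1"
  have "\<bar>t\<bar> ^ j \<le> (t + 2) ^ j" using t by (intro power_mono) auto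
  also have "\<dots> \<le> (t + 2) ^ n" using t j by (intro power_increasing) auto
  also have "(t + 2) ^ n \<le> fact n * exp (\<alpha> * (t + 2)) / \<alpha> ^ n"
  proof -
    have "\<alpha> ^ n * (t + 2) ^ n \<le> fact n * exp (\<alpha> * (t + 2))"
      unfolding power_mult_distrib[symmetric] using assms t by (intro power_le_fact_exp) auto
    then show ?thesis using assms by (simp add: pos_le_divide_eq mult.commute)
  qed
  finally have "\<bar>t\<bar> ^ j * exp (- \<alpha> * t) \<le> fact n * exp (\<alpha> * (t + 2)) / \<alpha> ^ n * exp (- \<alpha> * t)"
    by (intro mult_right_mono) auto
  also have "\<dots> = fact n * (exp (\<alpha> * (t + 2)) * exp (- \<alpha> * t)) / \<alpha> ^ n" by simp
  also have "exp (\<alpha> * (t + 2)) * exp (- \<alpha> * t) = exp (2 * \<alpha>)"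
    unfolding exp_add[symmetric] by (simp add: algebra_simps)
  finally show "\<bar>t\<bar> ^ j * exp (- \<alpha> * t) \<le> fact n * exp (2 * \<alpha>) / \<alpha> ^ n" .
qed (use assms in auto)

text \<open>Smooth functions that decay exponentially to the right become Schwartz functions once their left
  half is cut off, with constants depending on the decay rate and the order only.\<close>

lemma schwartz_bound_cutoff:
  assumes "\<alpha> > 0"
  obtains C where "C \<ge> 0" "\<And>f B. smooth f \<Longrightarrow> B \<ge> 0 \<Longrightarrow>
    (\<And>k t. k \<le> n \<Longrightarrow> t \<ge> -1 \<Longrightarrow> \<bar>(deriv ^^ k) f t\<bar> \<le> B * exp (- \<alpha> * t)) \<Longrightarrow>
    schwartz_bound n (\<lambda>t. causal_cutoff t * f t) (C * B)"
proof -
  obtain M where M: "M \<ge> 0" "\<forall>k\<le>n. \<forall>t. \<bar>(deriv ^^ k) causal_cutoff t\<bar> \<le> M"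
    using bounded_smooth_causal_cutoff unfolding bounded_smooth_def by blast
  obtain D where D: "D \<ge> 0" "\<And>j t. j \<le> n \<Longrightarrow> t \<ge> -1 \<Longrightarrow> \<bar>t\<bar> ^ j * exp (- \<alpha> * t) \<le> D"
    using power_exp_decay_bounded[OF assms, of n] by blast
  show thesis
  proof (rule that[of "2 ^ n * (M * D)"])
    fix f :: "real \<Rightarrow> real" and B :: real
    assume f: "smooth f" and B: "B \<ge> 0"
      and bound: "\<And>k t. k \<le> n \<Longrightarrow> t \<ge> -1 \<Longrightarrow> \<bar>(deriv ^^ k) f t\<bar> \<le> B * exp (- \<alpha> * t)"
    show "schwartz_bound n (\<lambda>t. causal_cutoff t * f t) (2 ^ n * (M * D) * B)"
    proof (rule schwartz_boundI)
      fix j k and t :: real assume jk: "j \<le> n" "k \<le> n"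
      show "\<bar>t\<bar> ^ j * \<bar>(deriv ^^ k) (\<lambda>t. causal_cutoff t * f t) t\<bar> \<le> 2 ^ n * (M * D) * B"
      proof (cases "t < -1")
        case True
        have "(deriv ^^ k) (\<lambda>t. causal_cutoff t * f t) t = (deriv ^^ k) (\<lambda>_. 0) t"
          by (rule funpow_deriv_eventually_cong[of "{..< -1}"]) (use True causal_cutoff_eq_0 in auto)
        then show ?thesis using M D B by (simp add: funpow_deriv_const)
      next
        case False
        have "\<bar>t\<bar> ^ j * \<bar>(deriv ^^ k) (\<lambda>t. causal_cutoff t * f t) t\<bar> \<le> 2 ^ k * (M * D * B)"
        proof (rule funpow_deriv_mult_bound[OF smooth_causal_cutoff f])
          fix i assume i: "i \<le> k"
          have "\<bar>t\<bar> ^ j * (\<bar>(deriv ^^ i) causal_cutoff t\<bar> * \<bar>(deriv ^^ (k - i)) f t\<bar>)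
            \<le> \<bar>t\<bar> ^ j * (M * (B * exp (- \<alpha> * t)))"
            using i jk M B False by (intro mult_left_mono mult_mono bound) auto
          also have "\<dots> = M * B * (\<bar>t\<bar> ^ j * exp (- \<alpha> * t))" by simp
          also have "\<dots> \<le> M * B * D" using M B False jk by (intro mult_left_mono D) auto
          finally show "\<bar>t\<bar> ^ j * (\<bar>(deriv ^^ i) causal_cutoff t\<bar> * \<bar>(deriv ^^ (k - i)) f t\<bar>) \<le> M * D * B"
            by (simp add: ac_simps)
        qed simp
        also have "\<dots> \<le> 2 ^ n * (M * D * B)"
          using jk M D B by (intro mult_right_mono power_increasing) auto
        finally show ?thesis by (simp add: mult.assoc)
      qed
    qed
  qed (use M D in simp)
qed

text \<open>Real parts of complex exponentials: real and imaginary parts of the Laplace kernel and all their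
  derivatives are in this family.\<close>

definition re_exp :: "complex \<Rightarrow> complex \<Rightarrow> real \<Rightarrow> real" where
  "re_exp w z t = Re (w * exp (z * of_real t))"

lemma re_exp_deriv: "(re_exp w z has_real_derivative re_exp (w * z) z t) (at t)"
proof -
  have "((\<lambda>t. w * exp (z * of_real t)) has_vector_derivative w * z * exp (z * of_real t)) (at t)"
    by (rule has_vector_derivative_real_field[of "\<lambda>x. w * exp (z * x)"])
       (auto intro!: derivative_eq_intros)
  from bounded_linear.has_vector_derivative[OF bounded_linear_Re this]
  show ?thesis
    unfolding has_real_derivative_iff_has_vector_derivative re_exp_def[abs_def] by simp
qed

lemma funpow_deriv_re_exp: "(deriv ^^ k) (re_exp w z) = re_exp (w * z ^ k) z"
proof (induction k)
  case (Suc k)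
  have "deriv (re_exp (w * z ^ k) z) = re_exp (w * z ^ k * z) z"
    by (intro ext DERIV_imp_deriv re_exp_deriv)
  then show ?case by (simp add: Suc ac_simps)
qed simp

lemma smooth_re_exp: "smooth (re_exp w z)"
  unfolding smooth_def funpow_deriv_re_exp real_differentiable_def using re_exp_deriv by blast

lemma abs_re_exp_le: "\<bar>re_exp w z t\<bar> \<le> norm w * exp (Re z * t)"
  unfolding re_exp_def using abs_Re_le_cmod[of "w * exp (z * of_real t)"] by (simp add: norm_mult)

lemma schwartz_cutoff_re_exp:
  assumes "Re z < 0" shows "(\<lambda>t. causal_cutoff t * re_exp w z t) \<in> schwartz"
proof (rule schwartzI)
  show "smooth (\<lambda>t. causal_cutoff t * re_exp w z t)"
    by (intro smooth_mult smooth_causal_cutoff smooth_re_exp)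
  fix n
  have \<alpha>: "0 < - Re z" using assms by simp
  obtain C where C: "C \<ge> 0" "\<And>f B. smooth f \<Longrightarrow> B \<ge> 0 \<Longrightarrow>
    (\<And>k t. k \<le> n \<Longrightarrow> t \<ge> -1 \<Longrightarrow> \<bar>(deriv ^^ k) f t\<bar> \<le> B * exp (- (- Re z) * t)) \<Longrightarrow>
    schwartz_bound n (\<lambda>t. causal_cutoff t * f t) (C * B)"
    using schwartz_bound_cutoff[OF \<alpha>, of n] by blast
  have "schwartz_bound n (\<lambda>t. causal_cutoff t * re_exp w z t) (C * (norm w * (1 + norm z) ^ n))"
  proof (rule C(2)[OF smooth_re_exp])
    fix k and t :: real assume k: "k \<le> n"
    have "norm z ^ k \<le> (1 + norm z) ^ k" by (intro power_mono) auto
    also have "\<dots> \<le> (1 + norm z) ^ n" using k by (intro power_increasing) auto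
    finally have "norm (w * z ^ k) \<le> norm w * (1 + norm z) ^ n"
      by (simp add: norm_mult norm_power mult_left_mono)
    then have "norm (w * z ^ k) * exp (Re z * t) \<le> norm w * (1 + norm z) ^ n * exp (Re z * t)"
      by (intro mult_right_mono) auto
    then show "\<bar>(deriv ^^ k) (re_exp w z) t\<bar> \<le> norm w * (1 + norm z) ^ n * exp (- (- Re z) * t)"
      unfolding funpow_deriv_re_exp minus_minus using abs_re_exp_le[of "w * z ^ k" z t]
      by (rule order_trans[rotated])
  qed simp
  then show "\<exists>B. schwartz_bound n (\<lambda>t. causal_cutoff t * re_exp w z t) B" by blast
qed


section \<open>The Laplace transform is well defined\<close>

lemma tempered_functional_mult:
  assumes G: "tempered_functional G" and \<mu>: "bounded_smooth \<mu>"
  shows "tempered_functional (\<lambda>\<phi>. G (\<lambda>t. \<mu> t * \<phi> t))"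
  unfolding tempered_functional_iff linear_functional_on_def
proof (intro conjI ballI allI)
  fix \<phi> \<psi> assume "\<phi> \<in> schwartz" "\<psi> \<in> schwartz"
  then show "G (\<lambda>t. \<mu> t * (\<phi> t + \<psi> t)) = G (\<lambda>t. \<mu> t * \<phi> t) + G (\<lambda>t. \<mu> t * \<psi> t)"
    using tempered_add[OF G schwartz_mult[OF \<mu>] schwartz_mult[OF \<mu>]] by (simp add: distrib_left)
next
  fix c \<phi> assume "\<phi> \<in> schwartz"
  then show "G (\<lambda>t. \<mu> t * (c * \<phi> t)) = c * G (\<lambda>t. \<mu> t * \<phi> t)"
    using tempered_cmult[OF G schwartz_mult[OF \<mu>], of \<phi> c] by (simp add: mult.left_commute)
next
  obtain C n where C: "C \<ge> 0" "\<And>\<phi> B. \<phi> \<in> schwartz \<Longrightarrow> schwartz_bound n \<phi> B \<Longrightarrow> \<bar>G \<phi>\<bar> \<le> C * B"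
    using tempered_functionalE[OF G] by blast
  obtain M where M: "M \<ge> 0" "\<And>\<phi> B. smooth \<phi> \<Longrightarrow> schwartz_bound n \<phi> B \<Longrightarrow>
    schwartz_bound n (\<lambda>t. \<mu> t * \<phi> t) (M * B)"
    using bounded_smooth_schwartz_bound[OF \<mu>] by blast
  have "\<bar>G (\<lambda>t. \<mu> t * \<phi> t)\<bar> \<le> (C * M) * B" if "\<phi> \<in> schwartz" "schwartz_bound n \<phi> B" for \<phi> B
    using C(2)[OF schwartz_mult[OF \<mu> that(1)] M(2)[OF schwartz_smooth[OF that(1)] that(2)]]
    by (simp add: mult.assoc)
  then show "\<exists>C\<ge>0. \<exists>n. \<forall>\<phi>\<in>schwartz. \<forall>B. schwartz_bound n \<phi> B \<longrightarrow> \<bar>G (\<lambda>t. \<mu> t * \<phi> t)\<bar> \<le> C * B"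
    using C M by (intro exI[of _ "C * M"] conjI exI[of _ n]) auto
qed

lemma schwartz_bound_mono: "schwartz_bound n \<phi> B \<Longrightarrow> m \<le> n \<Longrightarrow> schwartz_bound m \<phi> B"
  unfolding schwartz_bound_def by auto

lemma tempered_functional_lincomb:
  assumes G: "tempered_functional G" and H: "tempered_functional H"
  shows "tempered_functional (\<lambda>\<phi>. a * G \<phi> + b * H \<phi>)"
  unfolding tempered_functional_iff linear_functional_on_def
proof (intro conjI ballI allI)
  fix \<phi> \<psi> assume "\<phi> \<in> schwartz" "\<psi> \<in> schwartz"
  then show "a * G (\<lambda>t. \<phi> t + \<psi> t) + b * H (\<lambda>t. \<phi> t + \<psi> t) = a * G \<phi> + b * H \<phi> + (a * G \<psi> + b * H \<psi>)"
    by (simp add: tempered_add[OF G] tempered_add[OF H] algebra_simps)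
next
  fix c \<phi> assume "\<phi> \<in> schwartz"
  then show "a * G (\<lambda>t. c * \<phi> t) + b * H (\<lambda>t. c * \<phi> t) = c * (a * G \<phi> + b * H \<phi>)"
    by (simp add: tempered_cmult[OF G] tempered_cmult[OF H] algebra_simps)
next
  obtain C n where C: "C \<ge> 0" "\<And>\<phi> B. \<phi> \<in> schwartz \<Longrightarrow> schwartz_bound n \<phi> B \<Longrightarrow> \<bar>G \<phi>\<bar> \<le> C * B"
    using tempered_functionalE[OF G] by blast
  obtain D m where D: "D \<ge> 0" "\<And>\<phi> B. \<phi> \<in> schwartz \<Longrightarrow> schwartz_bound m \<phi> B \<Longrightarrow> \<bar>H \<phi>\<bar> \<le> D * B"
    using tempered_functionalE[OF H] by blast
  have "\<bar>a * G \<phi> + b * H \<phi>\<bar> \<le> (\<bar>a\<bar> * C + \<bar>b\<bar> * D) * B"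
    if \<phi>: "\<phi> \<in> schwartz" and B: "schwartz_bound (max n m) \<phi> B" for \<phi> B
  proof -
    have "\<bar>a * G \<phi> + b * H \<phi>\<bar> \<le> \<bar>a\<bar> * \<bar>G \<phi>\<bar> + \<bar>b\<bar> * \<bar>H \<phi>\<bar>"
      by (metis abs_mult abs_triangle_ineq)
    also have "\<dots> \<le> \<bar>a\<bar> * (C * B) + \<bar>b\<bar> * (D * B)"
      by (intro add_mono mult_left_mono C(2) D(2) \<phi> schwartz_bound_mono[OF B]) auto
    finally show ?thesis by (simp add: algebra_simps)
  qed
  then show "\<exists>C\<ge>0. \<exists>n. \<forall>\<phi>\<in>schwartz. \<forall>B. schwartz_bound n \<phi> B \<longrightarrow> \<bar>a * G \<phi> + b * H \<phi>\<bar> \<le> C * B"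
    using C D by (intro exI[of _ "\<bar>a\<bar> * C + \<bar>b\<bar> * D"] conjI exI[of _ "max n m"]) auto
qed

lemma tempered_eqI:
  assumes "tempered_functional G" "tempered_functional H"
    and "\<And>\<phi>. \<phi> \<in> test_functions \<Longrightarrow> G \<phi> = H \<phi>" "\<phi> \<in> schwartz"
  shows "G \<phi> = H \<phi>"
  using tempered_eq_0[OF tempered_functional_lincomb[OF assms(1,2), of 1 "-1"] _ assms(4)] assms(3)
  by simp

lemma tempered_extension_tempered: "tempered_extension T \<sigma> G \<Longrightarrow> tempered_functional G"
  by (simp add: tempered_extension_def)

lemma tempered_extension_test:
  "tempered_extension T \<sigma> G \<Longrightarrow> \<phi> \<in> test_functions \<Longrightarrow> G \<phi> = pairing T (\<lambda>t. exp (- \<sigma> * t) * \<phi> t)"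
  by (simp add: tempered_extension_def)

text \<open>The tempered extension inherits causality: a Schwartz function vanishing near \<open>[0,\<infinity>)\<close> is fixed by
  a multiplier \<open>\<mu>\<close> that vanishes there too, and multiplication by \<open>\<mu>\<close> reduces the claim to test functions,
  which are dense.\<close>

lemma tempered_extension_eq_0:
  assumes T: "causal T" "tempered_extension T \<sigma> G" and \<psi>: "\<psi> \<in> schwartz"
    and \<epsilon>: "\<epsilon> > 0" "\<And>t. t > - \<epsilon> \<Longrightarrow> \<psi> t = 0"
  shows "G \<psi> = 0"
proof -
  define \<mu> where "\<mu> t = 1 - causal_cutoff ((1 / \<epsilon>) * t + 0)" for t
  have \<mu>: "bounded_smooth \<mu>"
    unfolding \<mu>_def[abs_def] by (intro bounded_smooth_one_minus_affine bounded_smooth_causal_cutoff)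
  have "(\<lambda>\<phi>. G (\<lambda>t. \<mu> t * \<phi> t)) \<psi> = 0"
  proof (rule tempered_eq_0[OF tempered_functional_mult[OF tempered_extension_tempered[OF T(2)] \<mu>] _ \<psi>])
    fix \<phi> assume \<phi>: "\<phi> \<in> test_functions"
    then have test: "(\<lambda>t. \<mu> t * \<phi> t) \<in> test_functions"
      by (intro test_functions_mult_smooth bounded_smooth_smooth[OF \<mu>])
    have "pairing T (\<lambda>t. exp (- \<sigma> * t) * (\<mu> t * \<phi> t)) = 0"
    proof (rule causal_pairing_eq_0[OF T(1) test_functions_exp[OF test], of "\<epsilon> / 2"])
      fix t assume "t > - (\<epsilon> / 2)"
      then have "(1 / \<epsilon>) * t + 0 \<ge> -1/2" using \<epsilon>(1) by (simp add: field_simps)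
      then show "exp (- \<sigma> * t) * (\<mu> t * \<phi> t) = 0" unfolding \<mu>_def by (simp add: causal_cutoff_eq_1)
    qed (use \<epsilon> in simp)
    then show "G (\<lambda>t. \<mu> t * \<phi> t) = 0" using tempered_extension_test[OF T(2) test] by simp
  qed
  moreover have "(\<lambda>t. \<mu> t * \<psi> t) = \<psi>"
  proof
    fix t
    show "\<mu> t * \<psi> t = \<psi> t"
    proof (cases "t > - \<epsilon>")
      case False
      then have "(1 / \<epsilon>) * t + 0 \<le> -1" using \<epsilon>(1) by (simp add: field_simps)
      then show ?thesis unfolding \<mu>_def by (simp add: causal_cutoff_eq_0)
    qed (simp add: \<epsilon>)
  qed
  ultimately show ?thesis by simp
qed

lemma tempered_extension_cong:
  assumes T: "causal T" "tempered_extension T \<sigma> G" and "\<phi> \<in> schwartz" "\<psi> \<in> schwartz"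
    and \<epsilon>: "\<epsilon> > 0" "\<And>t. t > - \<epsilon> \<Longrightarrow> \<phi> t = \<psi> t"
  shows "G \<phi> = G \<psi>"
  using tempered_extension_eq_0[OF T schwartz_diff[OF assms(3,4)] \<epsilon>(1)] \<epsilon>(2)
    tempered_diff[OF tempered_extension_tempered[OF T(2)] assms(3,4)] by simp

lemma bounded_smooth_damping:
  assumes "\<delta> \<ge> 0" shows "bounded_smooth (\<lambda>t. causal_cutoff t * exp (- \<delta> * t))"
proof (cases "\<delta> = 0")
  case True
  then show ?thesis using bounded_smooth_causal_cutoff by simp
next
  case False
  then have "(\<lambda>t. causal_cutoff t * re_exp 1 (of_real (- \<delta>)) t) \<in> schwartz"
    using assms by (intro schwartz_cutoff_re_exp) simp
  moreover have "re_exp 1 (of_real (- \<delta>)) t = exp (- \<delta> * t)" for t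
    unfolding re_exp_def of_real_mult[symmetric] exp_of_real by simp
  ultimately show ?thesis using schwartz_bounded_smooth by simp
qed

text \<open>For a causal distribution only the behaviour on a neighbourhood of \<open>[0,\<infinity>)\<close> matters, where the
  damping factor that relates two abscissas is a bounded multiplier.\<close>

lemma tempered_extension_change:
  assumes T: "causal T" "tempered_extension T \<sigma> G" "tempered_extension T \<sigma>' G'" and "\<sigma> \<le> \<sigma>'"
    and \<psi>: "\<psi> \<in> schwartz"
  shows "G' \<psi> = G (\<lambda>t. (causal_cutoff t * exp (- (\<sigma>' - \<sigma>) * t)) * \<psi> t)"
proof -
  define \<rho> where "\<rho> t = causal_cutoff t * exp (- (\<sigma>' - \<sigma>) * t)" for t
  have \<rho>: "bounded_smooth \<rho>"
    unfolding \<rho>_def[abs_def] using assms by (intro bounded_smooth_damping) simp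
  have "G' \<psi> = (\<lambda>\<phi>. G (\<lambda>t. \<rho> t * \<phi> t)) \<psi>"
  proof (rule tempered_eqI[OF tempered_extension_tempered[OF T(3)]
        tempered_functional_mult[OF tempered_extension_tempered[OF T(2)] \<rho>] _ \<psi>])
    fix \<phi> assume \<phi>: "\<phi> \<in> test_functions"
    then have test: "(\<lambda>t. \<rho> t * \<phi> t) \<in> test_functions"
      by (intro test_functions_mult_smooth bounded_smooth_smooth[OF \<rho>])
    have "pairing T (\<lambda>t. exp (- \<sigma>' * t) * \<phi> t) = pairing T (\<lambda>t. exp (- \<sigma> * t) * (\<rho> t * \<phi> t))"
    proof (rule causal_pairing_cong[OF T(1) test_functions_exp[OF \<phi>] test_functions_exp[OF test], of "1/2"])
      fix t :: real assume "t > - (1/2)"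
      then have "exp (- \<sigma> * t) * \<rho> t = exp (- \<sigma> * t) * exp (- (\<sigma>' - \<sigma>) * t)"
        unfolding \<rho>_def by (simp add: causal_cutoff_eq_1)
      also have "\<dots> = exp (- \<sigma>' * t)" unfolding exp_add[symmetric] by (simp add: algebra_simps)
      finally show "exp (- \<sigma>' * t) * \<phi> t = exp (- \<sigma> * t) * (\<rho> t * \<phi> t)" by (simp add: mult.assoc[symmetric])
    qed simp
    then show "G' \<phi> = G (\<lambda>t. \<rho> t * \<phi> t)"
      using tempered_extension_test[OF T(2) test] tempered_extension_test[OF T(3) \<phi>] by simp
  qed
  then show ?thesis by (simp add: \<rho>_def)
qed

text \<open>The complex number \<open>\<langle>G, e\<^sup>z\<^sup>t\<rangle>\<close>, with the exponential cut off on the left.\<close>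

definition complex_pairing :: "((real \<Rightarrow> real) \<Rightarrow> real) \<Rightarrow> complex \<Rightarrow> complex" where
  "complex_pairing G z = Complex (G (\<lambda>t. causal_cutoff t * re_exp 1 z t))
                                 (G (\<lambda>t. causal_cutoff t * re_exp (- \<i>) z t))"

lemma tempered_cutoff_re_exp:
  assumes G: "tempered_functional G" and z: "Re z < 0"
  shows "G (\<lambda>t. causal_cutoff t * re_exp w z t) = Re (w * complex_pairing G z)"
proof -
  have S: "(\<lambda>t. causal_cutoff t * re_exp w z t) \<in> schwartz" for w
    by (rule schwartz_cutoff_re_exp[OF z])
  have "(\<lambda>t. causal_cutoff t * re_exp w z t)
    = (\<lambda>t. Re w * (causal_cutoff t * re_exp 1 z t) + (- Im w) * (causal_cutoff t * re_exp (- \<i>) z t))"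
    by (simp add: re_exp_def fun_eq_iff algebra_simps)
  then show ?thesis
    using tempered_add[OF G schwartz_cmult[OF S] schwartz_cmult[OF S], of "Re w" 1 "- Im w" "- \<i>"]
      tempered_cmult[OF G S, of "Re w" 1] tempered_cmult[OF G S, of "- Im w" "- \<i>"]
    by (simp add: complex_pairing_def)
qed

lemma complex_pairing_eq_of_extension:
  assumes T: "causal T" "tempered_extension T \<sigma> G" "tempered_extension T \<sigma>' G'"
    and s: "\<sigma> < Re s" "\<sigma>' < Re s"
  shows "complex_pairing G (- (s - of_real \<sigma>)) = complex_pairing G' (- (s - of_real \<sigma>'))"
  using assms
proof (induction \<sigma> \<sigma>' arbitrary: G G' rule: linorder_wlog)
  case (le \<sigma> \<sigma>')
  note T = le(2-4)
  let ?z = "- (s - of_real \<sigma>)" and ?z' = "- (s - of_real \<sigma>')"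
  have z: "Re ?z < 0" "Re ?z' < 0" using le by auto
  have "G' (\<lambda>t. causal_cutoff t * re_exp w ?z' t) = G (\<lambda>t. causal_cutoff t * re_exp w ?z t)" for w
  proof -
    let ?\<rho> = "\<lambda>t. causal_cutoff t * exp (- (\<sigma>' - \<sigma>) * t)"
    have "G' (\<lambda>t. causal_cutoff t * re_exp w ?z' t) = G (\<lambda>t. ?\<rho> t * (causal_cutoff t * re_exp w ?z' t))"
      by (rule tempered_extension_change[OF T le(1) schwartz_cutoff_re_exp[OF z(2)]])
    also have "\<dots> = G (\<lambda>t. causal_cutoff t * re_exp w ?z t)"
    proof (rule tempered_extension_cong[OF T(1,2)])
      show "(\<lambda>t. ?\<rho> t * (causal_cutoff t * re_exp w ?z' t)) \<in> schwartz"
        using le(1) by (intro schwartz_mult bounded_smooth_damping schwartz_cutoff_re_exp[OF z(2)]) simp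
      show "(\<lambda>t. causal_cutoff t * re_exp w ?z t) \<in> schwartz" by (rule schwartz_cutoff_re_exp[OF z(1)])
      fix t :: real assume t: "t > - (1/2)"
      have "exp (- (\<sigma>' - \<sigma>) * t) * re_exp w ?z' t = Re (of_real (exp (- (\<sigma>' - \<sigma>) * t)) * (w * exp (?z' * of_real t)))"
        unfolding re_exp_def by (simp only: Re_complex_of_real Im_complex_of_real times_complex.sel)
      also have "of_real (exp (- (\<sigma>' - \<sigma>) * t)) * (w * exp (?z' * of_real t))
          = w * (exp (of_real (- (\<sigma>' - \<sigma>) * t)) * exp (?z' * of_real t))"
        unfolding exp_of_real by (simp only: ac_simps)
      also have "\<dots> = w * exp (?z * of_real t)"
        unfolding exp_add[symmetric] by (simp add: algebra_simps)
      finally show "?\<rho> t * (causal_cutoff t * re_exp w ?z' t) = causal_cutoff t * re_exp w ?z t"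
        using t by (simp add: causal_cutoff_eq_1 re_exp_def)
    qed simp
    finally show ?thesis .
  qed
  then show ?case by (simp add: complex_pairing_def)
qed metis

text \<open>This justifies the definite description in the definition of the transform and reduces every
  computation to a single admissible choice of abscissa and cutoff.\<close>

lemma laplace_eq:
  assumes T: "causal T" "tempered_extension T \<sigma> G" and s: "\<sigma> < Re s"
  shows "laplace T s = complex_pairing G (- (s - of_real \<sigma>))"
  unfolding laplace_def
proof (rule the_equality)
  let ?z = "\<lambda>\<sigma>. - (s - of_real \<sigma>)"
  have S: "(\<lambda>t. causal_cutoff t * re_exp w (?z \<sigma>) t) \<in> schwartz" if "\<sigma> < Re s" for w \<sigma>
    using that by (intro schwartz_cutoff_re_exp) simp
  have val: "Complex (causal_cutoff t * re_exp 1 (?z \<sigma>) t) (causal_cutoff t * re_exp (- \<i>) (?z \<sigma>) t)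
     = exp (?z \<sigma> * of_real t)" if "t > - (1/2)" for t \<sigma>
    using that by (simp add: causal_cutoff_eq_1 re_exp_def complex_eq_iff)
  show "has_laplace T s (complex_pairing G (?z \<sigma>))"
    unfolding has_laplace_def complex_pairing_def
    using s T(2) S[OF s] val
    by (intro exI[of _ \<sigma>] exI[of _ G] exI[of _ "\<lambda>t. causal_cutoff t * re_exp 1 (?z \<sigma>) t"]
        exI[of _ "\<lambda>t. causal_cutoff t * re_exp (- \<i>) (?z \<sigma>) t"] exI[of _ "1/2"] conjI allI impI) auto
  fix v assume "has_laplace T s v"
  then obtain \<sigma>' G' \<psi>\<^sub>1 \<psi>\<^sub>2 \<epsilon> where
    *: "\<sigma>' < Re s" "tempered_extension T \<sigma>' G'" "\<psi>\<^sub>1 \<in> schwartz" "\<psi>\<^sub>2 \<in> schwartz" "\<epsilon> > 0"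
       "\<And>t. t > - \<epsilon> \<Longrightarrow> Complex (\<psi>\<^sub>1 t) (\<psi>\<^sub>2 t) = exp (?z \<sigma>' * of_real t)" "v = Complex (G' \<psi>\<^sub>1) (G' \<psi>\<^sub>2)"
    unfolding has_laplace_def by blast
  have eq: "Complex (\<psi>\<^sub>1 t) (\<psi>\<^sub>2 t) = Complex (causal_cutoff t * re_exp 1 (?z \<sigma>') t)
      (causal_cutoff t * re_exp (- \<i>) (?z \<sigma>') t)" if "t > - min \<epsilon> (1/2)" for t
    using *(6)[of t] val[of t \<sigma>'] that by auto
  have "G' \<psi>\<^sub>1 = G' (\<lambda>t. causal_cutoff t * re_exp 1 (?z \<sigma>') t)"
    using eq *(5) by (intro tempered_extension_cong[OF T(1) *(2,3) S[OF *(1)], of "min \<epsilon> (1/2)"]) auto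
  moreover have "G' \<psi>\<^sub>2 = G' (\<lambda>t. causal_cutoff t * re_exp (- \<i>) (?z \<sigma>') t)"
    using eq *(5) by (intro tempered_extension_cong[OF T(1) *(2,4) S[OF *(1)], of "min \<epsilon> (1/2)"]) auto
  ultimately have "v = complex_pairing G' (?z \<sigma>')" by (simp add: *(7) complex_pairing_def)
  then show "v = complex_pairing G (?z \<sigma>)"
    using complex_pairing_eq_of_extension[OF T *(2) s *(1)] by simp
qed

section \<open>Uniqueness of the inverse Laplace transform\<close>

lemma tempered_sum:
  assumes G: "tempered_functional G" and "\<And>i. i \<in> I \<Longrightarrow> \<phi> i \<in> schwartz"
  shows "(\<lambda>t. \<Sum>i\<in>I. \<phi> i t) \<in> schwartz \<and> G (\<lambda>t. \<Sum>i\<in>I. \<phi> i t) = (\<Sum>i\<in>I. G (\<phi> i))"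
  using assms(2)
proof (induction I rule: infinite_finite_induct)
  case (insert i I)
  then show ?case
    using tempered_add[OF G, of "\<phi> i" "\<lambda>t. \<Sum>i\<in>I. \<phi> i t"]
      schwartz_add[of "\<phi> i" "\<lambda>t. \<Sum>i\<in>I. \<phi> i t"] by simp
qed (use tempered_cmult[OF G test_imp_schwartz[OF test_functions_plateau], of 0]
     schwartz_cmult[OF test_imp_schwartz[OF test_functions_plateau], of 0] in auto)

lemma re_exp_real: "re_exp 1 (of_real a) t = exp (a * t)"
  unfolding re_exp_def of_real_mult[symmetric] exp_of_real by simp

definition exp_poly :: "nat \<Rightarrow> (nat \<Rightarrow> real) \<Rightarrow> real \<Rightarrow> real" where
  "exp_poly K c t = (\<Sum>k=1..K. c k * re_exp 1 (of_real (- real k)) t)"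

lemma smooth_exp_poly: "smooth (exp_poly K c)"
  unfolding exp_poly_def[abs_def] by (intro smooth_sum smooth_cmult smooth_re_exp)

text \<open>Weierstrass approximation in the variable \<open>w = e\<^sup>-\<^sup>t\<close>, with the weight \<open>e\<^sup>-\<^sup>t\<close> absorbing the
  powers of \<open>t\<close> in the Schwartz seminorms.\<close>

lemma exp_poly_approx_uniform:
  assumes \<phi>: "\<phi> \<in> test_functions" and \<epsilon>: "\<epsilon> > 0"
  shows "\<exists>K c. \<forall>t\<ge>-1. \<bar>\<phi> t - exp_poly K c t\<bar> \<le> \<epsilon> * exp (- t)"
proof -
  obtain R where R: "R > 0" "\<And>t. \<bar>t\<bar> > R \<Longrightarrow> \<phi> t = 0"
    using test_functions_vanishE[OF \<phi>] by blast
  define g where "g t = exp t * \<phi> t" for t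
  define \<delta> where "\<delta> = exp (- (R + 2))"
  \<comment> \<open>\<open>g\<close> in the variable \<open>w = e\<^sup>-\<^sup>(\<^sup>t\<^sup>+\<^sup>1\<^sup>)\<close>; it vanishes for \<open>w \<le> \<delta>\<close>, so that freezing \<open>w\<close>
    there changes nothing and keeps the logarithm away from its singularity\<close>
  define f where "f w = g (- 1 - ln (max w \<delta>))" for w
  have \<delta>: "\<delta> > 0" by (simp add: \<delta>_def)
  have g_cont: "continuous_on UNIV g"
    unfolding g_def by (intro continuous_intros test_functions_continuous \<phi>)
  have "max w \<delta> \<noteq> 0" for w using \<delta> by (simp add: max_def)
  then have "continuous_on {0..1} (\<lambda>w. - 1 - ln (max w \<delta>))"
    by (intro continuous_intros) auto
  then have "continuous_on {0..1} f"
    unfolding f_def by (rule continuous_on_compose2[OF g_cont]) simp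
  then obtain q where q: "real_polynomial_function q" "\<And>w. w \<in> {0..1} \<Longrightarrow> \<bar>f w - q w\<bar> < \<epsilon>"
    using Stone_Weierstrass_real_polynomial_function[of "{0..1}" f \<epsilon>] \<epsilon> by auto
  obtain a n where a: "q = (\<lambda>w. \<Sum>i\<le>n. a i * w ^ i)"
    using q(1) real_polynomial_function_iff_sum by auto
  define c where "c k = a (k - 1) * exp (- real (k - 1))" for k
  have "\<bar>\<phi> t - exp_poly (Suc n) c t\<bar> \<le> \<epsilon> * exp (- t)" if t: "t \<ge> -1" for t
  proof -
    define w where "w = exp (- (t + 1))"
    have w: "w \<in> {0..1}" "ln w = - (t + 1)" using t by (auto simp: w_def)
    have fg: "f w = g t"
    proof (cases "w \<ge> \<delta>")
      case True
      then show ?thesis using w by (simp add: f_def max_def)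
    next
      case False
      then have "t > R" by (simp add: w_def \<delta>_def)
      then have "g t = 0" using R by (simp add: g_def)
      moreover have "g (R + 1) = 0" using R by (simp add: g_def)
      ultimately show ?thesis using False by (simp add: f_def max_def \<delta>_def add.commute)
    qed
    have "exp_poly (Suc n) c t = (\<Sum>i\<le>n. c (Suc i) * exp (- real (Suc i) * t))"
      unfolding exp_poly_def re_exp_real
      by (rule sum.reindex_bij_witness[of _ Suc "\<lambda>k. k - 1"]) auto
    also have "\<dots> = (\<Sum>i\<le>n. exp (- t) * (a i * w ^ i))"
    proof (rule sum.cong)
      fix i
      have "exp (- real i) * exp (- real (Suc i) * t) = exp (- t) * exp (real i * (- (t + 1)))"
        unfolding exp_add[symmetric] by (simp add: algebra_simps)
      also have "exp (real i * (- (t + 1))) = w ^ i"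
        unfolding w_def by (simp only: exp_of_nat_mult)
      finally show "c (Suc i) * exp (- real (Suc i) * t) = exp (- t) * (a i * w ^ i)"
        by (simp add: c_def)
    qed simp
    also have "\<dots> = exp (- t) * q w" by (simp add: a sum_distrib_left)
    finally have "\<phi> t - exp_poly (Suc n) c t = exp (- t) * (g t - q w)"
      by (simp add: g_def algebra_simps exp_minus)
    then show ?thesis
      using q(2)[OF w(1)] fg by (simp add: abs_mult mult.commute)
  qed
  then show ?thesis by blast
qed

text \<open>Both \<open>f + \<epsilon> e\<^sup>-\<^sup>t\<close> and \<open>- f + \<epsilon> e\<^sup>-\<^sup>t\<close> are decreasing with limit \<open>0\<close>, hence nonnegative.\<close>

lemma exp_decay_of_deriv:
  assumes f: "\<And>t. t \<ge> -1 \<Longrightarrow> (f has_real_derivative f' t) (at t)"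
    and f': "\<And>t. t \<ge> -1 \<Longrightarrow> \<bar>f' t\<bar> \<le> \<epsilon> * exp (- t)"
    and lim: "(f \<longlongrightarrow> 0) at_top" and t: "t \<ge> -1"
  shows "\<bar>f t\<bar> \<le> \<epsilon> * exp (- t)"
proof -
  have *: "h t \<ge> - \<epsilon> * exp (- t)"
    if h: "\<And>t. t \<ge> -1 \<Longrightarrow> (h has_real_derivative h' t) (at t)"
      and h': "\<And>t. t \<ge> -1 \<Longrightarrow> \<bar>h' t\<bar> \<le> \<epsilon> * exp (- t)" and lim: "(h \<longlongrightarrow> 0) at_top" for h h'
  proof -
    have "h s + \<epsilon> * exp (- s) \<le> h t + \<epsilon> * exp (- t)" if "t \<le> s" for s
    proof (rule DERIV_nonpos_imp_nonincreasing[OF that])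
      fix x assume "t \<le> x"
      then have x: "x \<ge> -1" using t by simp
      have "((\<lambda>t. h t + \<epsilon> * exp (- t)) has_real_derivative h' x - \<epsilon> * exp (- x)) (at x)"
        by (rule derivative_eq_intros h x refl | simp)+
      then show "\<exists>y. ((\<lambda>t. h t + \<epsilon> * exp (- t)) has_real_derivative y) (at x) \<and> y \<le> 0"
        using h'[OF x] by (intro exI[of _ "h' x - \<epsilon> * exp (- x)"]) auto
    qed
    moreover have "((\<lambda>s. h s + \<epsilon> * exp (- s)) \<longlongrightarrow> 0 + \<epsilon> * 0) at_top"
      by (intro tendsto_intros lim filterlim_compose[OF exp_at_bot] filterlim_uminus_at_bot_at_top)
    ultimately have "0 \<le> h t + \<epsilon> * exp (- t)"
      by (intro tendsto_upperbound[of "\<lambda>s. h s + \<epsilon> * exp (- s)" 0 at_top])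
         (auto intro!: eventually_mono[OF eventually_ge_at_top[of t]])
    then show ?thesis by simp
  qed
  have "- f t \<ge> - \<epsilon> * exp (- t)"
    by (rule *[of "\<lambda>t. - f t" "\<lambda>t. - f' t"]) (use f f' lim tendsto_minus[OF lim] in \<open>auto intro!: DERIV_minus\<close>)
  then show ?thesis using *[OF f f' lim] by auto
qed

lemma exp_poly_tendsto_0: "(exp_poly K c \<longlongrightarrow> 0) at_top"
proof -
  have "((\<lambda>t. c k * exp (- real k * t)) \<longlongrightarrow> 0) at_top" if "k \<in> {1..K}" for k
    using that
    by (intro tendsto_mult_right_zero filterlim_compose[OF exp_at_bot]
        filterlim_tendsto_neg_mult_at_bot[OF tendsto_const] filterlim_ident) auto
  then have "((\<lambda>t. \<Sum>k=1..K. c k * exp (- real k * t)) \<longlongrightarrow> 0) at_top"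
    by (rule tendsto_null_sum)
  then show ?thesis unfolding exp_poly_def[abs_def] re_exp_real .
qed

text \<open>Derivatives are controlled by approximating the highest one and integrating from infinity, which
  preserves both exponential polynomials and the weight \<open>e\<^sup>-\<^sup>t\<close>.\<close>

lemma exp_poly_approx:
  assumes \<phi>: "\<phi> \<in> test_functions" and \<epsilon>: "\<epsilon> > 0"
  shows "\<exists>K c. \<forall>i\<le>n. \<forall>t\<ge>-1. \<bar>(deriv ^^ i) (\<lambda>t. \<phi> t - exp_poly K c t) t\<bar> \<le> \<epsilon> * exp (- t)"
  using \<phi>
proof (induction n arbitrary: \<phi>)
  case 0
  then show ?case using exp_poly_approx_uniform[OF _ \<epsilon>] by simp
next
  case (Suc n)
  obtain K c where c: "\<And>i t. i \<le> n \<Longrightarrow> t \<ge> -1 \<Longrightarrow>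
      \<bar>(deriv ^^ i) (\<lambda>t. deriv \<phi> t - exp_poly K c t) t\<bar> \<le> \<epsilon> * exp (- t)"
    using Suc.IH[OF test_functions_deriv[OF Suc.prems]] by blast
  define C where "C k = - c k / real k" for k
  define f where "f = (\<lambda>t. \<phi> t - exp_poly K C t)"
  have "(exp_poly K C has_real_derivative exp_poly K c t) (at t)" for t
  proof -
    have "(exp_poly K C has_real_derivative
        (\<Sum>k=1..K. C k * re_exp (1 * of_real (- real k)) (of_real (- real k)) t)) (at t)"
      unfolding exp_poly_def[abs_def] by (intro DERIV_sum DERIV_cmult re_exp_deriv)
    also have "(\<Sum>k=1..K. C k * re_exp (1 * of_real (- real k)) (of_real (- real k)) t) = exp_poly K c t"
      unfolding exp_poly_def by (intro sum.cong refl) (auto simp: C_def re_exp_def)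
    finally show ?thesis .
  qed
  then have f': "(f has_real_derivative deriv \<phi> t - exp_poly K c t) (at t)" for t
    unfolding f_def by (intro DERIV_diff smooth_has_deriv[OF test_smooth[OF Suc.prems]])
  then have deriv_f: "deriv f = (\<lambda>t. deriv \<phi> t - exp_poly K c t)"
    by (auto intro!: ext DERIV_imp_deriv)
  obtain R where R: "R > 0" "\<And>t. \<bar>t\<bar> > R \<Longrightarrow> \<phi> t = 0"
    using test_functions_vanishE[OF Suc.prems] by blast
  have "(\<phi> \<longlongrightarrow> 0) at_top"
    using R by (intro tendsto_eventually eventually_mono[OF eventually_gt_at_top[of R]]) auto
  then have lim: "(f \<longlongrightarrow> 0) at_top"
    using tendsto_diff[OF _ exp_poly_tendsto_0] unfolding f_def by force
  have "\<bar>(deriv ^^ i) f t\<bar> \<le> \<epsilon> * exp (- t)" if i: "i \<le> Suc n" and t: "t \<ge> -1" for i t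
  proof (cases i)
    case 0
    show ?thesis
      using exp_decay_of_deriv[OF f' _ lim t] c[of 0] by (simp add: 0)
  next
    case (Suc j)
    then show ?thesis using c[of j t] i t by (simp add: funpow_Suc_right deriv_f del: funpow.simps(2))
  qed
  then show ?case unfolding f_def by blast
qed

text \<open>In the spirit of Lerch's theorem, the values on one arithmetic progression already determine the
  distribution.\<close>

lemma laplace_eq_0_imp:
  assumes T: "causal T" "tempered_extension T \<sigma> G"
    and 0: "\<And>k. k \<ge> 1 \<Longrightarrow> laplace T (of_real (\<sigma> + real k)) = 0"
  shows "T = 0"
proof -
  have G: "tempered_functional G" by (rule tempered_extension_tempered[OF T(2)])
  have S: "(\<lambda>t. causal_cutoff t * re_exp 1 (of_real (- real k)) t) \<in> schwartz" if "k \<ge> 1" for k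
    using that by (intro schwartz_cutoff_re_exp) simp
  have G0: "G (\<lambda>t. causal_cutoff t * re_exp 1 (of_real (- real k)) t) = 0" if k: "k \<ge> 1" for k
  proof -
    have "complex_pairing G (- (of_real (\<sigma> + real k) - of_real \<sigma>)) = 0"
      using 0[OF k] laplace_eq[OF T, of "of_real (\<sigma> + real k)"] k by simp
    then have "complex_pairing G (of_real (- real k)) = 0" by simp
    then show ?thesis using tempered_cutoff_re_exp[OF G, of "of_real (- real k)" 1] k by simp
  qed
  have Gp: "(\<lambda>t. causal_cutoff t * exp_poly K c t) \<in> schwartz \<and> G (\<lambda>t. causal_cutoff t * exp_poly K c t) = 0" for K c
  proof -
    have "(\<lambda>t. causal_cutoff t * exp_poly K c t)
      = (\<lambda>t. \<Sum>k\<in>{1..K}. c k * (causal_cutoff t * re_exp 1 (of_real (- real k)) t))"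
      unfolding exp_poly_def by (simp add: sum_distrib_left mult.left_commute)
    moreover have "G (\<lambda>t. c k * (causal_cutoff t * re_exp 1 (of_real (- real k)) t)) = 0" if "k \<ge> 1" for k
      using tempered_cmult[OF G S[OF that]] G0[OF that] by simp
    ultimately show ?thesis
      using tempered_sum[OF G, of "{1..K}" "\<lambda>k t. c k * (causal_cutoff t * re_exp 1 (of_real (- real k)) t)"]
        schwartz_cmult[OF S] by simp
  qed
  obtain C n where C: "C \<ge> 0" "\<And>\<phi> B. \<phi> \<in> schwartz \<Longrightarrow> schwartz_bound n \<phi> B \<Longrightarrow> \<bar>G \<phi>\<bar> \<le> C * B"
    using tempered_functionalE[OF G] by blast
  have one: "0 < (1::real)" by simp
  obtain D where D: "D \<ge> 0" "\<And>f B. smooth f \<Longrightarrow> B \<ge> 0 \<Longrightarrow>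
    (\<And>k t. k \<le> n \<Longrightarrow> t \<ge> -1 \<Longrightarrow> \<bar>(deriv ^^ k) f t\<bar> \<le> B * exp (- 1 * t)) \<Longrightarrow>
    schwartz_bound n (\<lambda>t. causal_cutoff t * f t) (D * B)"
    using schwartz_bound_cutoff[OF one, of n] by blast
  have G_test: "G \<phi> = 0" if \<phi>: "\<phi> \<in> test_functions" for \<phi>
  proof -
    have \<phi>': "(\<lambda>t. causal_cutoff t * \<phi> t) \<in> schwartz"
      by (intro test_imp_schwartz test_functions_mult_smooth smooth_causal_cutoff \<phi>)
    have eq: "G \<phi> = G (\<lambda>t. causal_cutoff t * \<phi> t)"
      by (rule tempered_extension_cong[OF T test_imp_schwartz[OF \<phi>] \<phi>', of "1/2"])
         (auto simp: causal_cutoff_eq_1)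
    have *: "\<bar>G \<phi>\<bar> \<le> (C * D) * \<epsilon>" if \<epsilon>: "\<epsilon> > 0" for \<epsilon>
    proof -
      obtain K c where c: "\<And>i t. i \<le> n \<Longrightarrow> t \<ge> -1 \<Longrightarrow>
          \<bar>(deriv ^^ i) (\<lambda>t. \<phi> t - exp_poly K c t) t\<bar> \<le> \<epsilon> * exp (- t)"
        using exp_poly_approx[OF \<phi> \<epsilon>] by blast
      have "schwartz_bound n (\<lambda>t. causal_cutoff t * (\<phi> t - exp_poly K c t)) (D * \<epsilon>)"
        using c \<epsilon> by (intro D(2) smooth_diff test_smooth[OF \<phi>] smooth_exp_poly) auto
      moreover have "(\<lambda>t. causal_cutoff t * (\<phi> t - exp_poly K c t))
          = (\<lambda>t. causal_cutoff t * \<phi> t - causal_cutoff t * exp_poly K c t)"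
        by (simp add: right_diff_distrib)
      ultimately have "\<bar>G (\<lambda>t. causal_cutoff t * \<phi> t - causal_cutoff t * exp_poly K c t)\<bar> \<le> C * (D * \<epsilon>)"
        using Gp[of K c] by (intro C(2) schwartz_diff \<phi>') auto
      then show ?thesis using tempered_diff[OF G \<phi>', of "\<lambda>t. causal_cutoff t * exp_poly K c t"] Gp[of K c] eq
        by (simp add: mult.assoc)
    qed
    have "\<bar>G \<phi>\<bar> \<le> 0"
    proof (rule field_le_epsilon)
      fix e :: real assume e: "e > 0"
      have CD: "C * D \<ge> 0" using C(1) D(1) by simp
      then have "(C * D) * (e / (C * D + 1)) \<le> e" using e by (simp add: field_simps)
      moreover have "\<bar>G \<phi>\<bar> \<le> (C * D) * (e / (C * D + 1))"
        using e CD by (intro *) (simp add: add_nonneg_pos)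
      ultimately show "\<bar>G \<phi>\<bar> \<le> 0 + e" by linarith
    qed
    then show ?thesis by simp
  qed
  show ?thesis
  proof (rule distr_eqI)
    fix \<phi> assume \<phi>: "\<phi> \<in> test_functions"
    have "(\<lambda>t. exp (- \<sigma> * t) * (exp (\<sigma> * t) * \<phi> t)) = \<phi>"
      by (simp add: fun_eq_iff mult.assoc[symmetric] exp_add[symmetric])
    then show "pairing T \<phi> = pairing 0 \<phi>"
      using G_test[OF test_functions_exp[OF \<phi>]] tempered_extension_test[OF T(2) test_functions_exp[OF \<phi>, of \<sigma>]]
      by (simp add: pairing_zero)
  qed
qed
section \<open>Operational rules of the Laplace transform\<close>

text \<open>Properties on some right half-plane form a filter.\<close>

abbreviation far_right :: "complex filter" where
  "far_right \<equiv> filtercomap Re at_top"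

lemma laplace_pair_iff:
  "laplace_pair T F \<longleftrightarrow> laplace_transformable T \<and> (\<forall>\<^sub>F s in far_right. laplace T s = F s)"
  unfolding laplace_pair_def eventually_filtercomap_at_top_dense ..

lemma laplace_transformableE:
  assumes "laplace_transformable T"
  obtains \<sigma>\<^sub>0 where "causal T" "\<And>\<sigma>. \<sigma> > \<sigma>\<^sub>0 \<Longrightarrow> \<exists>G. tempered_extension T \<sigma> G"
  using assms unfolding laplace_transformable_def by blast

lemma laplace_transformableI:
  assumes "causal T" "\<And>\<sigma>. \<sigma> > \<sigma>\<^sub>0 \<Longrightarrow> \<exists>G. tempered_extension T \<sigma> G"
  shows "laplace_transformable T"
  using assms unfolding laplace_transformable_def by (intro conjI exI[of _ "max 0 \<sigma>\<^sub>0"]) auto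

lemma laplace_pairD: "laplace_pair T F \<Longrightarrow> laplace_transformable T"
  by (simp add: laplace_pair_iff)

lemma laplace_pair_self: "laplace_transformable T \<Longrightarrow> laplace_pair T (laplace T)"
  by (simp add: laplace_pair_iff)

lemma laplace_pair_cong:
  assumes "laplace_pair T F" "\<forall>\<^sub>F s in far_right. F s = H s" shows "laplace_pair T H"
  using assms unfolding laplace_pair_iff by (auto elim: eventually_elim2)

text \<open>To compute a transform it is enough to know one tempered extension for every large abscissa.\<close>

lemma laplace_pairI:
  assumes T: "causal T"
    and *: "\<And>\<sigma>. \<sigma> > \<sigma>\<^sub>0 \<Longrightarrow> \<exists>G. tempered_extension T \<sigma> G \<and>
      (\<forall>s. Re s > \<sigma> \<longrightarrow> complex_pairing G (- (s - of_real \<sigma>)) = F s)"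
  shows "laplace_pair T F"
proof -
  have "laplace T s = F s" if "Re s > \<sigma>\<^sub>0 + 1" for s
  proof -
    obtain G where "tempered_extension T (\<sigma>\<^sub>0 + 1) G"
      "\<forall>s. Re s > \<sigma>\<^sub>0 + 1 \<longrightarrow> complex_pairing G (- (s - of_real (\<sigma>\<^sub>0 + 1))) = F s"
      using *[of "\<sigma>\<^sub>0 + 1"] by auto
    then show ?thesis using laplace_eq[OF T _ that] that by auto
  qed
  then show ?thesis
    using laplace_transformableI[OF T] * unfolding laplace_pair_iff eventually_filtercomap_at_top_dense
    by blast
qed

lemma laplace_pairE:
  assumes "laplace_pair T F"
  obtains \<sigma>\<^sub>0 where "causal T" "\<And>\<sigma>. \<sigma> > \<sigma>\<^sub>0 \<Longrightarrow> \<exists>G. tempered_extension T \<sigma> G \<and>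
      (\<forall>s. Re s > \<sigma> \<longrightarrow> complex_pairing G (- (s - of_real \<sigma>)) = F s)"
proof -
  obtain \<sigma>\<^sub>1 where 1: "causal T" "\<And>\<sigma>. \<sigma> > \<sigma>\<^sub>1 \<Longrightarrow> \<exists>G. tempered_extension T \<sigma> G"
    using laplace_transformableE[OF laplace_pairD[OF assms]] by blast
  obtain \<sigma>\<^sub>2 where 2: "\<And>s. Re s > \<sigma>\<^sub>2 \<Longrightarrow> laplace T s = F s"
    using assms unfolding laplace_pair_iff eventually_filtercomap_at_top_dense by blast
  show thesis
  proof (rule that[OF 1(1), of "max \<sigma>\<^sub>1 \<sigma>\<^sub>2"])
    fix \<sigma> assume \<sigma>: "\<sigma> > max \<sigma>\<^sub>1 \<sigma>\<^sub>2"
    then obtain G where G: "tempered_extension T \<sigma> G" using 1(2)[of \<sigma>] by auto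
    then show "\<exists>G. tempered_extension T \<sigma> G \<and> (\<forall>s. Re s > \<sigma> \<longrightarrow> complex_pairing G (- (s - of_real \<sigma>)) = F s)"
      using laplace_eq[OF 1(1) G] 2 \<sigma> by (intro exI[of _ G]) auto
  qed
qed

lemma laplace_pair_lincomb:
  assumes "laplace_pair S F" "laplace_pair T H"
  shows "laplace_pair (a *\<^sub>R S + b *\<^sub>R T) (\<lambda>s. of_real a * F s + of_real b * H s)"
proof -
  obtain \<sigma>\<^sub>1 where 1: "causal S" "\<And>\<sigma>. \<sigma> > \<sigma>\<^sub>1 \<Longrightarrow> \<exists>G. tempered_extension S \<sigma> G \<and>
      (\<forall>s. Re s > \<sigma> \<longrightarrow> complex_pairing G (- (s - of_real \<sigma>)) = F s)"
    using laplace_pairE[OF assms(1)] by blast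
  obtain \<sigma>\<^sub>2 where 2: "causal T" "\<And>\<sigma>. \<sigma> > \<sigma>\<^sub>2 \<Longrightarrow> \<exists>G. tempered_extension T \<sigma> G \<and>
      (\<forall>s. Re s > \<sigma> \<longrightarrow> complex_pairing G (- (s - of_real \<sigma>)) = H s)"
    using laplace_pairE[OF assms(2)] by blast
  show ?thesis
  proof (rule laplace_pairI)
    show "causal (a *\<^sub>R S + b *\<^sub>R T)" by (intro causal_plus causal_scaleR 1 2)
    fix \<sigma> assume \<sigma>: "\<sigma> > max \<sigma>\<^sub>1 \<sigma>\<^sub>2"
    then obtain A where A: "tempered_extension S \<sigma> A"
        "\<forall>s. Re s > \<sigma> \<longrightarrow> complex_pairing A (- (s - of_real \<sigma>)) = F s" using 1(2)[of \<sigma>] by auto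
    obtain B where B: "tempered_extension T \<sigma> B"
        "\<forall>s. Re s > \<sigma> \<longrightarrow> complex_pairing B (- (s - of_real \<sigma>)) = H s" using 2(2)[of \<sigma>] \<sigma> by auto
    have "tempered_extension (a *\<^sub>R S + b *\<^sub>R T) \<sigma> (\<lambda>\<phi>. a * A \<phi> + b * B \<phi>)"
      unfolding tempered_extension_def
      using A(1) B(1) tempered_functional_lincomb[of A B a b]
      by (auto simp: tempered_extension_def pairing_plus pairing_scaleR)
    moreover have "complex_pairing (\<lambda>\<phi>. a * A \<phi> + b * B \<phi>) z
        = of_real a * complex_pairing A z + of_real b * complex_pairing B z" for z
      by (simp add: complex_pairing_def complex_eq_iff)
    ultimately show "\<exists>G. tempered_extension (a *\<^sub>R S + b *\<^sub>R T) \<sigma> G \<and>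
      (\<forall>s. Re s > \<sigma> \<longrightarrow> complex_pairing G (- (s - of_real \<sigma>)) = of_real a * F s + of_real b * H s)"
      using A(2) B(2) by (intro exI[of _ "\<lambda>\<phi>. a * A \<phi> + b * B \<phi>"]) auto
  qed
qed

lemma laplace_pair_plus:
  "laplace_pair S F \<Longrightarrow> laplace_pair T H \<Longrightarrow> laplace_pair (S + T) (\<lambda>s. F s + H s)"
  using laplace_pair_lincomb[of S F T H 1 1] by simp

lemma laplace_pair_scaleR: "laplace_pair T F \<Longrightarrow> laplace_pair (c *\<^sub>R T) (\<lambda>s. of_real c * F s)"
  using laplace_pair_lincomb[of T F T F c 0] by simp

lemma laplace_pair_zero: "laplace_pair 0 (\<lambda>_. 0)"
proof (rule laplace_pairI)
  show "causal 0" by (rule causalI) (simp add: pairing_zero)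
  fix \<sigma> :: real
  have "tempered_functional (\<lambda>_. 0)"
    unfolding tempered_functional_iff linear_functional_on_def by (auto intro!: exI[of _ 0])
  then show "\<exists>G. tempered_extension 0 \<sigma> G \<and> (\<forall>s. Re s > \<sigma> \<longrightarrow> complex_pairing G (- (s - of_real \<sigma>)) = 0)"
    by (intro exI[of _ "\<lambda>_. 0"])
       (auto simp: tempered_extension_def pairing_zero complex_pairing_def complex_eq_iff)
qed

lemma laplace_pair_sum:
  "(\<And>i. i \<in> I \<Longrightarrow> laplace_pair (T i) (F i)) \<Longrightarrow> laplace_pair (\<Sum>i\<in>I. T i) (\<lambda>s. \<Sum>i\<in>I. F i s)"
  by (induction I rule: infinite_finite_induct) (auto intro: laplace_pair_zero laplace_pair_plus)

lemma tempered_functional_deriv: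
  assumes G: "tempered_functional G" shows "tempered_functional (\<lambda>\<phi>. G (deriv \<phi>))"
  unfolding tempered_functional_iff linear_functional_on_def
proof (intro conjI ballI allI)
  fix \<phi> \<psi> assume \<phi>: "\<phi> \<in> schwartz" "\<psi> \<in> schwartz"
  have "deriv (\<lambda>t. \<phi> t + \<psi> t) = (\<lambda>t. deriv \<phi> t + deriv \<psi> t)"
    using smooth_funpow_deriv_add[of \<phi> \<psi> 1] \<phi> by (simp add: schwartz_smooth)
  then show "G (deriv (\<lambda>t. \<phi> t + \<psi> t)) = G (deriv \<phi>) + G (deriv \<psi>)"
    using tempered_add[OF G] \<phi> by (simp add: schwartz_deriv)
next
  fix c \<phi> assume \<phi>: "\<phi> \<in> schwartz"
  have "deriv (\<lambda>t. c * \<phi> t) = (\<lambda>t. c * deriv \<phi> t)"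
    using smooth_funpow_deriv_cmult[of \<phi> 1] \<phi> by (simp add: schwartz_smooth)
  then show "G (deriv (\<lambda>t. c * \<phi> t)) = c * G (deriv \<phi>)"
    using tempered_cmult[OF G] \<phi> by (simp add: schwartz_deriv)
next
  obtain C n where C: "C \<ge> 0" "\<And>\<phi> B. \<phi> \<in> schwartz \<Longrightarrow> schwartz_bound n \<phi> B \<Longrightarrow> \<bar>G \<phi>\<bar> \<le> C * B"
    using tempered_functionalE[OF G] by blast
  then have "\<forall>\<phi>\<in>schwartz. \<forall>B. schwartz_bound (Suc n) \<phi> B \<longrightarrow> \<bar>G (deriv \<phi>)\<bar> \<le> C * B"
    by (simp add: schwartz_deriv schwartz_bound_deriv)
  then show "\<exists>C\<ge>0. \<exists>n. \<forall>\<phi>\<in>schwartz. \<forall>B. schwartz_bound n \<phi> B \<longrightarrow> \<bar>G (deriv \<phi>)\<bar> \<le> C * B"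
    using C(1) by blast
qed

text \<open>At abscissa \<open>\<sigma>\<close> the derivative of \<open>T\<close> acts through the transposed operator \<open>\<sigma> - d/dt\<close>, and on the
  exponential \<open>e\<^sup>-\<^sup>(\<^sup>s\<^sup>-\<^sup>\<sigma>\<^sup>)\<^sup>t\<close> that operator is multiplication by \<open>s\<close>.\<close>

lemma laplace_pair_distr_deriv:
  assumes "laplace_pair T F" shows "laplace_pair (distr_deriv T) (\<lambda>s. s * F s)"
proof -
  obtain \<sigma>\<^sub>0 where T: "causal T" "\<And>\<sigma>. \<sigma> > \<sigma>\<^sub>0 \<Longrightarrow> \<exists>G. tempered_extension T \<sigma> G \<and>
      (\<forall>s. Re s > \<sigma> \<longrightarrow> complex_pairing G (- (s - of_real \<sigma>)) = F s)"
    using laplace_pairE[OF assms] by blast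
  show ?thesis
  proof (rule laplace_pairI)
    show "causal (distr_deriv T)" by (rule causal_distr_deriv[OF T(1)])
    fix \<sigma> assume "\<sigma> > \<sigma>\<^sub>0"
    then obtain G where G: "tempered_extension T \<sigma> G"
        "\<And>s. Re s > \<sigma> \<Longrightarrow> complex_pairing G (- (s - of_real \<sigma>)) = F s" using T(2) by blast
    have tG: "tempered_functional G" by (rule tempered_extension_tempered[OF G(1)])
    let ?H = "\<lambda>\<phi>. \<sigma> * G \<phi> + -1 * G (deriv \<phi>)"
    have "tempered_extension (distr_deriv T) \<sigma> ?H"
      unfolding tempered_extension_def
    proof (intro conjI ballI)
      show "tempered_functional ?H"
        by (intro tempered_functional_lincomb tempered_functional_deriv tG)
      fix \<phi> assume \<phi>: "\<phi> \<in> test_functions"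
      have d: "deriv (\<lambda>t. exp (- \<sigma> * t) * \<phi> t)
          = (\<lambda>t. - \<sigma> * (exp (- \<sigma> * t) * \<phi> t) + exp (- \<sigma> * t) * deriv \<phi> t)"
        by (intro ext DERIV_imp_deriv)
           (auto intro!: derivative_eq_intros smooth_has_deriv[OF test_smooth[OF \<phi>]] simp: algebra_simps)
      have "pairing (distr_deriv T) (\<lambda>t. exp (- \<sigma> * t) * \<phi> t)
        = - pairing T (\<lambda>t. - \<sigma> * (exp (- \<sigma> * t) * \<phi> t) + exp (- \<sigma> * t) * deriv \<phi> t)"
        by (simp only: pairing_distr_deriv[OF test_functions_exp[OF \<phi>]] d)
      also have "\<dots> = \<sigma> * pairing T (\<lambda>t. exp (- \<sigma> * t) * \<phi> t) - pairing T (\<lambda>t. exp (- \<sigma> * t) * deriv \<phi> t)"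
        using pairing_add[OF test_functions_cmult[OF test_functions_exp[OF \<phi>]]
            test_functions_exp[OF test_functions_deriv[OF \<phi>]], of T "- \<sigma>" "- \<sigma>" "- \<sigma>"]
          pairing_cmult[OF test_functions_exp[OF \<phi>], of T "- \<sigma>" "- \<sigma>"] by simp
      finally show "?H \<phi> = pairing (distr_deriv T) (\<lambda>t. exp (- \<sigma> * t) * \<phi> t)"
        using tempered_extension_test[OF G(1) \<phi>] tempered_extension_test[OF G(1) test_functions_deriv[OF \<phi>]]
        by simp
    qed
    moreover have "complex_pairing ?H (- (s - of_real \<sigma>)) = s * F s" if s: "Re s > \<sigma>" for s
    proof -
      let ?z = "- (s - of_real \<sigma>)"
      have z: "Re ?z < 0" using s by simp
      have "?H (\<lambda>t. causal_cutoff t * re_exp w ?z t) = Re (w * (s * F s))" for w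
      proof -
        have "G (deriv (\<lambda>t. causal_cutoff t * re_exp w ?z t)) = G (\<lambda>t. causal_cutoff t * re_exp (w * ?z) ?z t)"
        proof (rule tempered_extension_cong[OF T(1) G(1)])
          fix t :: real assume t: "t > - (1/2)"
          have "(deriv ^^ 1) (\<lambda>t. causal_cutoff t * re_exp w ?z t) t = (deriv ^^ 1) (re_exp w ?z) t"
            by (rule funpow_deriv_eventually_cong[of "{- (1/2)<..}"]) (use t in \<open>auto simp: causal_cutoff_eq_1\<close>)
          then show "deriv (\<lambda>t. causal_cutoff t * re_exp w ?z t) t = causal_cutoff t * re_exp (w * ?z) ?z t"
            using t unfolding funpow_deriv_re_exp by (simp add: causal_cutoff_eq_1)
        qed (intro schwartz_deriv schwartz_cutoff_re_exp z | simp)+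
        then have "?H (\<lambda>t. causal_cutoff t * re_exp w ?z t)
            = \<sigma> * Re (w * complex_pairing G ?z) - Re (w * ?z * complex_pairing G ?z)"
          using tempered_cutoff_re_exp[OF tG z, of w] tempered_cutoff_re_exp[OF tG z, of "w * ?z"] by simp
        also have "\<dots> = Re (of_real \<sigma> * (w * F s) - w * ?z * F s)"
          unfolding G(2)[OF s] by simp
        also have "of_real \<sigma> * (w * F s) - w * ?z * F s = w * (s * F s)" by (simp add: algebra_simps)
        finally show ?thesis .
      qed
      from this[of 1] this[of "- \<i>"] show ?thesis
        unfolding complex_pairing_def by (simp add: complex_eq_iff)
    qed
    ultimately show "\<exists>G. tempered_extension (distr_deriv T) \<sigma> G \<and>
        (\<forall>s. Re s > \<sigma> \<longrightarrow> complex_pairing G (- (s - of_real \<sigma>)) = s * F s)"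
      by blast
  qed
qed

lemma laplace_pair_diff_op:
  assumes "laplace_pair T F"
  shows "laplace_pair (\<Sum>n=0..N. a n *\<^sub>R (distr_deriv ^^ n) T) (\<lambda>s. (\<Sum>n=0..N. of_real (a n) * s ^ n) * F s)"
proof -
  have "laplace_pair ((distr_deriv ^^ n) T) (\<lambda>s. s ^ n * F s)" for n
    by (induction n) (use assms laplace_pair_distr_deriv in \<open>auto simp: mult.assoc\<close>)
  then show ?thesis
    unfolding sum_distrib_right mult.assoc by (intro laplace_pair_sum laplace_pair_scaleR)
qed

lemma laplace_pair_unique:
  assumes "laplace_pair S F" "laplace_pair T F" shows "S = T"
proof -
  have "laplace_pair (1 *\<^sub>R S + (-1) *\<^sub>R T) (\<lambda>_. 0)"
    using laplace_pair_lincomb[OF assms, of 1 "-1"] by simp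
  then obtain \<sigma>\<^sub>0 where *: "causal (1 *\<^sub>R S + (-1) *\<^sub>R T)" "\<And>\<sigma>. \<sigma> > \<sigma>\<^sub>0 \<Longrightarrow>
      \<exists>G. tempered_extension (1 *\<^sub>R S + (-1) *\<^sub>R T) \<sigma> G \<and>
      (\<forall>s. Re s > \<sigma> \<longrightarrow> complex_pairing G (- (s - of_real \<sigma>)) = 0)"
    by (rule laplace_pairE) blast
  obtain G where G: "tempered_extension (1 *\<^sub>R S + (-1) *\<^sub>R T) (\<sigma>\<^sub>0 + 1) G"
      "\<forall>s. Re s > \<sigma>\<^sub>0 + 1 \<longrightarrow> complex_pairing G (- (s - of_real (\<sigma>\<^sub>0 + 1))) = 0"
    using *(2)[of "\<sigma>\<^sub>0 + 1"] by auto
  have "laplace (1 *\<^sub>R S + (-1) *\<^sub>R T) (of_real (\<sigma>\<^sub>0 + 1 + real k)) = 0" if "k \<ge> 1" for k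
  proof -
    have "complex_pairing G (- (of_real (\<sigma>\<^sub>0 + 1 + real k) - of_real (\<sigma>\<^sub>0 + 1))) = 0"
      using that by (intro G(2)[rule_format]) simp
    then show ?thesis
      using that by (subst laplace_eq[OF *(1) G(1)]) auto
  qed
  then have "1 *\<^sub>R S + (-1) *\<^sub>R T = 0" by (rule laplace_eq_0_imp[OF *(1) G(1)])
  then show ?thesis by simp
qed

lemma inverse_laplace_eq: "laplace_pair T F \<Longrightarrow> inverse_laplace F = T"
  unfolding inverse_laplace_def using laplace_pair_unique by blast

lemma laplace_pair_ex1: "laplace_pair T F \<Longrightarrow> \<exists>!T. laplace_pair T F"
  using laplace_pair_unique by blast

lemma characteristic_poly_nonzero:
  assumes "a N \<noteq> (0::real)"
  shows "\<forall>\<^sub>F s in far_right. (\<Sum>n=0..N. of_real (a n) * s ^ n) \<noteq> (0::complex)"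
proof -
  let ?S = "{s::complex. (\<Sum>n\<le>N. of_real (a n) * s ^ n) = 0}"
  have "finite ?S"
    using assms by (subst polyfun_finite_roots) (auto intro!: exI[of _ N])
  then have "bdd_above (Re ` ?S)" by (intro bdd_above_finite finite_imageI)
  then obtain B where "\<And>s. s \<in> ?S \<Longrightarrow> Re s \<le> B" by (auto simp: bdd_above_def)
  then show ?thesis
    unfolding eventually_filtercomap_at_top_dense atLeast0AtMost by (intro exI[of _ B]) force
qed


section \<open>Integrals over the half-line\<close>

lemma set_integrable_exp_decay:
  assumes "\<delta> > 0" shows "set_integrable lborel {0..} (\<lambda>t::real. exp (- \<delta> * t))"
proof -
  have "((\<lambda>t. - exp (- \<delta> * t) / \<delta>) \<longlongrightarrow> - 0 / \<delta>) at_top"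
    using assms
    by (intro tendsto_intros filterlim_compose[OF exp_at_bot]
        filterlim_tendsto_neg_mult_at_bot[OF tendsto_const] filterlim_ident) auto
  then have "(\<integral>\<^sup>+t. ennreal (exp (- \<delta> * t)) * indicator {0..} t \<partial>lborel) = ennreal (0 - (- exp (- \<delta> * 0) / \<delta>))"
    using assms by (intro nn_integral_FTC_atLeast) (auto intro!: derivative_eq_intros)
  then have "(\<integral>\<^sup>+t. ennreal (indicator {0..} t *\<^sub>R exp (- \<delta> * t)) \<partial>lborel) < \<infinity>"
    by (subst nn_integral_cong[of _ _ "\<lambda>t. ennreal (exp (- \<delta> * t)) * indicator {0..} t"])
       (auto simp: indicator_def)
  then show ?thesis
    unfolding set_integrable_def by (intro integrableI_nonneg) auto
qed

definition exp_integral :: "real \<Rightarrow> real" where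
  "exp_integral \<delta> = (LBINT t:{0..}. exp (- \<delta> * t))"

lemma exp_integral_nonneg: "exp_integral \<delta> \<ge> 0"
  unfolding exp_integral_def set_lebesgue_integral_def
  by (intro Bochner_Integration.integral_nonneg) auto

lemma half_line_integral_bound:
  assumes \<delta>: "\<delta> > 0" and f: "continuous_on UNIV f"
    and B: "\<And>t. t \<ge> 0 \<Longrightarrow> \<bar>f t\<bar> \<le> B * exp (- \<delta> * t)"
  shows "set_integrable lborel {0..} f" "\<bar>LBINT t:{0..}. f t\<bar> \<le> B * exp_integral \<delta>"
proof -
  have dom: "integrable lborel (\<lambda>t. B * (indicator {0..} t *\<^sub>R exp (- \<delta> * t)))"
    using set_integrable_exp_decay[OF \<delta>] unfolding set_integrable_def by (intro integrable_mult_right)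
  have le: "\<bar>indicator {0..} t *\<^sub>R f t\<bar> \<le> B * (indicator {0..} t *\<^sub>R exp (- \<delta> * t))" for t
    using B[of t] by (simp add: indicator_def)
  show int: "set_integrable lborel {0..} f"
    unfolding set_integrable_def
  proof (rule Bochner_Integration.integrable_bound[OF dom])
    show "(\<lambda>t. indicator {0..} t *\<^sub>R f t) \<in> borel_measurable lborel"
      using borel_measurable_continuous_onI[OF f] by measurable
    show "AE t in lborel. norm (indicator {0..} t *\<^sub>R f t) \<le> norm (B * (indicator {0..} t *\<^sub>R exp (- \<delta> * t)))"
      using le by (intro AE_I2) (auto intro: order_trans[OF _ abs_ge_self])
  qed
  have "\<bar>LBINT t:{0..}. f t\<bar> \<le> (LBINT t. \<bar>indicator {0..} t *\<^sub>R f t\<bar>)"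
    unfolding set_lebesgue_integral_def
    using integral_norm_bound[of lborel "\<lambda>t. indicator {0..} t *\<^sub>R f t"] by simp
  also have "\<dots> \<le> (LBINT t. B * (indicator {0..} t *\<^sub>R exp (- \<delta> * t)))"
    using int le unfolding set_integrable_def
    by (intro integral_mono dom integrable_abs) auto
  also have "\<dots> = B * exp_integral \<delta>"
    unfolding exp_integral_def set_lebesgue_integral_def by (rule integral_mult_right_zero)
  finally show "\<bar>LBINT t:{0..}. f t\<bar> \<le> B * exp_integral \<delta>" .
qed

lemma half_line_integral_FTC:
  fixes F f :: "real \<Rightarrow> real"
  assumes F: "\<And>t. (F has_real_derivative f t) (at t)" and f: "continuous_on UNIV f"
    and van: "\<And>t. t > R \<Longrightarrow> F t = 0"
  shows "(LBINT t:{0..}. f t) = - F 0"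
proof -
  define R' where "R' = max R 0 + 1"
  have f0: "f t = 0" if "t > R" for t
  proof (rule DERIV_unique[OF F])
    show "(F has_real_derivative 0) (at t)"
      by (rule has_field_derivative_transform_within_open[of "\<lambda>_. 0" _ _ "{R<..}"])
         (use that van in auto)
  qed
  have "(LBINT t:{0..}. f t) = (LBINT t. indicator {0..R'} t *\<^sub>R f t)"
    unfolding set_lebesgue_integral_def
    by (rule Bochner_Integration.integral_cong) (use f0 in \<open>auto simp: indicator_def R'_def\<close>)
  also have "\<dots> = F R' - F 0"
    using F f by (intro integral_FTC_atLeastAtMost)
      (auto simp: R'_def has_real_derivative_iff_has_vector_derivative[symmetric]
        intro: continuous_on_subset has_field_derivative_at_within)
  also have "F R' = 0" by (rule van) (simp add: R'_def)
  finally show ?thesis by simp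
qed

lemma line_integral_FTC:
  fixes F f :: "real \<Rightarrow> real"
  assumes F: "\<And>t. (F has_real_derivative f t) (at t)" and f: "continuous_on UNIV f"
    and van: "\<And>t. \<bar>t\<bar> > R \<Longrightarrow> F t = 0" and R: "R > 0"
  shows "(LBINT t. f t) = 0"
proof -
  have f0: "f t = 0" if "\<bar>t\<bar> > R" for t
  proof (rule DERIV_unique[OF F])
    show "(F has_real_derivative 0) (at t)"
      by (rule has_field_derivative_transform_within_open[of "\<lambda>_. 0" _ _ "{t. \<bar>t\<bar> > R}"])
         (use that van in \<open>auto intro!: open_Collect_less continuous_intros\<close>)
  qed
  have "(LBINT t. f t) = (LBINT t. indicator {- (R + 1)..R + 1} t *\<^sub>R f t)"
    by (rule Bochner_Integration.integral_cong) (use f0 in \<open>force simp: indicator_def\<close>)+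
  also have "\<dots> = F (R + 1) - F (- (R + 1))"
    using F f R by (intro integral_FTC_atLeastAtMost)
      (auto simp: has_real_derivative_iff_has_vector_derivative[symmetric]
        intro: continuous_on_subset has_field_derivative_at_within)
  finally show ?thesis using van[of "R + 1"] van[of "- (R + 1)"] R by simp
qed
section \<open>Regular distributions and the unit impulse\<close>

lemma locally_integrable_continuous:
  assumes "continuous_on UNIV f" shows "locally_integrable f"
  unfolding locally_integrable_def set_integrable_def
  using borel_integrable_compact[OF _ continuous_on_subset[OF assms subset_UNIV]] by blast

lemma locally_integrable_unit_step:
  assumes "continuous_on UNIV f" shows "locally_integrable (\<lambda>t. unit_step t * f t)"
  unfolding locally_integrable_def set_integrable_def
proof (intro allI impI)
  fix K :: "real set" assume K: "compact K"
  then have "integrable lborel (\<lambda>t. indicator (K \<inter> {0..}) t *\<^sub>R f t)"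
    by (intro borel_integrable_compact compact_Int_closed continuous_on_subset[OF assms]) auto
  moreover have "(\<lambda>t. indicator K t *\<^sub>R (unit_step t * f t)) = (\<lambda>t. indicator (K \<inter> {0..}) t *\<^sub>R f t)"
    by (auto simp: fun_eq_iff indicator_def unit_step_def)
  ultimately show "integrable lborel (\<lambda>t. indicator K t *\<^sub>R (unit_step t * f t))" by simp
qed

lemma pairing_distr_of_fun:
  "locally_integrable f \<Longrightarrow> \<phi> \<in> test_functions \<Longrightarrow> pairing (distr_of_fun f) \<phi> = (LBINT t. f t * \<phi> t)"
  by (simp add: distr_of_fun.rep_eq)

lemma pairing_unit_step:
  assumes "continuous_on UNIV f" "\<phi> \<in> test_functions"
  shows "pairing (distr_of_fun (\<lambda>t. unit_step t * f t)) \<phi> = (LBINT t:{0..}. f t * \<phi> t)"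
  unfolding pairing_distr_of_fun[OF locally_integrable_unit_step[OF assms(1)] assms(2)]
    set_lebesgue_integral_def
  by (rule Bochner_Integration.integral_cong) (auto simp: indicator_def unit_step_def)

lemma integrable_times_test:
  assumes "locally_integrable f" "\<phi> \<in> test_functions" shows "integrable lborel (\<lambda>t. f t * \<phi> t)"
  using locally_integrable_times_test(1)[OF assms, of "supp \<phi>"] assms(2)
  by (simp add: test_functions_def)

lemma half_line_integrable_times_test:
  assumes "continuous_on UNIV f" "\<phi> \<in> test_functions"
  shows "set_integrable lborel {0..} (\<lambda>t. f t * \<phi> t)"
proof -
  have "integrable lborel (\<lambda>t. (unit_step t * f t) * \<phi> t)"
    by (intro integrable_times_test locally_integrable_unit_step assms)
  moreover have "(\<lambda>t. (unit_step t * f t) * \<phi> t) = (\<lambda>t. indicator {0..} t *\<^sub>R (f t * \<phi> t))"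
    by (auto simp: fun_eq_iff indicator_def unit_step_def)
  ultimately show ?thesis by (simp add: set_integrable_def)
qed

lemma distr_of_fun_lincomb:
  assumes "\<And>i. i \<in> I \<Longrightarrow> locally_integrable (f i)" "finite I" "locally_integrable (\<lambda>t. \<Sum>i\<in>I. c i * f i t)"
  shows "(\<Sum>i\<in>I. c i *\<^sub>R distr_of_fun (f i)) = distr_of_fun (\<lambda>t. \<Sum>i\<in>I. c i * f i t)"
proof (rule distr_eqI)
  fix \<phi> assume \<phi>: "\<phi> \<in> test_functions"
  have "pairing (\<Sum>i\<in>I. c i *\<^sub>R distr_of_fun (f i)) \<phi> = (\<Sum>i\<in>I. LBINT t. c i * (f i t * \<phi> t))"
    by (simp add: pairing_distr_sum pairing_scaleR pairing_distr_of_fun assms(1) \<phi>)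
  also have "\<dots> = (LBINT t. \<Sum>i\<in>I. c i * (f i t * \<phi> t))"
    by (intro Bochner_Integration.integral_sum[symmetric] integrable_mult_right integrable_times_test assms(1) \<phi>)
  also have "\<dots> = pairing (distr_of_fun (\<lambda>t. \<Sum>i\<in>I. c i * f i t)) \<phi>"
    by (simp add: pairing_distr_of_fun assms(3) \<phi> sum_distrib_right mult.assoc)
  finally show "pairing (\<Sum>i\<in>I. c i *\<^sub>R distr_of_fun (f i)) \<phi> = pairing (distr_of_fun (\<lambda>t. \<Sum>i\<in>I. c i * f i t)) \<phi>" .
qed

lemma distr_of_fun_zero: "distr_of_fun (\<lambda>_. 0) = 0"
  by (rule distr_eqI) (simp add: pairing_distr_of_fun locally_integrable_continuous pairing_zero)

lemma distr_deriv_of_fun: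
  assumes f: "\<And>t. (f has_real_derivative f' t) (at t)" and f': "continuous_on UNIV f'"
  shows "distr_deriv (distr_of_fun f) = distr_of_fun f'"
proof (rule distr_eqI)
  fix \<phi> assume \<phi>: "\<phi> \<in> test_functions"
  have cf: "continuous_on UNIV f"
    using f by (meson DERIV_isCont continuous_at_imp_continuous_on)
  obtain R where R: "R > 0" "\<And>t. \<bar>t\<bar> > R \<Longrightarrow> \<phi> t = 0"
    using test_functions_vanishE[OF \<phi>] by blast
  note int = integrable_times_test[OF locally_integrable_continuous[OF cf] test_functions_deriv[OF \<phi>]]
    integrable_times_test[OF locally_integrable_continuous[OF f'] \<phi>]
  have "(LBINT t. f' t * \<phi> t + f t * deriv \<phi> t) = 0"
  proof (rule line_integral_FTC[OF _ _ _ R(1)])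
    show "((\<lambda>t. f t * \<phi> t) has_real_derivative f' t * \<phi> t + f t * deriv \<phi> t) (at t)" for t
      using DERIV_mult[OF f[of t] smooth_has_deriv[OF test_smooth[OF \<phi>], of t]] by (simp add: ac_simps)
    show "continuous_on UNIV (\<lambda>t. f' t * \<phi> t + f t * deriv \<phi> t)"
      by (intro continuous_intros f' cf test_functions_continuous test_functions_deriv \<phi>)
  qed (use R in auto)
  then have "(LBINT t. f' t * \<phi> t) + (LBINT t. f t * deriv \<phi> t) = 0"
    using int by simp
  then show "pairing (distr_deriv (distr_of_fun f)) \<phi> = pairing (distr_of_fun f') \<phi>"
    by (simp add: pairing_distr_deriv pairing_distr_of_fun locally_integrable_continuous cf f' \<phi> test_functions_deriv)
qed

text \<open>The distribution \<open>e\<^sup>\<sigma>\<^sup>t G\<close>.\<close>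

definition distr_of_tempered :: "real \<Rightarrow> ((real \<Rightarrow> real) \<Rightarrow> real) \<Rightarrow> distr" where
  "distr_of_tempered \<sigma> G = Abs_distr (\<lambda>\<phi>. if \<phi> \<in> test_functions then G (\<lambda>t. exp (\<sigma> * t) * \<phi> t) else 0)"

lemma pairing_distr_of_tempered:
  "tempered_functional G \<Longrightarrow> \<phi> \<in> test_functions \<Longrightarrow>
    pairing (distr_of_tempered \<sigma> G) \<phi> = G (\<lambda>t. exp (\<sigma> * t) * \<phi> t)"
  unfolding distr_of_tempered_def by (subst Abs_distr_inverse) (auto intro: is_distribution_tempered)

definition distr_delta :: distr where
  "distr_delta = distr_of_tempered 0 (\<lambda>\<phi>. \<phi> 0)"

lemma tempered_functional_delta: "tempered_functional (\<lambda>\<phi>. \<phi> 0)"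
proof -
  have "\<forall>\<phi>\<in>schwartz. \<forall>B. schwartz_bound 0 \<phi> B \<longrightarrow> \<bar>\<phi> 0\<bar> \<le> 1 * B"
    using schwartz_boundD[of 0 _ _ 0 0 0] by simp
  then show ?thesis
    unfolding tempered_functional_iff linear_functional_on_def
    by (intro conjI exI[of _ "1::real"] exI[of _ "0::nat"]) auto
qed

lemma pairing_distr_delta: "\<phi> \<in> test_functions \<Longrightarrow> pairing distr_delta \<phi> = \<phi> 0"
  by (simp add: distr_delta_def pairing_distr_of_tempered tempered_functional_delta)

lemma laplace_pair_delta: "laplace_pair distr_delta (\<lambda>_. 1)"
proof (rule laplace_pairI)
  show "causal distr_delta" by (rule causalI) (simp add: pairing_distr_delta)
  fix \<sigma> :: real
  have "tempered_extension distr_delta \<sigma> (\<lambda>\<phi>. \<phi> 0)"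
    unfolding tempered_extension_def
    using pairing_distr_delta[OF test_functions_exp, of _ "- \<sigma>"] tempered_functional_delta by simp
  moreover have "complex_pairing (\<lambda>\<phi>. \<phi> 0) z = 1" for z
    by (simp add: complex_pairing_def complex_eq_iff re_exp_def causal_cutoff_eq_1)
  ultimately show "\<exists>G. tempered_extension distr_delta \<sigma> G \<and>
      (\<forall>s. Re s > \<sigma> \<longrightarrow> complex_pairing G (- (s - of_real \<sigma>)) = 1)"
    by blast
qed

lemma causal_unit_step:
  assumes "continuous_on UNIV f" shows "causal (distr_of_fun (\<lambda>t. unit_step t * f t))"
proof (rule causalI)
  fix \<phi> and \<epsilon> :: real
  assume \<phi>: "\<phi> \<in> test_functions" "\<epsilon> > 0" "\<And>t. t > - \<epsilon> \<Longrightarrow> \<phi> t = 0"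
  have "(LBINT t:{0..}. f t * \<phi> t) = (LBINT t::real. 0)"
    unfolding set_lebesgue_integral_def
    by (rule Bochner_Integration.integral_cong) (use \<phi>(2,3) in \<open>auto simp: indicator_def\<close>)
  then show "pairing (distr_of_fun (\<lambda>t. unit_step t * f t)) \<phi> = 0"
    by (simp add: pairing_unit_step[OF assms \<phi>(1)])
qed

lemma distr_deriv_unit_step:
  assumes f: "\<And>t. (f has_real_derivative f' t) (at t)" and f': "continuous_on UNIV f'"
  shows "distr_deriv (distr_of_fun (\<lambda>t. unit_step t * f t))
    = distr_of_fun (\<lambda>t. unit_step t * f' t) + f 0 *\<^sub>R distr_delta"
proof (rule distr_eqI)
  fix \<phi> assume \<phi>: "\<phi> \<in> test_functions"
  have cf: "continuous_on UNIV f"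
    using f by (meson DERIV_isCont continuous_at_imp_continuous_on)
  obtain R where R: "R > 0" "\<And>t. \<bar>t\<bar> > R \<Longrightarrow> \<phi> t = 0"
    using test_functions_vanishE[OF \<phi>] by blast
  have "(LBINT t:{0..}. f' t * \<phi> t + f t * deriv \<phi> t) = - (f 0 * \<phi> 0)"
  proof (rule half_line_integral_FTC)
    show "((\<lambda>t. f t * \<phi> t) has_real_derivative f' t * \<phi> t + f t * deriv \<phi> t) (at t)" for t
      using DERIV_mult[OF f[of t] smooth_has_deriv[OF test_smooth[OF \<phi>], of t]] by (simp add: ac_simps)
    show "continuous_on UNIV (\<lambda>t. f' t * \<phi> t + f t * deriv \<phi> t)"
      by (intro continuous_intros f' cf test_functions_continuous test_functions_deriv \<phi>)
    show "f t * \<phi> t = 0" if "t > R" for t using R that by simp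
  qed
  then have "(LBINT t:{0..}. f' t * \<phi> t) + (LBINT t:{0..}. f t * deriv \<phi> t) = - (f 0 * \<phi> 0)"
    using set_integral_add(2)[OF half_line_integrable_times_test[OF f' \<phi>]
        half_line_integrable_times_test[OF cf test_functions_deriv[OF \<phi>]]] by simp
  then show "pairing (distr_deriv (distr_of_fun (\<lambda>t. unit_step t * f t))) \<phi>
      = pairing (distr_of_fun (\<lambda>t. unit_step t * f' t) + f 0 *\<^sub>R distr_delta) \<phi>"
    by (simp add: pairing_distr_deriv pairing_plus pairing_scaleR pairing_distr_delta \<phi>
        pairing_unit_step[OF cf test_functions_deriv[OF \<phi>]] pairing_unit_step[OF f' \<phi>])
qed

lemma laplace_transformable_unit_step:
  assumes f: "continuous_on UNIV f" and B: "\<And>t. t \<ge> 0 \<Longrightarrow> \<bar>f t\<bar> \<le> B * exp (\<rho> * t)"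
  shows "laplace_transformable (distr_of_fun (\<lambda>t. unit_step t * f t))"
proof (rule laplace_transformableI[OF causal_unit_step[OF f]])
  fix \<sigma> assume \<sigma>: "\<sigma> > \<rho>"
  define G where "G \<phi> = (LBINT t:{0..}. (exp (- \<sigma> * t) * f t) * \<phi> t)" for \<phi>
  have B0: "B \<ge> 0" using B[of 0] by simp
  have bound: "set_integrable lborel {0..} (\<lambda>t. (exp (- \<sigma> * t) * f t) * \<phi> t)"
      "\<bar>G \<phi>\<bar> \<le> (B * A) * exp_integral (\<sigma> - \<rho>)"
    if \<phi>: "\<phi> \<in> schwartz" and A: "schwartz_bound 0 \<phi> A" for \<phi> A
  proof -
    have c: "continuous_on UNIV (\<lambda>t. (exp (- \<sigma> * t) * f t) * \<phi> t)"
      by (intro continuous_intros f smooth_continuous schwartz_smooth \<phi>)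
    have le: "\<bar>(exp (- \<sigma> * t) * f t) * \<phi> t\<bar> \<le> (B * A) * exp (- (\<sigma> - \<rho>) * t)" if t: "t \<ge> 0" for t
    proof -
      have "\<bar>(exp (- \<sigma> * t) * f t) * \<phi> t\<bar> \<le> (exp (- \<sigma> * t) * (B * exp (\<rho> * t))) * A"
        unfolding abs_mult using B[OF t] schwartz_boundD[OF A, of 0 0 t] B0
        by (intro mult_mono) auto
      also have "\<dots> = (B * A) * (exp (- \<sigma> * t) * exp (\<rho> * t))" by simp
      also have "exp (- \<sigma> * t) * exp (\<rho> * t) = exp (- (\<sigma> - \<rho>) * t)"
        unfolding exp_add[symmetric] by (simp add: algebra_simps)
      finally show ?thesis .
    qed
    have \<delta>: "\<sigma> - \<rho> > 0" using \<sigma> by simp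
    from half_line_integral_bound[OF \<delta> c le]
    show "set_integrable lborel {0..} (\<lambda>t. (exp (- \<sigma> * t) * f t) * \<phi> t)"
      "\<bar>G \<phi>\<bar> \<le> (B * A) * exp_integral (\<sigma> - \<rho>)" by (simp_all add: G_def)
  qed
  note int = bound(1)[OF _ schwartz_bound_norm]
  have "tempered_functional G"
    unfolding tempered_functional_iff linear_functional_on_def
  proof (intro conjI ballI allI)
    fix \<phi> \<psi> assume \<phi>: "\<phi> \<in> schwartz" and \<psi>: "\<psi> \<in> schwartz"
    show "G (\<lambda>t. \<phi> t + \<psi> t) = G \<phi> + G \<psi>"
      unfolding G_def distrib_left by (intro set_integral_add(2) int \<phi> \<psi>)
  next
    fix c \<phi>
    show "G (\<lambda>t. c * \<phi> t) = c * G \<phi>"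
      unfolding G_def mult.left_commute[of _ c] by (rule set_integral_mult_right)
  next
    have "\<forall>\<phi>\<in>schwartz. \<forall>A. schwartz_bound 0 \<phi> A \<longrightarrow> \<bar>G \<phi>\<bar> \<le> (B * exp_integral (\<sigma> - \<rho>)) * A"
      using bound(2) by (simp add: ac_simps)
    moreover have "B * exp_integral (\<sigma> - \<rho>) \<ge> 0" using B0 exp_integral_nonneg by simp
    ultimately show "\<exists>C\<ge>0. \<exists>n. \<forall>\<phi>\<in>schwartz. \<forall>A. schwartz_bound n \<phi> A \<longrightarrow> \<bar>G \<phi>\<bar> \<le> C * A" by blast
  qed
  moreover have "G \<phi> = pairing (distr_of_fun (\<lambda>t. unit_step t * f t)) (\<lambda>t. exp (- \<sigma> * t) * \<phi> t)"
    if "\<phi> \<in> test_functions" for \<phi>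
    unfolding pairing_unit_step[OF f test_functions_exp[OF that]] G_def by (simp add: ac_simps)
  ultimately have "tempered_extension (distr_of_fun (\<lambda>t. unit_step t * f t)) \<sigma> G"
    unfolding tempered_extension_def by blast
  then show "\<exists>G. tempered_extension (distr_of_fun (\<lambda>t. unit_step t * f t)) \<sigma> G" by blast
qed

text \<open>The fundamental lemma of the calculus of variations, localised to \<open>U\<close> so that it applies to
  functions with a jump at the origin.\<close>

lemma regular_eq_on_open:
  assumes loc: "locally_integrable f" "locally_integrable g" and U: "open U" "t\<^sub>0 \<in> U"
    and cont: "continuous_on U f" "continuous_on U g"
    and eq: "\<And>\<phi>. \<phi> \<in> test_functions \<Longrightarrow> (\<And>t. t \<notin> U \<Longrightarrow> \<phi> t = 0) \<Longrightarrow>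
      pairing (distr_of_fun f) \<phi> = pairing (distr_of_fun g) \<phi>"
  shows "f t\<^sub>0 = g t\<^sub>0"
proof -
  have "f t\<^sub>0 \<ge> g t\<^sub>0"
    if loc: "locally_integrable f" "locally_integrable g" and cont: "continuous_on U f" "continuous_on U g"
      and eq: "\<And>\<phi>. \<phi> \<in> test_functions \<Longrightarrow> (\<And>t. t \<notin> U \<Longrightarrow> \<phi> t = 0) \<Longrightarrow>
        pairing (distr_of_fun f) \<phi> = pairing (distr_of_fun g) \<phi>" for f g
  proof (rule ccontr)
    assume "\<not> f t\<^sub>0 \<ge> g t\<^sub>0"
    define m where "m = (g t\<^sub>0 - f t\<^sub>0) / 2"
    have m: "m > 0" "g t\<^sub>0 - f t\<^sub>0 > m" using \<open>\<not> f t\<^sub>0 \<ge> g t\<^sub>0\<close> by (auto simp: m_def)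
    define d where "d t = g t - f t" for t
    have "isCont d t\<^sub>0"
      unfolding d_def using cont U by (intro continuous_intros) (auto simp: continuous_on_eq_continuous_at)
    then have "(d \<longlongrightarrow> d t\<^sub>0) (nhds t\<^sub>0)"
      unfolding isCont_def tendsto_at_iff_tendsto_nhds .
    then have "\<forall>\<^sub>F t in nhds t\<^sub>0. d t > m"
      by (rule order_tendstoD) (use m(2) in \<open>simp add: d_def\<close>)
    moreover have "\<forall>\<^sub>F t in nhds t\<^sub>0. t \<in> U" by (rule eventually_nhds_in_open[OF U])
    ultimately have "\<forall>\<^sub>F t in nhds t\<^sub>0. g t - f t > m \<and> t \<in> U"
      unfolding d_def by (rule eventually_conj)
    then obtain r where r: "r > 0" "\<And>t. \<bar>t - t\<^sub>0\<bar> < r \<Longrightarrow> g t - f t > m \<and> t \<in> U"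
      unfolding eventually_nhds_metric dist_real_def by blast
    \<comment> \<open>the plateau of half-width \<open>\<delta>\<close> lives on an interval of half-width \<open>2 \<delta> < r\<close>\<close>
    define \<delta> where "\<delta> = r / 3"
    have \<delta>: "\<delta> > 0" using r by (simp add: \<delta>_def)
    define \<phi> where "\<phi> t = plateau ((t - t\<^sub>0) / \<delta>)" for t
    have \<phi>: "\<phi> \<in> test_functions"
      unfolding \<phi>_def[abs_def] by (rule test_functions_plateau_affine[OF \<delta>])
    have far: "\<phi> t = 0" if "\<bar>t - t\<^sub>0\<bar> \<ge> r" for t
      unfolding \<phi>_def using that r by (intro plateau_eq_0) (simp add: \<delta>_def field_simps)
    have "pairing (distr_of_fun f) \<phi> = pairing (distr_of_fun g) \<phi>"
    proof (rule eq[OF \<phi>])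
      fix t assume "t \<notin> U"
      then show "\<phi> t = 0" using r(2)[of t] far[of t] by force
    qed
    then have "(LBINT t. g t * \<phi> t) - (LBINT t. f t * \<phi> t) = 0"
      by (simp add: pairing_distr_of_fun loc \<phi>)
    then have 0: "(LBINT t. g t * \<phi> t - f t * \<phi> t) = 0"
      by (simp add: integrable_times_test loc \<phi>)
    have "m * indicator {t\<^sub>0 - \<delta>..t\<^sub>0 + \<delta>} t \<le> g t * \<phi> t - f t * \<phi> t" for t
    proof (cases "\<bar>t - t\<^sub>0\<bar> < r")
      case True
      have "0 \<le> (g t - f t) * \<phi> t"
        using r(2)[OF True] m(1) by (intro mult_nonneg_nonneg) (auto simp: \<phi>_def plateau_nonneg)
      moreover have "\<phi> t = 1" if "t \<in> {t\<^sub>0 - \<delta>..t\<^sub>0 + \<delta>}"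
      proof -
        have "\<bar>(t - t\<^sub>0) / \<delta>\<bar> \<le> 1" using that \<delta> by (auto simp: abs_if divide_le_eq le_divide_eq)
        then show ?thesis unfolding \<phi>_def by (rule plateau_eq_1)
      qed
      ultimately show ?thesis using r(2)[OF True] by (auto simp: indicator_def left_diff_distrib)
    next
      case False
      then show ?thesis using far[of t] r(1) by (auto simp: indicator_def \<delta>_def)
    qed
    moreover have "integrable lborel (indicator {t\<^sub>0 - \<delta>..t\<^sub>0 + \<delta>} :: real \<Rightarrow> real)"
      using \<delta> by (intro integrable_real_indicator) (simp_all add: emeasure_lborel_Icc)
    ultimately have "(LBINT t. m * indicator {t\<^sub>0 - \<delta>..t\<^sub>0 + \<delta>} t) \<le> (LBINT t. g t * \<phi> t - f t * \<phi> t)"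
      by (intro integral_mono integrable_mult_right Bochner_Integration.integrable_diff integrable_times_test loc \<phi>)
    moreover have "(LBINT t. m * indicator {t\<^sub>0 - \<delta>..t\<^sub>0 + \<delta>} t) = m * (2 * \<delta>)"
      using \<delta> by simp
    ultimately show False using 0 mult_pos_pos[OF m(1) \<delta>] by linarith
  qed
  note le = this
  show ?thesis
  proof (rule antisym)
    show "g t\<^sub>0 \<le> f t\<^sub>0" by (rule le[OF loc cont]) (rule eq)
    show "f t\<^sub>0 \<le> g t\<^sub>0" by (rule le[OF loc(2,1) cont(2,1)]) (rule eq[symmetric])
  qed
qed

lemma distr_of_fun_inject:
  assumes "continuous_on UNIV f" "continuous_on UNIV g" "distr_of_fun f = distr_of_fun g"
  shows "f = g"
  using regular_eq_on_open[of f g UNIV] assms by (auto simp: locally_integrable_continuous)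


section \<open>Real-analytic functions\<close>

lemma real_analytic_continuous:
  assumes "real_analytic g" shows "continuous_on UNIV g"
proof -
  have "isCont g t\<^sub>0" for t\<^sub>0
  proof -
    obtain c r where r: "r > 0" "\<And>t. \<bar>t - t\<^sub>0\<bar> < r \<Longrightarrow> (\<lambda>n. c n * (t - t\<^sub>0) ^ n) sums g t"
      using assms unfolding real_analytic_def by blast
    have "(\<lambda>h. g (t\<^sub>0 + h)) \<midarrow>0\<rightarrow> c 0"
      using r(2)[of "t\<^sub>0 + _"] by (intro powser_limit_0[OF r(1)]) auto
    moreover have "g t\<^sub>0 = c 0"
      using r(2)[of t\<^sub>0] r(1) by simp
    ultimately show ?thesis by (simp add: isCont_iff)
  qed
  then show ?thesis by (intro continuous_at_imp_continuous_on) auto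
qed

text \<open>The interior of the zero set is open and closed: at a limit point of it the local power series has
  non-isolated zeros, so all its coefficients vanish.\<close>

lemma real_analytic_zero:
  assumes g: "real_analytic g" and U: "open U" "U \<noteq> {}" "\<And>t. t \<in> U \<Longrightarrow> g t = 0"
  shows "g t = 0"
proof -
  define S where "S = interior {t. g t = 0}"
  have "closed S"
    unfolding closed_limpt
  proof (intro allI impI)
    fix t\<^sub>0 assume lim: "t\<^sub>0 islimpt S"
    obtain c r where r: "r > 0" "\<And>t. \<bar>t - t\<^sub>0\<bar> < r \<Longrightarrow> (\<lambda>n. c n * (t - t\<^sub>0) ^ n) sums g t"
      using g unfolding real_analytic_def by blast
    have "closed {t. g t = 0}"
      using real_analytic_continuous[OF g] by (intro closed_Collect_eq) auto
    moreover have "t\<^sub>0 islimpt {t. g t = 0}"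
      using lim by (rule islimpt_subset) (simp add: S_def interior_subset)
    ultimately have g0: "g t\<^sub>0 = 0" by (simp add: closed_limpt)
    have "c m = 0" for m
    proof (cases "m = 0")
      case True
      then show ?thesis
        using r(2)[of t\<^sub>0] r(1) g0 by simp
    next
      case False
      show ?thesis
      proof (rule ccontr)
        assume "c m \<noteq> 0"
        then obtain s where s: "s > 0" "\<And>t. t \<in> cball t\<^sub>0 s - {t\<^sub>0} \<Longrightarrow> g t \<noteq> 0"
          using powser_0_nonzero[of r t\<^sub>0 c g m] r g0 False by auto
        obtain t where "t \<in> S" "t \<in> ball t\<^sub>0 s" "t \<noteq> t\<^sub>0"
          using lim s(1) unfolding islimpt_def by (meson centre_in_ball open_ball)
        then have "g t = 0" using interior_subset by (auto simp: S_def)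
        then show False using s(2)[of t] \<open>t \<in> ball t\<^sub>0 s\<close> \<open>t \<noteq> t\<^sub>0\<close> by auto
      qed
    qed
    then have "g t = 0" if "\<bar>t - t\<^sub>0\<bar> < r" for t
      using r(2)[OF that] by (simp add: sums_iff)
    then have "ball t\<^sub>0 r \<subseteq> {t. g t = 0}" by (auto simp: dist_real_def abs_minus_commute)
    then show "t\<^sub>0 \<in> S" unfolding S_def using r(1) by (meson centre_in_ball interiorI open_ball)
  qed
  moreover have "open S" by (simp add: S_def)
  moreover have "S \<noteq> {}"
    using U interior_maximal[of U "{t. g t = 0}"] by (auto simp: S_def)
  ultimately have "S = UNIV" using clopen by blast
  then show ?thesis using interior_subset unfolding S_def by blast
qed

lemma real_analytic_diff:
  assumes "real_analytic f" "real_analytic g" shows "real_analytic (\<lambda>t. f t - g t)"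
  unfolding real_analytic_def
proof
  fix t\<^sub>0
  obtain a r where r: "r > 0" "\<And>t. \<bar>t - t\<^sub>0\<bar> < r \<Longrightarrow> (\<lambda>n. a n * (t - t\<^sub>0) ^ n) sums f t"
    using assms(1) unfolding real_analytic_def by blast
  obtain b s where s: "s > 0" "\<And>t. \<bar>t - t\<^sub>0\<bar> < s \<Longrightarrow> (\<lambda>n. b n * (t - t\<^sub>0) ^ n) sums g t"
    using assms(2) unfolding real_analytic_def by blast
  have "(\<lambda>n. (a n - b n) * (t - t\<^sub>0) ^ n) sums (f t - g t)" if "\<bar>t - t\<^sub>0\<bar> < min r s" for t
    using sums_diff[OF r(2) s(2)] that by (simp add: left_diff_distrib)
  then show "\<exists>c. \<exists>r>0. \<forall>t. \<bar>t - t\<^sub>0\<bar> < r \<longrightarrow> (\<lambda>n. c n * (t - t\<^sub>0) ^ n) sums (f t - g t)"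
    using r s by (intro exI[of _ "\<lambda>n. a n - b n"] exI[of _ "min r s"]) auto
qed

lemma real_analytic_unit_step_inject:
  assumes "real_analytic f" "real_analytic g"
    and eq: "distr_of_fun (\<lambda>t. unit_step t * f t) = distr_of_fun (\<lambda>t. unit_step t * g t)"
  shows "f = g"
proof
  fix t
  have cont: "continuous_on UNIV f" "continuous_on UNIV g"
    using assms by (auto intro: real_analytic_continuous)
  have sub: "continuous_on {0<..} (\<lambda>t. unit_step t * h t)" if "continuous_on UNIV h" for h
    by (subst continuous_on_cong[OF refl, of _ _ h])
       (auto simp: unit_step_def intro: continuous_on_subset[OF that])
  have "f t - g t = 0" if "t \<in> {0<..}" for t
    using regular_eq_on_open[OF locally_integrable_unit_step[OF cont(1)] locally_integrable_unit_step[OF cont(2)]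
        open_greaterThan that sub[OF cont(1)] sub[OF cont(2)]] eq that
    by (simp add: unit_step_def)
  moreover have "{0::real<..} \<noteq> {}" using greaterThan_non_empty by blast
  ultimately have "f t - g t = 0"
    using real_analytic_zero[OF real_analytic_diff[OF assms(1,2)] open_greaterThan] by blast
  then show "f t = g t" by simp
qed
section \<open>Solutions of the homogeneous equation\<close>

text \<open>The companion matrix, acting on sequences whose first \<open>N\<close> entries are initial values. One step turns the initial values of a solution into those of its
  derivative, so that the Taylor coefficients at \<open>0\<close> are the first entries of the iterates.\<close>

definition companion :: "nat \<Rightarrow> (nat \<Rightarrow> real) \<Rightarrow> (nat \<Rightarrow> real) \<Rightarrow> nat \<Rightarrow> real" where
  "companion N a v i = (if Suc i < N then v (Suc i) else - (\<Sum>j<N. a j * v j) / a N)"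

definition ode_sol :: "nat \<Rightarrow> (nat \<Rightarrow> real) \<Rightarrow> (nat \<Rightarrow> real) \<Rightarrow> real \<Rightarrow> real" where
  "ode_sol N a v t = (\<Sum>n. ((companion N a ^^ n) v 0 / fact n) * t ^ n)"

definition companion_rate :: "nat \<Rightarrow> (nat \<Rightarrow> real) \<Rightarrow> real" where
  "companion_rate N a = 1 + (\<Sum>j<N. \<bar>a j\<bar>) / \<bar>a N\<bar>"

definition initial_norm :: "nat \<Rightarrow> (nat \<Rightarrow> real) \<Rightarrow> real" where
  "initial_norm N v = (\<Sum>j<N. \<bar>v j\<bar>)"

lemma companion_rate_ge_1: "companion_rate N a \<ge> 1"
  unfolding companion_rate_def by (simp add: sum_nonneg)

lemma companion_bound:
  assumes V: "\<And>j. j < N \<Longrightarrow> \<bar>v j\<bar> \<le> V" "V \<ge> 0"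
  shows "\<bar>companion N a v i\<bar> \<le> companion_rate N a * V"
proof (cases "Suc i < N")
  case True
  then have "\<bar>companion N a v i\<bar> \<le> 1 * V" using V(1) by (simp add: companion_def)
  also have "\<dots> \<le> companion_rate N a * V"
    by (intro mult_right_mono companion_rate_ge_1 V)
  finally show ?thesis .
next
  case False
  have "\<bar>\<Sum>j<N. a j * v j\<bar> \<le> (\<Sum>j<N. \<bar>a j\<bar> * V)"
    using V by (intro order_trans[OF sum_abs] sum_mono) (simp add: abs_mult mult_left_mono)
  then have "\<bar>companion N a v i\<bar> \<le> (\<Sum>j<N. \<bar>a j\<bar> * V) / \<bar>a N\<bar>"
    using False by (simp add: companion_def divide_right_mono)
  also have "\<dots> \<le> companion_rate N a * V"
    using V(2) by (simp add: companion_rate_def sum_distrib_right[symmetric] distrib_right)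
  finally show ?thesis .
qed

lemma companion_funpow_bound:
  assumes "j < N"
  shows "\<bar>(companion N a ^^ n) v j\<bar> \<le> companion_rate N a ^ n * initial_norm N v"
  using assms
proof (induction n arbitrary: j)
  case 0
  then show ?case unfolding initial_norm_def
    by (auto intro: member_le_sum[of j "{..<N}" "\<lambda>j. \<bar>v j\<bar>"])
next
  case (Suc n)
  have "initial_norm N v \<ge> 0" by (simp add: initial_norm_def sum_nonneg)
  then have "\<bar>companion N a ((companion N a ^^ n) v) j\<bar>
      \<le> companion_rate N a * (companion_rate N a ^ n * initial_norm N v)"
    using companion_rate_ge_1[of N a] by (intro companion_bound Suc.IH) auto
  then show ?case by (simp add: mult.assoc)
qed

lemma ode_sol_coeff_bound:
  assumes "N \<ge> 1"
  shows "\<bar>((companion N a ^^ n) v 0 / fact n) * t ^ n\<bar>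
    \<le> initial_norm N v * ((companion_rate N a * \<bar>t\<bar>) ^ n /\<^sub>R fact n)"
proof -
  have "\<bar>(companion N a ^^ n) v 0\<bar> * (\<bar>t\<bar> ^ n / fact n)
      \<le> companion_rate N a ^ n * initial_norm N v * (\<bar>t\<bar> ^ n / fact n)"
    using assms by (intro mult_right_mono companion_funpow_bound) auto
  then show ?thesis
    by (simp add: abs_mult power_abs power_mult_distrib field_simps)
qed

lemma ode_sol_summable:
  assumes "N \<ge> 1" shows "summable (\<lambda>n. ((companion N a ^^ n) v 0 / fact n) * t ^ n)"
proof (rule summable_comparison_test'[of _ 0])
  show "summable (\<lambda>n. initial_norm N v * ((companion_rate N a * \<bar>t\<bar>) ^ n /\<^sub>R fact n))"
    by (intro summable_mult summable_exp_generic)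
qed (use ode_sol_coeff_bound[OF assms] in \<open>simp only: real_norm_def\<close>)

lemma ode_sol_bound:
  assumes "N \<ge> 1"
  shows "\<bar>ode_sol N a v t\<bar> \<le> initial_norm N v * exp (companion_rate N a * \<bar>t\<bar>)"
proof -
  have "norm (ode_sol N a v t) \<le> (\<Sum>n. initial_norm N v * ((companion_rate N a * \<bar>t\<bar>) ^ n /\<^sub>R fact n))"
    unfolding ode_sol_def using ode_sol_coeff_bound[OF assms]
    by (intro norm_suminf_le summable_mult summable_exp_generic) (simp only: real_norm_def)
  also have "\<dots> = initial_norm N v * exp (companion_rate N a * \<bar>t\<bar>)"
    unfolding exp_def by (intro suminf_mult summable_exp_generic)
  finally show ?thesis by simp
qed

lemma ode_sol_0: "ode_sol N a v 0 = v 0"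
  unfolding ode_sol_def powser_zero by simp

lemma ode_sol_deriv:
  assumes "N \<ge> 1"
  shows "(ode_sol N a v has_real_derivative ode_sol N a (companion N a v) t) (at t)"
proof -
  have "((\<lambda>t. \<Sum>n. ((companion N a ^^ n) v 0 / fact n) * t ^ n) has_real_derivative
      (\<Sum>n. diffs (\<lambda>n. (companion N a ^^ n) v 0 / fact n) n * t ^ n)) (at t)"
    by (intro termdiffs_strong_converges_everywhere ode_sol_summable assms)
  moreover have "diffs (\<lambda>n. (companion N a ^^ n) v 0 / fact n) = (\<lambda>n. (companion N a ^^ n) (companion N a v) 0 / fact n)"
    by (auto simp: diffs_def fun_eq_iff funpow_swap1 field_simps simp del: of_nat_Suc)
  ultimately show ?thesis by (simp add: ode_sol_def[abs_def])
qed

lemma ode_sol_continuous: "N \<ge> 1 \<Longrightarrow> continuous_on S (ode_sol N a v)"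
  by (meson DERIV_isCont continuous_at_imp_continuous_on ode_sol_deriv)

lemma funpow_deriv_ode_sol:
  assumes "N \<ge> 1" shows "(deriv ^^ k) (ode_sol N a v) = ode_sol N a ((companion N a ^^ k) v)"
proof (induction k)
  case (Suc k)
  have "deriv (ode_sol N a w) = ode_sol N a (companion N a w)" for w
    by (intro ext DERIV_imp_deriv ode_sol_deriv assms)
  then show ?case using Suc by simp
qed simp

lemma smooth_ode_sol:
  assumes "N \<ge> 1" shows "smooth (ode_sol N a v)"
  unfolding smooth_def funpow_deriv_ode_sol[OF assms] real_differentiable_def
  using ode_sol_deriv[OF assms] by blast

lemma companion_funpow_low: "i + n < N \<Longrightarrow> (companion N a ^^ n) v i = v (i + n)"
  by (induction n arbitrary: i) (auto simp: companion_def)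

lemma companion_cong: "(\<And>j. j < N \<Longrightarrow> v j = w j) \<Longrightarrow> companion N a v = companion N a w"
  unfolding companion_def by (auto simp: fun_eq_iff)

lemma ode_sol_cong:
  assumes "N \<ge> 1" "\<And>j. j < N \<Longrightarrow> v j = w j" shows "ode_sol N a v = ode_sol N a w"
proof -
  have "(companion N a ^^ n) v 0 = (companion N a ^^ n) w 0" for n
    using assms companion_cong[of N v w a] by (cases n) (auto simp: funpow_swap1)
  then show ?thesis by (simp add: ode_sol_def fun_eq_iff)
qed

lemma companion_characteristic:
  assumes "N \<ge> 1" "a N \<noteq> 0" shows "(\<Sum>n=0..N. a n * (companion N a ^^ n) v 0) = 0"
proof -
  have "(companion N a ^^ N) v 0 = (companion N a ^^ (N - 1)) (companion N a v) 0"
    using assms(1) funpow_Suc_right[of "N - 1" "companion N a"] by simp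
  also have "\<dots> = companion N a v (N - 1)"
    using assms(1) companion_funpow_low[of 0 "N - 1" N a "companion N a v"] by simp
  also have "\<dots> = - (\<Sum>j<N. a j * v j) / a N" using assms(1) by (simp add: companion_def)
  finally have "a N * (companion N a ^^ N) v 0 = - (\<Sum>j<N. a j * v j)" using assms(2) by simp
  moreover have "(\<Sum>n<N. a n * (companion N a ^^ n) v 0) = (\<Sum>n<N. a n * v n)"
    by (intro sum.cong refl) (use companion_funpow_low[of 0 _ N a v] in simp)
  moreover have "{0..N} = insert N {..<N}" by auto
  ultimately show ?thesis by simp
qed

lemma ode_sol_equation:
  assumes "N \<ge> 1" "a N \<noteq> 0"
  shows "(\<Sum>n=0..N. a n * ode_sol N a ((companion N a ^^ n) v) t) = 0"
proof -
  let ?c = "\<lambda>n m. a n * (((companion N a ^^ m) ((companion N a ^^ n) v) 0 / fact m) * t ^ m)"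
  have "(\<Sum>n=0..N. a n * ode_sol N a ((companion N a ^^ n) v) t) = (\<Sum>n=0..N. \<Sum>m. ?c n m)"
    unfolding ode_sol_def
    by (intro sum.cong refl suminf_mult[symmetric] ode_sol_summable assms)
  also have "\<dots> = (\<Sum>m. \<Sum>n=0..N. ?c n m)"
    by (intro suminf_sum[symmetric] summable_mult ode_sol_summable assms)
  also have "(\<lambda>m. \<Sum>n=0..N. ?c n m) = (\<lambda>m. 0)"
  proof
    fix m
    have swap: "(companion N a ^^ m) ((companion N a ^^ n) v) = (companion N a ^^ n) ((companion N a ^^ m) v)" for n
      by (metis add.commute comp_apply funpow_add)
    have "(\<Sum>n=0..N. ?c n m) = (\<Sum>n=0..N. a n * (companion N a ^^ n) ((companion N a ^^ m) v) 0) * (t ^ m / fact m)"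
      unfolding swap sum_distrib_right by (intro sum.cong refl) simp
    then show "(\<Sum>n=0..N. ?c n m) = 0"
      by (simp only: companion_characteristic[where a = a, OF assms] mult_zero_left)
  qed
  finally show ?thesis by simp
qed

text \<open>The Taylor remainder at an arbitrary centre tends to \<open>0\<close> because the derivatives grow at most
  geometrically on bounded intervals.\<close>

lemma ode_sol_taylor:
  assumes "N \<ge> 1"
  shows "(\<lambda>n. ode_sol N a ((companion N a ^^ n) v) t / fact n * h ^ n) sums ode_sol N a v (t + h)"
proof -
  let ?z = "\<lambda>n. ode_sol N a ((companion N a ^^ n) v)"
  let ?\<rho> = "companion_rate N a"
  have N: "0 < N" using assms by simp
  have entry: "initial_norm N ((companion N a ^^ n) v) \<le> real N * (?\<rho> ^ n * initial_norm N v)" for n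
    unfolding initial_norm_def[of N "(companion N a ^^ n) v"]
    using sum_mono[of "{..<N}" _ "\<lambda>_. ?\<rho> ^ n * initial_norm N v", OF companion_funpow_bound[where N = N and a = a and n = n and v = v]]
    by simp
  let ?E = "real N * initial_norm N v * exp (?\<rho> * (\<bar>t\<bar> + \<bar>h\<bar>))"
  have rem: "\<bar>ode_sol N a v (t + h) - (\<Sum>m<n. ?z m t / fact m * h ^ m)\<bar> \<le> ?E * ((?\<rho> * \<bar>h\<bar>) ^ n /\<^sub>R fact n)" for n
  proof -
    have "\<exists>\<xi>. \<bar>\<xi>\<bar> \<le> \<bar>h\<bar> \<and> ode_sol N a v (t + h)
        = (\<Sum>m<n. ?z m (t + 0) / fact m * h ^ m) + ?z n (t + \<xi>) / fact n * h ^ n"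
    proof (rule Maclaurin_bi_le[of "\<lambda>n \<xi>. ?z n (t + \<xi>)" "\<lambda>\<xi>. ode_sol N a v (t + \<xi>)" n h])
      have "((\<lambda>\<xi>. ?z m (t + \<xi>)) has_real_derivative ?z (Suc m) (t + s)) (at s)" for m s
        using DERIV_shift[of "?z m" _ s t] ode_sol_deriv[OF assms, of a "(companion N a ^^ m) v" "s + t"]
        by (simp add: add.commute)
      then show "\<forall>m s. m < n \<and> \<bar>s\<bar> \<le> \<bar>h\<bar> \<longrightarrow>
          ((\<lambda>\<xi>. ?z m (t + \<xi>)) has_real_derivative ?z (Suc m) (t + s)) (at s)" by blast
    qed simp
    then obtain \<xi> where \<xi>: "\<bar>\<xi>\<bar> \<le> \<bar>h\<bar>"
      "ode_sol N a v (t + h) - (\<Sum>m<n. ?z m t / fact m * h ^ m) = ?z n (t + \<xi>) / fact n * h ^ n"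
      by auto
    have "\<bar>?z n (t + \<xi>)\<bar> \<le> initial_norm N ((companion N a ^^ n) v) * exp (?\<rho> * \<bar>t + \<xi>\<bar>)"
      by (rule ode_sol_bound[OF assms])
    also have "\<dots> \<le> (real N * (?\<rho> ^ n * initial_norm N v)) * exp (?\<rho> * (\<bar>t\<bar> + \<bar>h\<bar>))"
    proof (rule mult_mono[OF entry])
      have "\<bar>t + \<xi>\<bar> \<le> \<bar>t\<bar> + \<bar>h\<bar>" using \<xi>(1) by linarith
      then show "exp (?\<rho> * \<bar>t + \<xi>\<bar>) \<le> exp (?\<rho> * (\<bar>t\<bar> + \<bar>h\<bar>))"
        using companion_rate_ge_1[of N a] by (simp add: mult_left_mono)
      show "0 \<le> real N * (?\<rho> ^ n * initial_norm N v)"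
        using companion_rate_ge_1[of N a] by (simp add: initial_norm_def sum_nonneg)
    qed simp
    finally have "\<bar>?z n (t + \<xi>)\<bar> * (\<bar>h\<bar> ^ n / fact n)
      \<le> (real N * (?\<rho> ^ n * initial_norm N v)) * exp (?\<rho> * (\<bar>t\<bar> + \<bar>h\<bar>)) * (\<bar>h\<bar> ^ n / fact n)"
      by (rule mult_right_mono) simp
    then show ?thesis
      unfolding \<xi>(2) by (simp add: abs_mult power_abs power_mult_distrib divide_inverse ac_simps)
  qed
  have "(\<lambda>n. ?E * ((?\<rho> * \<bar>h\<bar>) ^ n /\<^sub>R fact n)) \<longlonglongrightarrow> 0"
    by (intro tendsto_mult_right_zero summable_LIMSEQ_zero summable_exp_generic)
  then have "(\<lambda>n. ode_sol N a v (t + h) - (\<Sum>m<n. ?z m t / fact m * h ^ m)) \<longlonglongrightarrow> 0"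
    by (rule Lim_null_comparison[rotated]) (use rem in auto)
  then have "(\<lambda>n. \<Sum>m<n. ?z m t / fact m * h ^ m) \<longlonglongrightarrow> ode_sol N a v (t + h)"
    using tendsto_diff[OF tendsto_const[of "ode_sol N a v (t + h)"]] by force
  then show ?thesis by (simp add: sums_def)
qed

lemma real_analytic_ode_sol:
  assumes "N \<ge> 1" shows "real_analytic (ode_sol N a v)"
  unfolding real_analytic_def
proof
  fix t\<^sub>0
  have "(\<lambda>n. ode_sol N a ((companion N a ^^ n) v) t\<^sub>0 / fact n * (t - t\<^sub>0) ^ n) sums ode_sol N a v t" for t
    using ode_sol_taylor[OF assms, of a v t\<^sub>0 "t - t\<^sub>0"] by simp
  then show "\<exists>c. \<exists>r>0. \<forall>t. \<bar>t - t\<^sub>0\<bar> < r \<longrightarrow> (\<lambda>n. c n * (t - t\<^sub>0) ^ n) sums ode_sol N a v t"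
    by (intro exI[of _ "\<lambda>n. ode_sol N a ((companion N a ^^ n) v) t\<^sub>0 / fact n"] exI[of _ "1::real"]) auto
qed

lemma companion_derivatives:
  assumes "N \<ge> 1" "a N \<noteq> 0"
  shows "i < N \<Longrightarrow> (companion N a ^^ n) (\<lambda>j. ode_sol N a ((companion N a ^^ j) v) t) i
    = ode_sol N a ((companion N a ^^ (n + i)) v) t"
proof (induction n arbitrary: i)
  case (Suc n)
  let ?z = "\<lambda>n. ode_sol N a ((companion N a ^^ n) v) t"
  show ?case
  proof (cases "Suc i < N")
    case True
    then show ?thesis using Suc.IH[OF True] by (simp add: companion_def)
  next
    case False
    then have i: "Suc i = N" using Suc.prems by simp
    have "(\<Sum>m=0..N. a m * ode_sol N a ((companion N a ^^ m) ((companion N a ^^ n) v)) t) = 0"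
      by (rule ode_sol_equation[where a = a, OF assms])
    then have "(\<Sum>m=0..N. a m * ?z (n + m)) = 0"
      by (simp add: add.commute[of n] funpow_add)
    moreover have "{0..N} = insert N {..<N}" by auto
    ultimately have "a N * ?z (n + N) = - (\<Sum>m<N. a m * ?z (n + m))" by simp
    then have "?z (n + N) = - (\<Sum>m<N. a m * ?z (n + m)) / a N" using assms(2) by (simp add: field_simps)
    moreover have "(\<Sum>m<N. a m * (companion N a ^^ n) (\<lambda>j. ?z j) m) = (\<Sum>m<N. a m * ?z (n + m))"
      by (intro sum.cong refl) (simp add: Suc.IH)
    moreover have "n + N = Suc n + i" using i by simp
    moreover have "(companion N a ^^ Suc n) (\<lambda>j. ?z j) i
        = - (\<Sum>m<N. a m * (companion N a ^^ n) (\<lambda>j. ?z j) m) / a N"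
      using False by (simp add: companion_def[of N a _ i])
    ultimately show ?thesis by (simp only:)
  qed
qed simp

text \<open>Both sides have the same Taylor coefficients in \<open>h\<close>, since the companion matrix shifts the sequence of
  derivatives at \<open>t\<close>.\<close>

lemma ode_sol_translate:
  assumes "N \<ge> 1" "a N \<noteq> 0"
  shows "ode_sol N a v (t + h) = ode_sol N a (\<lambda>j. ode_sol N a ((companion N a ^^ j) v) t) h"
  using sums_unique[OF ode_sol_taylor[OF assms(1), of a v t h]] companion_derivatives[where a = a, OF assms, of 0 _ v t] assms(1)
  by (simp add: ode_sol_def[of N a "\<lambda>j. ode_sol N a ((companion N a ^^ j) v) t"])

definition unit_vec :: "nat \<Rightarrow> nat \<Rightarrow> real" where
  "unit_vec j i = (if i = j then 1 else 0)"

lemma companion_funpow_lincomb: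
  "(companion N a ^^ n) (\<lambda>i. \<Sum>j<N. x j * u j i) = (\<lambda>i. \<Sum>j<N. x j * (companion N a ^^ n) (u j) i)"
proof (induction n)
  case (Suc n)
  have "companion N a (\<lambda>i. \<Sum>j<N. x j * w j i) = (\<lambda>i. \<Sum>j<N. x j * companion N a (w j) i)" for w
  proof
    fix i
    define S where "S j = (\<Sum>k<N. a k * w j k)" for j
    have "(\<Sum>k<N. a k * (\<Sum>j<N. x j * w j k)) = (\<Sum>j<N. x j * S j)"
      unfolding S_def sum_distrib_left by (subst sum.swap) (simp add: mult.left_commute)
    then show "companion N a (\<lambda>i. \<Sum>j<N. x j * w j i) i = (\<Sum>j<N. x j * companion N a (w j) i)"
      by (simp add: companion_def S_def[symmetric] sum_divide_distrib sum_negf)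
  qed
  then show ?case by (simp add: Suc)
qed simp

lemma ode_sol_basis:
  assumes "N \<ge> 1" shows "ode_sol N a v t = (\<Sum>j<N. v j * ode_sol N a (unit_vec j) t)"
proof -
  let ?u = "\<lambda>i. \<Sum>j<N. v j * unit_vec j i"
  let ?c = "\<lambda>j n. v j * (((companion N a ^^ n) (unit_vec j) 0 / fact n) * t ^ n)"
  have "?u i = v i" if "i < N" for i
    using that by (simp add: unit_vec_def if_distrib[of "(*) _"] cong: if_cong)
  then have "ode_sol N a v t = ode_sol N a ?u t"
    using ode_sol_cong[OF assms, of v ?u a] by simp
  also have "\<dots> = (\<Sum>n. \<Sum>j<N. ?c j n)"
    unfolding ode_sol_def companion_funpow_lincomb
    by (intro suminf_cong) (simp add: sum_divide_distrib sum_distrib_right mult.assoc)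
  also have "\<dots> = (\<Sum>j<N. \<Sum>n. ?c j n)"
    by (intro suminf_sum summable_mult ode_sol_summable assms)
  also have "\<dots> = (\<Sum>j<N. v j * ode_sol N a (unit_vec j) t)"
    unfolding ode_sol_def by (intro sum.cong refl suminf_mult ode_sol_summable assms)
  finally show ?thesis .
qed

section \<open>Convolution with a kernel on the half-line\<close>

text \<open>The transpose of convolution with a causal kernel: pairing \<open>T\<close> with \<open>half_conv \<kappa> \<phi>\<close> is what pairing
  the convolution of \<open>T\<close> and \<open>u \<kappa>\<close> with \<open>\<phi>\<close> should mean.\<close>

definition half_conv :: "(real \<Rightarrow> real) \<Rightarrow> (real \<Rightarrow> real) \<Rightarrow> real \<Rightarrow> real" where
  "half_conv \<kappa> \<phi> t = (LBINT \<tau>:{0..}. \<kappa> \<tau> * \<phi> (t + \<tau>))"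

definition decaying_kernel :: "real \<Rightarrow> real \<Rightarrow> (real \<Rightarrow> real) \<Rightarrow> bool" where
  "decaying_kernel \<delta> B \<kappa> \<longleftrightarrow> \<delta> > 0 \<and> B \<ge> 0 \<and> continuous_on UNIV \<kappa> \<and>
     (\<forall>\<tau>\<ge>0. \<bar>\<kappa> \<tau>\<bar> \<le> B * exp (- \<delta> * \<tau>))"

lemma decaying_kernel_bounded:
  assumes \<kappa>: "decaying_kernel \<delta> B \<kappa>" and f: "continuous_on UNIV f" and A: "\<And>\<tau>. \<tau> \<ge> 0 \<Longrightarrow> \<bar>f \<tau>\<bar> \<le> A"
  shows "set_integrable lborel {0..} (\<lambda>\<tau>. \<kappa> \<tau> * f \<tau>)"
    and "\<bar>LBINT \<tau>:{0..}. \<kappa> \<tau> * f \<tau>\<bar> \<le> (B * A) * exp_integral \<delta>"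
proof -
  have c: "continuous_on UNIV (\<lambda>\<tau>. \<kappa> \<tau> * f \<tau>)"
    using \<kappa> f by (intro continuous_intros) (auto simp: decaying_kernel_def)
  have \<delta>: "\<delta> > 0" using \<kappa> by (simp add: decaying_kernel_def)
  have le: "\<bar>\<kappa> \<tau> * f \<tau>\<bar> \<le> (B * A) * exp (- \<delta> * \<tau>)" if "\<tau> \<ge> 0" for \<tau>
  proof -
    have "\<bar>\<kappa> \<tau> * f \<tau>\<bar> \<le> (B * exp (- \<delta> * \<tau>)) * A"
      unfolding abs_mult using \<kappa> A that by (intro mult_mono) (auto simp: decaying_kernel_def)
    then show ?thesis by (simp add: ac_simps)
  qed
  from half_line_integral_bound[OF \<delta> c le]
  show "set_integrable lborel {0..} (\<lambda>\<tau>. \<kappa> \<tau> * f \<tau>)"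
    "\<bar>LBINT \<tau>:{0..}. \<kappa> \<tau> * f \<tau>\<bar> \<le> (B * A) * exp_integral \<delta>" by simp_all
qed

lemma continuous_translate: "continuous_on UNIV f \<Longrightarrow> continuous_on UNIV (\<lambda>\<tau>::real. f (t + \<tau>))"
  by (erule continuous_on_compose2) (auto intro!: continuous_intros)

lemma half_conv_integrable:
  assumes "decaying_kernel \<delta> B \<kappa>" "\<phi> \<in> schwartz"
  shows "set_integrable lborel {0..} (\<lambda>\<tau>. \<kappa> \<tau> * \<phi> (t + \<tau>))"
  using schwartz_boundD[OF schwartz_bound_norm[OF assms(2)], of 0 0 0]
  by (intro decaying_kernel_bounded(1)[OF assms(1), of _ "schwartz_norm 0 \<phi>"]
      continuous_translate smooth_continuous schwartz_smooth assms) auto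

text \<open>The second-order Taylor remainder of a Schwartz function is uniformly quadratic in the increment, so
  the difference quotients converge under the integral with an explicit rate.\<close>

lemma half_conv_deriv:
  assumes \<kappa>: "decaying_kernel \<delta> B \<kappa>" and \<phi>: "\<phi> \<in> schwartz"
  shows "(half_conv \<kappa> \<phi> has_real_derivative half_conv \<kappa> (deriv \<phi>) t) (at t)"
proof -
  define M where "M = schwartz_norm 2 \<phi>"
  have M: "\<bar>(deriv ^^ 2) \<phi> s\<bar> \<le> M" for s
    using schwartz_boundD[OF schwartz_bound_norm[OF \<phi>], of 0 2 2 s] by (simp add: M_def)
  have taylor: "\<bar>\<phi> (s + h) - \<phi> s - h * deriv \<phi> s\<bar> \<le> M * h\<^sup>2" for s h
  proof -
    have "\<exists>\<xi>. \<bar>\<xi>\<bar> \<le> \<bar>h\<bar> \<and> \<phi> (s + h) = (\<Sum>m<2. (deriv ^^ m) \<phi> (s + 0) / fact m * h ^ m)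
        + (deriv ^^ 2) \<phi> (s + \<xi>) / fact 2 * h ^ 2"
    proof (rule Maclaurin_bi_le[of "\<lambda>m \<xi>. (deriv ^^ m) \<phi> (s + \<xi>)" "\<lambda>\<xi>. \<phi> (s + \<xi>)" 2 h])
      have "((\<lambda>\<xi>. (deriv ^^ m) \<phi> (s + \<xi>)) has_real_derivative (deriv ^^ Suc m) \<phi> (s + x)) (at x)" for m x
        using smooth_deriv_eq[OF schwartz_smooth[OF \<phi>], of m "x + s"]
          DERIV_shift[of "(deriv ^^ m) \<phi>" _ x s] by (simp add: add.commute)
      then show "\<forall>m x. m < 2 \<and> \<bar>x\<bar> \<le> \<bar>h\<bar> \<longrightarrow>
          ((\<lambda>\<xi>. (deriv ^^ m) \<phi> (s + \<xi>)) has_real_derivative (deriv ^^ Suc m) \<phi> (s + x)) (at x)" by blast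
    qed simp
    then obtain \<xi> where "\<phi> (s + h) = (\<Sum>m<2. (deriv ^^ m) \<phi> (s + 0) / fact m * h ^ m)
        + (deriv ^^ 2) \<phi> (s + \<xi>) / fact 2 * h ^ 2" by blast
    then have "\<phi> (s + h) - \<phi> s - h * deriv \<phi> s = (deriv ^^ 2) \<phi> (s + \<xi>) / 2 * h\<^sup>2"
      by (simp add: numeral_2_eq_2 algebra_simps)
    then have "\<bar>\<phi> (s + h) - \<phi> s - h * deriv \<phi> s\<bar> = \<bar>(deriv ^^ 2) \<phi> (s + \<xi>)\<bar> / 2 * h\<^sup>2"
      by (simp only: abs_mult abs_divide) simp
    also have "\<dots> \<le> M * h\<^sup>2"
      using M[of "s + \<xi>"] by (intro mult_right_mono) auto
    finally show ?thesis .
  qed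
  let ?K = "half_conv \<kappa>"
  have est: "\<bar>?K \<phi> (t + h) - ?K \<phi> t - h * ?K (deriv \<phi>) t\<bar> \<le> (B * (M * h\<^sup>2)) * exp_integral \<delta>" for h
  proof -
    note int = half_conv_integrable[OF \<kappa> \<phi>] half_conv_integrable[OF \<kappa> schwartz_deriv[OF \<phi>]]
    have "?K \<phi> (t + h) - ?K \<phi> t - h * ?K (deriv \<phi>) t
      = (LBINT \<tau>:{0..}. \<kappa> \<tau> * \<phi> (t + h + \<tau>) - \<kappa> \<tau> * \<phi> (t + \<tau>) - h * (\<kappa> \<tau> * deriv \<phi> (t + \<tau>)))"
      unfolding half_conv_def set_integral_mult_right[symmetric]
      by (simp add: set_integral_diff int)
    also have "\<dots> = (LBINT \<tau>:{0..}. \<kappa> \<tau> * (\<phi> ((t + \<tau>) + h) - \<phi> (t + \<tau>) - h * deriv \<phi> (t + \<tau>)))"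
      by (simp add: algebra_simps)
    also have "\<bar>\<dots>\<bar> \<le> (B * (M * h\<^sup>2)) * exp_integral \<delta>"
    proof (rule decaying_kernel_bounded(2)[OF \<kappa>])
      have c: "continuous_on UNIV (\<lambda>s. \<phi> (s + h) - \<phi> s - h * deriv \<phi> s)"
      proof -
        have "continuous_on UNIV \<phi>" "continuous_on UNIV (deriv \<phi>)"
          using \<phi> by (auto intro!: smooth_continuous schwartz_smooth schwartz_deriv)
        moreover from this(1) have "continuous_on UNIV (\<lambda>s. \<phi> (s + h))"
          using continuous_translate[of \<phi> h] by (simp add: add.commute)
        ultimately show ?thesis by (intro continuous_intros)
      qed
      show "continuous_on UNIV (\<lambda>\<tau>. \<phi> ((t + \<tau>) + h) - \<phi> (t + \<tau>) - h * deriv \<phi> (t + \<tau>))"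
        by (rule continuous_translate[OF c])
    qed (rule taylor)
    finally show ?thesis .
  qed
  have "((\<lambda>h. (?K \<phi> (t + h) - ?K \<phi> t) / h - ?K (deriv \<phi>) t) \<longlongrightarrow> 0) (at 0)"
  proof (rule Lim_null_comparison)
    have "\<bar>(?K \<phi> (t + h) - ?K \<phi> t) / h - ?K (deriv \<phi>) t\<bar> \<le> (B * M * exp_integral \<delta>) * \<bar>h\<bar>" if "h \<noteq> 0" for h
    proof -
      have "\<bar>(?K \<phi> (t + h) - ?K \<phi> t) / h - ?K (deriv \<phi>) t\<bar> = \<bar>?K \<phi> (t + h) - ?K \<phi> t - h * ?K (deriv \<phi>) t\<bar> / \<bar>h\<bar>"
        using that by (simp add: abs_divide[symmetric] diff_divide_distrib)
      also have "\<dots> \<le> (B * (M * h\<^sup>2)) * exp_integral \<delta> / \<bar>h\<bar>" by (rule divide_right_mono[OF est]) simp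
      also have "\<dots> = (B * M * exp_integral \<delta>) * \<bar>h\<bar>"
        using that by (simp add: power2_eq_square abs_if)
      finally show ?thesis .
    qed
    then show "\<forall>\<^sub>F h in at 0. norm ((?K \<phi> (t + h) - ?K \<phi> t) / h - ?K (deriv \<phi>) t) \<le> (B * M * exp_integral \<delta>) * \<bar>h\<bar>"
      by (simp add: eventually_at_filter)
    have "((\<lambda>h::real. (B * M * exp_integral \<delta>) * \<bar>h\<bar>) \<longlongrightarrow> (B * M * exp_integral \<delta>) * \<bar>0\<bar>) (at 0)"
      by (intro tendsto_intros)
    then show "((\<lambda>h::real. (B * M * exp_integral \<delta>) * \<bar>h\<bar>) \<longlongrightarrow> 0) (at 0)" by simp
  qed
  then show ?thesis unfolding DERIV_def by (simp add: LIM_zero_iff)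
qed

lemma funpow_deriv_half_conv:
  assumes "decaying_kernel \<delta> B \<kappa>" "\<phi> \<in> schwartz"
  shows "(deriv ^^ k) (half_conv \<kappa> \<phi>) = half_conv \<kappa> ((deriv ^^ k) \<phi>) \<and> (deriv ^^ k) \<phi> \<in> schwartz"
proof (induction k)
  case (Suc k)
  then show ?case
    using half_conv_deriv[OF assms(1)] by (auto intro!: ext DERIV_imp_deriv schwartz_deriv)
qed (simp add: assms)

lemma smooth_half_conv:
  assumes "decaying_kernel \<delta> B \<kappa>" "\<phi> \<in> schwartz" shows "smooth (half_conv \<kappa> \<phi>)"
  unfolding smooth_def real_differentiable_def
  using funpow_deriv_half_conv[OF assms] half_conv_deriv[OF assms(1)] by metis

text \<open>Moving a power of \<open>t\<close> under the integral costs a power of the shift, which the kernel absorbs.\<close>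

lemma schwartz_bound_half_conv:
  assumes \<kappa>: "decaying_kernel \<delta> B \<kappa>"
  obtains C where "C \<ge> 0" "\<And>\<phi> A. \<phi> \<in> schwartz \<Longrightarrow> schwartz_bound n \<phi> A \<Longrightarrow>
    schwartz_bound n (half_conv \<kappa> \<phi>) (C * A)"
proof -
  have \<delta>: "\<delta> / 2 > 0" "B \<ge> 0" using \<kappa> by (auto simp: decaying_kernel_def)
  obtain D where D: "D \<ge> 0" "\<And>j t. j \<le> n \<Longrightarrow> t \<ge> -1 \<Longrightarrow> \<bar>t\<bar> ^ j * exp (- (\<delta> / 2) * t) \<le> D"
    using power_exp_decay_bounded[OF \<delta>(1), of n] by blast
  let ?C = "B * (2 ^ n * (1 + D)) * exp_integral (\<delta> / 2)"
  show thesis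
  proof (rule that[of ?C])
    show "?C \<ge> 0" using \<delta> D exp_integral_nonneg by simp
    fix \<phi> A assume \<phi>: "\<phi> \<in> schwartz" and A: "schwartz_bound n \<phi> A"
    have A0: "A \<ge> 0" using schwartz_bound_nonneg[OF A] .
    show "schwartz_bound n (half_conv \<kappa> \<phi>) (?C * A)"
    proof (rule schwartz_boundI)
      fix j k and t :: real assume jk: "j \<le> n" "k \<le> n"
      let ?\<psi> = "(deriv ^^ k) \<phi>"
      have \<psi>: "?\<psi> \<in> schwartz" using funpow_deriv_half_conv[OF \<kappa> \<phi>] by blast
      have "\<bar>t\<bar> ^ j * \<bar>(deriv ^^ k) (half_conv \<kappa> \<phi>) t\<bar> = \<bar>\<bar>t\<bar> ^ j * half_conv \<kappa> ?\<psi> t\<bar>"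
        using funpow_deriv_half_conv[OF \<kappa> \<phi>, of k] by (simp add: abs_mult)
      also have "\<bar>t\<bar> ^ j * half_conv \<kappa> ?\<psi> t = (LBINT \<tau>:{0..}. \<bar>t\<bar> ^ j * (\<kappa> \<tau> * ?\<psi> (t + \<tau>)))"
        unfolding half_conv_def by simp
      also have "\<bar>\<dots>\<bar> \<le> (B * (2 ^ n * (1 + D)) * A) * exp_integral (\<delta> / 2)"
      proof (rule half_line_integral_bound(2)[OF \<delta>(1)])
        show "continuous_on UNIV (\<lambda>\<tau>. \<bar>t\<bar> ^ j * (\<kappa> \<tau> * ?\<psi> (t + \<tau>)))"
          using \<kappa> continuous_translate[OF smooth_continuous[OF schwartz_smooth[OF \<psi>]]]
          by (intro continuous_intros) (auto simp: decaying_kernel_def)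
        fix \<tau> :: real assume \<tau>: "\<tau> \<ge> 0"
        define m where "m = max \<bar>t + \<tau>\<bar> \<tau>"
        have "\<bar>t\<bar> \<le> \<bar>t + \<tau>\<bar> + \<tau>" using \<tau> by linarith
        also have "\<dots> \<le> m + m" by (intro add_mono) (simp_all add: m_def)
        finally have "\<bar>t\<bar> ^ j \<le> (2 * m) ^ j" by (intro power_mono) auto
        also have "\<dots> = 2 ^ j * m ^ j" by (rule power_mult_distrib)
        also have "\<dots> \<le> 2 ^ n * (\<bar>t + \<tau>\<bar> ^ j + \<tau> ^ j)"
          using jk \<tau> by (intro mult_mono power_increasing) (auto simp: m_def max_def)
        finally have tj: "\<bar>t\<bar> ^ j \<le> 2 ^ n * (\<bar>t + \<tau>\<bar> ^ j + \<tau> ^ j)" .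
        have "\<bar>t\<bar> ^ j * \<bar>?\<psi> (t + \<tau>)\<bar> \<le> 2 ^ n * (\<bar>t + \<tau>\<bar> ^ j + \<tau> ^ j) * \<bar>?\<psi> (t + \<tau>)\<bar>"
          by (intro mult_right_mono tj) simp
        also have "\<dots> = 2 ^ n * (\<bar>t + \<tau>\<bar> ^ j * \<bar>?\<psi> (t + \<tau>)\<bar> + \<tau> ^ j * (\<bar>t + \<tau>\<bar> ^ 0 * \<bar>?\<psi> (t + \<tau>)\<bar>))"
          by (simp add: algebra_simps)
        also have "\<dots> \<le> 2 ^ n * (A + \<tau> ^ j * A)"
          using \<tau> jk by (intro mult_left_mono add_mono schwartz_boundD[OF A]) auto
        finally have *: "\<bar>t\<bar> ^ j * \<bar>?\<psi> (t + \<tau>)\<bar> \<le> 2 ^ n * (1 + \<tau> ^ j) * A" by (simp add: algebra_simps)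
        have "(1 + \<tau> ^ j) * exp (- (\<delta> / 2) * \<tau>) \<le> 1 + D"
          using D(2)[of j \<tau>] jk \<tau> \<delta> by (simp add: distrib_right add_mono)
        then have "(1 + \<tau> ^ j) * exp (- (\<delta> / 2) * \<tau>) * exp (- (\<delta> / 2) * \<tau>) \<le> (1 + D) * exp (- (\<delta> / 2) * \<tau>)"
          by (rule mult_right_mono) simp
        moreover have "exp (- (\<delta> / 2) * \<tau>) * exp (- (\<delta> / 2) * \<tau>) = exp (- \<delta> * \<tau>)"
          unfolding exp_add[symmetric] by simp
        ultimately have **: "(1 + \<tau> ^ j) * exp (- \<delta> * \<tau>) \<le> (1 + D) * exp (- (\<delta> / 2) * \<tau>)"
          by (simp only: mult.assoc)
        have "\<bar>\<bar>t\<bar> ^ j * (\<kappa> \<tau> * ?\<psi> (t + \<tau>))\<bar> = \<bar>\<kappa> \<tau>\<bar> * (\<bar>t\<bar> ^ j * \<bar>?\<psi> (t + \<tau>)\<bar>)"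
          by (simp add: abs_mult ac_simps)
        also have "\<dots> \<le> (B * exp (- \<delta> * \<tau>)) * (2 ^ n * (1 + \<tau> ^ j) * A)"
          using \<kappa> \<tau> by (intro mult_mono[OF _ *]) (auto simp: decaying_kernel_def)
        also have "\<dots> = B * 2 ^ n * A * ((1 + \<tau> ^ j) * exp (- \<delta> * \<tau>))" by simp
        also have "\<dots> \<le> B * 2 ^ n * A * ((1 + D) * exp (- (\<delta> / 2) * \<tau>))"
          using \<delta>(2) A0 by (intro mult_left_mono **) auto
        finally show "\<bar>\<bar>t\<bar> ^ j * (\<kappa> \<tau> * ?\<psi> (t + \<tau>))\<bar> \<le> (B * (2 ^ n * (1 + D)) * A) * exp (- (\<delta> / 2) * \<tau>)"
          by (simp add: ac_simps)
      qed
      finally show "\<bar>t\<bar> ^ j * \<bar>(deriv ^^ k) (half_conv \<kappa> \<phi>) t\<bar> \<le> ?C * A" by (simp add: ac_simps)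
    qed
  qed
qed

lemma schwartz_half_conv:
  assumes "decaying_kernel \<delta> B \<kappa>" "\<phi> \<in> schwartz" shows "half_conv \<kappa> \<phi> \<in> schwartz"
proof (rule schwartzI[OF smooth_half_conv[OF assms]])
  fix n
  obtain C where "\<And>\<phi> A. \<phi> \<in> schwartz \<Longrightarrow> schwartz_bound n \<phi> A \<Longrightarrow> schwartz_bound n (half_conv \<kappa> \<phi>) (C * A)"
    using schwartz_bound_half_conv[OF assms(1)] by blast
  then show "\<exists>A. schwartz_bound n (half_conv \<kappa> \<phi>) A"
    using schwartz_bound_norm[OF assms(2)] assms(2) by blast
qed

lemma tempered_functional_half_conv:
  assumes G: "tempered_functional G" and \<kappa>: "decaying_kernel \<delta> B \<kappa>"
  shows "tempered_functional (\<lambda>\<phi>. G (half_conv \<kappa> \<phi>))"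
  unfolding tempered_functional_iff linear_functional_on_def
proof (intro conjI ballI allI)
  fix \<phi> \<psi> assume \<phi>: "\<phi> \<in> schwartz" and \<psi>: "\<psi> \<in> schwartz"
  have "half_conv \<kappa> (\<lambda>t. \<phi> t + \<psi> t) = (\<lambda>t. half_conv \<kappa> \<phi> t + half_conv \<kappa> \<psi> t)"
    unfolding half_conv_def distrib_left
    by (intro ext set_integral_add(2) half_conv_integrable[OF \<kappa>] \<phi> \<psi>)
  then show "G (half_conv \<kappa> (\<lambda>t. \<phi> t + \<psi> t)) = G (half_conv \<kappa> \<phi>) + G (half_conv \<kappa> \<psi>)"
    using tempered_add[OF G schwartz_half_conv[OF \<kappa> \<phi>] schwartz_half_conv[OF \<kappa> \<psi>]] by simp
next
  fix c \<phi> assume \<phi>: "\<phi> \<in> schwartz"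
  have "half_conv \<kappa> (\<lambda>t. c * \<phi> t) = (\<lambda>t. c * half_conv \<kappa> \<phi> t)"
    unfolding half_conv_def mult.left_commute[of _ c] by simp
  then show "G (half_conv \<kappa> (\<lambda>t. c * \<phi> t)) = c * G (half_conv \<kappa> \<phi>)"
    using tempered_cmult[OF G schwartz_half_conv[OF \<kappa> \<phi>]] by simp
next
  obtain C n where C: "C \<ge> 0" "\<And>\<phi> A. \<phi> \<in> schwartz \<Longrightarrow> schwartz_bound n \<phi> A \<Longrightarrow> \<bar>G \<phi>\<bar> \<le> C * A"
    using tempered_functionalE[OF G] by blast
  obtain D where D: "D \<ge> 0" "\<And>\<phi> A. \<phi> \<in> schwartz \<Longrightarrow> schwartz_bound n \<phi> A \<Longrightarrow>
      schwartz_bound n (half_conv \<kappa> \<phi>) (D * A)"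
    using schwartz_bound_half_conv[OF \<kappa>] by blast
  have "\<bar>G (half_conv \<kappa> \<phi>)\<bar> \<le> (C * D) * A" if "\<phi> \<in> schwartz" "schwartz_bound n \<phi> A" for \<phi> A
    using C(2)[OF schwartz_half_conv[OF \<kappa> that(1)] D(2)[OF that]] by (simp add: mult.assoc)
  then show "\<exists>C\<ge>0. \<exists>n. \<forall>\<phi>\<in>schwartz. \<forall>A. schwartz_bound n \<phi> A \<longrightarrow> \<bar>G (half_conv \<kappa> \<phi>)\<bar> \<le> C * A"
    using C(1) D(1) by (intro exI[of _ "C * D"] conjI exI[of _ n]) auto
qed
section \<open>Differential operators and their adjoints\<close>

definition diff_op :: "nat \<Rightarrow> (nat \<Rightarrow> real) \<Rightarrow> distr \<Rightarrow> distr" where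
  "diff_op N a T = (\<Sum>n=0..N. a n *\<^sub>R (distr_deriv ^^ n) T)"

definition adjoint_op :: "nat \<Rightarrow> (nat \<Rightarrow> real) \<Rightarrow> (real \<Rightarrow> real) \<Rightarrow> real \<Rightarrow> real" where
  "adjoint_op N a \<phi> t = (\<Sum>n=0..N. a n * (-1) ^ n * (deriv ^^ n) \<phi> t)"

lemma pairing_funpow_distr_deriv:
  "\<phi> \<in> test_functions \<Longrightarrow> pairing ((distr_deriv ^^ n) T) \<phi> = (-1) ^ n * pairing T ((deriv ^^ n) \<phi>)"
proof (induction n arbitrary: \<phi>)
  case (Suc n)
  then show ?case
    using Suc.IH[OF test_functions_deriv[OF Suc.prems]] by (simp add: pairing_distr_deriv funpow_swap1[of deriv])
qed simp

lemma test_functions_adjoint_op: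
  "\<phi> \<in> test_functions \<Longrightarrow> adjoint_op N a \<phi> \<in> test_functions"
  unfolding adjoint_op_def[abs_def]
  by (intro test_functions_sum test_functions_cmult test_functions_funpow_deriv)

lemma pairing_diff_op:
  assumes \<phi>: "\<phi> \<in> test_functions" shows "pairing (diff_op N a T) \<phi> = pairing T (adjoint_op N a \<phi>)"
proof -
  have "pairing T (adjoint_op N a \<phi>) = (\<Sum>n=0..N. pairing T (\<lambda>t. a n * (-1) ^ n * (deriv ^^ n) \<phi> t))"
    unfolding adjoint_op_def[abs_def]
    by (intro pairing_sum test_functions_cmult test_functions_funpow_deriv \<phi>)
  also have "\<dots> = (\<Sum>n=0..N. a n * (-1) ^ n * pairing T ((deriv ^^ n) \<phi>))"
    by (intro sum.cong refl pairing_cmult test_functions_funpow_deriv \<phi>)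
  also have "\<dots> = pairing (diff_op N a T) \<phi>"
    by (simp add: diff_op_def pairing_distr_sum pairing_scaleR pairing_funpow_distr_deriv[OF \<phi>] mult.assoc)
  finally show ?thesis by simp
qed

lemma diff_op_plus: "diff_op N a (S + T) = diff_op N a S + diff_op N a T"
  by (rule distr_eqI) (simp add: pairing_diff_op pairing_plus)

lemma pairing_uminus: "pairing (- T) \<phi> = - pairing T \<phi>"
  unfolding uminus_distr_def pairing_scaleR by simp

lemma diff_op_uminus: "diff_op N a (- T) = - diff_op N a T"
  by (rule distr_eqI) (simp add: pairing_diff_op pairing_uminus)

lemma diff_op_minus: "diff_op N a (S - T) = diff_op N a S - diff_op N a T"
  using diff_op_plus[of N a S "- T"] by (simp add: diff_op_uminus)

lemma smooth_funpow_deriv_lincomb: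
  assumes "finite I" "\<And>i. i \<in> I \<Longrightarrow> smooth (f i)"
  shows "(deriv ^^ k) (\<lambda>t. \<Sum>i\<in>I. c i * f i t) = (\<lambda>t. \<Sum>i\<in>I. c i * (deriv ^^ k) (f i) t)"
  using assms
proof (induction I rule: finite_induct)
  case (insert i I)
  then have "smooth (f i)" by simp
  moreover have "smooth (\<lambda>t. \<Sum>i\<in>I. c i * f i t)"
    by (rule smooth_sum, rule smooth_cmult) (use insert in simp)
  ultimately show ?case
    using insert smooth_funpow_deriv_add[of "\<lambda>t. c i * f i t" "\<lambda>t. \<Sum>i\<in>I. c i * f i t" k]
      smooth_funpow_deriv_cmult[of "f i" k "c i"] by (simp add: smooth_cmult)
qed (simp add: funpow_deriv_const)

lemma adjoint_op_lincomb:
  assumes "smooth \<phi>" "finite I" "\<And>i. i \<in> I \<Longrightarrow> smooth (f i)"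
  shows "adjoint_op N a (\<lambda>t. \<phi> t + (\<Sum>i\<in>I. c i * f i t)) t
    = adjoint_op N a \<phi> t + (\<Sum>i\<in>I. c i * adjoint_op N a (f i) t)"
proof -
  have "smooth (\<lambda>t. \<Sum>i\<in>I. c i * f i t)"
    by (rule smooth_sum, rule smooth_cmult, rule assms(3))
  then have "adjoint_op N a (\<lambda>t. \<phi> t + (\<Sum>i\<in>I. c i * f i t)) t
    = adjoint_op N a \<phi> t + (\<Sum>n=0..N. \<Sum>i\<in>I. c i * (a n * (-1) ^ n * (deriv ^^ n) (f i) t))"
    unfolding adjoint_op_def
    by (simp add: smooth_funpow_deriv_add[OF assms(1)] smooth_funpow_deriv_lincomb[OF assms(2,3)]
        sum_distrib_left distrib_left sum.distrib mult.left_commute)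
  also have "(\<Sum>n=0..N. \<Sum>i\<in>I. c i * (a n * (-1) ^ n * (deriv ^^ n) (f i) t)) = (\<Sum>i\<in>I. c i * adjoint_op N a (f i) t)"
    unfolding adjoint_op_def sum_distrib_left by (rule sum.swap)
  finally show ?thesis .
qed

lemma smooth_adjoint_op: "smooth \<phi> \<Longrightarrow> smooth (adjoint_op N a \<phi>)"
  unfolding adjoint_op_def[abs_def] by (rule smooth_sum, rule smooth_cmult, rule smooth_funpow_deriv)

lemma funpow_distr_deriv_ode_sol:
  assumes "N \<ge> 1"
  shows "(distr_deriv ^^ n) (distr_of_fun (ode_sol N a v)) = distr_of_fun (ode_sol N a ((companion N a ^^ n) v))"
proof (induction n)
  case (Suc n)
  then show ?case
    by (simp add: distr_deriv_of_fun[OF ode_sol_deriv[OF assms] ode_sol_continuous[OF assms]])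
qed simp

lemma diff_op_ode_sol:
  assumes "N \<ge> 1" "a N \<noteq> 0" shows "diff_op N a (distr_of_fun (ode_sol N a v)) = 0"
proof -
  have "diff_op N a (distr_of_fun (ode_sol N a v))
      = (\<Sum>n\<in>{0..N}. a n *\<^sub>R distr_of_fun (ode_sol N a ((companion N a ^^ n) v)))"
    by (simp add: diff_op_def funpow_distr_deriv_ode_sol[OF assms(1)])
  also have "\<dots> = distr_of_fun (\<lambda>t. \<Sum>n\<in>{0..N}. a n * ode_sol N a ((companion N a ^^ n) v) t)"
    by (intro distr_of_fun_lincomb locally_integrable_continuous continuous_intros
        ode_sol_continuous assms(1)) simp
  also have "\<dots> = 0"
    by (simp only: ode_sol_equation[where a = a, OF assms] distr_of_fun_zero)
  finally show ?thesis .
qed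

lemma unit_step_ode_sol_equation:
  assumes N: "N \<ge> 1" "a N \<noteq> 0"
  shows "(\<Sum>n\<in>{0..N}. a n *\<^sub>R distr_of_fun (\<lambda>t. unit_step t * ode_sol N a ((companion N a ^^ n) v) t)) = 0"
proof -
  let ?z = "\<lambda>n. ode_sol N a ((companion N a ^^ n) v)"
  have eq: "(\<Sum>n\<in>{0..N}. a n * (unit_step t * ?z n t)) = 0" for t
  proof -
    have "(\<Sum>n\<in>{0..N}. a n * (unit_step t * ?z n t)) = unit_step t * (\<Sum>n=0..N. a n * ?z n t)"
      by (simp add: sum_distrib_left mult.left_commute)
    then show ?thesis by (simp only: ode_sol_equation[where a = a, OF N] mult_zero_right)
  qed
  have "(\<Sum>n\<in>{0..N}. a n *\<^sub>R distr_of_fun (\<lambda>t. unit_step t * ?z n t))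
      = distr_of_fun (\<lambda>t. \<Sum>n\<in>{0..N}. a n * (unit_step t * ?z n t))"
    by (rule distr_of_fun_lincomb, unfold eq)
       (auto intro: locally_integrable_unit_step ode_sol_continuous N(1) locally_integrable_continuous)
  then show ?thesis by (simp only: eq distr_of_fun_zero)
qed


section \<open>The causal fundamental solution\<close>

text \<open>The causal fundamental solution is \<open>u e\<close>, where \<open>e\<close> is the solution with these initial values.\<close>

definition impulse :: "nat \<Rightarrow> (nat \<Rightarrow> real) \<Rightarrow> nat \<Rightarrow> real" where
  "impulse N a i = (if i = N - 1 then 1 / a N else 0)"

abbreviation impulse_sol :: "nat \<Rightarrow> (nat \<Rightarrow> real) \<Rightarrow> nat \<Rightarrow> real \<Rightarrow> real" where
  "impulse_sol N a n \<equiv> ode_sol N a ((companion N a ^^ n) (impulse N a))"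

definition damped_kernel :: "nat \<Rightarrow> (nat \<Rightarrow> real) \<Rightarrow> real \<Rightarrow> real \<Rightarrow> real" where
  "damped_kernel N a \<sigma> \<tau> = exp (- \<sigma> * \<tau>) * impulse_sol N a 0 \<tau>"

lemma decaying_damped_kernel:
  assumes N: "N \<ge> 1" and \<sigma>: "\<sigma> > companion_rate N a"
  shows "decaying_kernel (\<sigma> - companion_rate N a) (initial_norm N (impulse N a)) (damped_kernel N a \<sigma>)"
  unfolding decaying_kernel_def
proof (intro conjI allI impI)
  show "continuous_on UNIV (damped_kernel N a \<sigma>)"
    unfolding damped_kernel_def[abs_def] by (intro continuous_intros ode_sol_continuous N)
  show "initial_norm N (impulse N a) \<ge> 0" by (simp add: initial_norm_def sum_nonneg)
  fix \<tau> :: real assume \<tau>: "\<tau> \<ge> 0"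
  have "\<bar>damped_kernel N a \<sigma> \<tau>\<bar> \<le> exp (- \<sigma> * \<tau>) * (initial_norm N (impulse N a) * exp (companion_rate N a * \<bar>\<tau>\<bar>))"
    unfolding damped_kernel_def abs_mult
    using ode_sol_bound[OF N, of a "impulse N a" \<tau>] by (simp add: mult_left_mono)
  also have "\<dots> = initial_norm N (impulse N a) * (exp (- \<sigma> * \<tau>) * exp (companion_rate N a * \<tau>))"
    using \<tau> by simp
  also have "exp (- \<sigma> * \<tau>) * exp (companion_rate N a * \<tau>) = exp (- (\<sigma> - companion_rate N a) * \<tau>)"
    unfolding exp_add[symmetric] by (simp add: algebra_simps)
  finally show "\<bar>damped_kernel N a \<sigma> \<tau>\<bar> \<le> initial_norm N (impulse N a) * exp (- (\<sigma> - companion_rate N a) * \<tau>)" .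
qed (use \<sigma> in simp)

lemma half_conv_exp:
  "half_conv (impulse_sol N a 0) (\<lambda>t. exp (- \<sigma> * t) * \<psi> t) t = exp (- \<sigma> * t) * half_conv (damped_kernel N a \<sigma>) \<psi> t"
proof -
  have "impulse_sol N a 0 \<tau> * (exp (- \<sigma> * (t + \<tau>)) * \<psi> (t + \<tau>))
      = exp (- \<sigma> * t) * (damped_kernel N a \<sigma> \<tau> * \<psi> (t + \<tau>))" for \<tau>
  proof -
    have "exp (- \<sigma> * (t + \<tau>)) = exp (- \<sigma> * t) * exp (- \<sigma> * \<tau>)"
      unfolding exp_add[symmetric] by (simp add: algebra_simps)
    then show ?thesis unfolding damped_kernel_def by (simp only: ac_simps)
  qed
  then show ?thesis unfolding half_conv_def by (simp only: set_integral_mult_right)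
qed

lemma exp_cancel: "(\<lambda>t. exp (- \<sigma> * t) * (exp (\<sigma> * t) * \<phi> t)) = (\<phi> :: real \<Rightarrow> real)"
  by (simp add: fun_eq_iff mult.assoc[symmetric] exp_add[symmetric])

lemma half_conv_impulse_eq:
  "half_conv (impulse_sol N a 0) \<phi>
    = (\<lambda>t. exp (- \<sigma> * t) * half_conv (damped_kernel N a \<sigma>) (\<lambda>t. exp (\<sigma> * t) * \<phi> t) t)"
  unfolding half_conv_exp[symmetric] exp_cancel ..

lemma half_conv_vanish:
  assumes "\<And>t. t > R \<Longrightarrow> \<phi> t = 0" "t > R" shows "half_conv \<kappa> \<phi> t = 0"
proof -
  have "half_conv \<kappa> \<phi> t = (LBINT \<tau>::real. 0)"
    unfolding half_conv_def set_lebesgue_integral_def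
    by (rule Bochner_Integration.integral_cong) (use assms in \<open>auto simp: indicator_def\<close>)
  then show ?thesis by simp
qed

lemma test_functions_translate:
  assumes "\<phi> \<in> test_functions" shows "(\<lambda>\<tau>. \<phi> (t + \<tau>)) \<in> test_functions"
proof -
  obtain R where R: "R > 0" "\<And>t. \<bar>t\<bar> > R \<Longrightarrow> \<phi> t = 0"
    using test_functions_vanishE[OF assms] by blast
  show ?thesis
  proof (rule test_functions_vanishI[of _ "- R - t" "R - t"])
    show "smooth (\<lambda>\<tau>. \<phi> (t + \<tau>))"
      using smooth_affine[OF test_smooth[OF assms], of 1 t] by (simp add: add.commute)
  qed (use R(2) in auto)
qed

lemma deriv_translate:
  assumes "\<phi> \<in> test_functions" shows "deriv (\<lambda>\<tau>. \<phi> (t + \<tau>)) = (\<lambda>\<tau>. deriv \<phi> (t + \<tau>))"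
  using funpow_deriv_affine[OF test_smooth[OF assms], of 1 1 t] by (simp add: add.commute)

lemma half_conv_eq_pairing:
  assumes "continuous_on UNIV \<kappa>" "\<phi> \<in> test_functions"
  shows "half_conv \<kappa> \<phi> t = pairing (distr_of_fun (\<lambda>\<tau>. unit_step \<tau> * \<kappa> \<tau>)) (\<lambda>\<tau>. \<phi> (t + \<tau>))"
  unfolding half_conv_def pairing_unit_step[OF assms(1) test_functions_translate[OF assms(2)]] ..

text \<open>Integration by parts, where the boundary term is the impulse contributed by the unit step.\<close>

lemma half_conv_test_deriv:
  assumes "N \<ge> 1" and \<phi>: "\<phi> \<in> test_functions"
  shows "half_conv (ode_sol N a v) (deriv \<phi>) t
    = - (half_conv (ode_sol N a (companion N a v)) \<phi> t + v 0 * \<phi> t)"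
proof -
  note cont = ode_sol_continuous[OF assms(1)]
  have "pairing (distr_deriv (distr_of_fun (\<lambda>\<tau>. unit_step \<tau> * ode_sol N a v \<tau>))) (\<lambda>\<tau>. \<phi> (t + \<tau>))
      = half_conv (ode_sol N a (companion N a v)) \<phi> t + v 0 * \<phi> t"
    unfolding distr_deriv_unit_step[OF ode_sol_deriv[OF assms(1)] cont]
    by (simp add: pairing_plus pairing_scaleR pairing_distr_delta test_functions_translate \<phi>
        half_conv_eq_pairing[OF cont \<phi>] ode_sol_0)
  moreover have "pairing (distr_deriv (distr_of_fun (\<lambda>\<tau>. unit_step \<tau> * ode_sol N a v \<tau>))) (\<lambda>\<tau>. \<phi> (t + \<tau>))
      = - half_conv (ode_sol N a v) (deriv \<phi>) t"
    by (simp add: pairing_distr_deriv test_functions_translate \<phi> deriv_translate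
        half_conv_eq_pairing[OF cont test_functions_deriv[OF \<phi>]])
  ultimately show ?thesis by simp
qed

lemma half_conv_impulse_funpow:
  assumes N: "N \<ge> 1" and "\<phi> \<in> test_functions" "n \<le> N"
  shows "half_conv (impulse_sol N a 0) ((deriv ^^ n) \<phi>) t
    = (-1) ^ n * (half_conv (impulse_sol N a n) \<phi> t + (if n = N then \<phi> t / a N else 0))"
  using assms(2,3)
proof (induction n arbitrary: \<phi>)
  case 0
  then show ?case using N by simp
next
  case (Suc n)
  have "half_conv (impulse_sol N a 0) ((deriv ^^ Suc n) \<phi>) t
      = half_conv (impulse_sol N a 0) ((deriv ^^ n) (deriv \<phi>)) t" by (simp add: funpow_swap1)
  also have "\<dots> = (-1) ^ n * half_conv (impulse_sol N a n) (deriv \<phi>) t"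
    using Suc.IH[OF test_functions_deriv[OF Suc.prems(1)]] Suc.prems(2) by simp
  also have "half_conv (impulse_sol N a n) (deriv \<phi>) t
      = - (half_conv (impulse_sol N a (Suc n)) \<phi> t + impulse N a n * \<phi> t)"
    using half_conv_test_deriv[OF N Suc.prems(1), of a "(companion N a ^^ n) (impulse N a)" t]
      companion_funpow_low[of 0 n N a "impulse N a"] Suc.prems(2) by simp
  also have "impulse N a n * \<phi> t = (if Suc n = N then \<phi> t / a N else 0)"
    using Suc.prems(2) by (auto simp: impulse_def)
  finally show ?case by (simp add: algebra_simps)
qed

lemma half_conv_adjoint_sum:
  assumes "continuous_on UNIV \<kappa>" and \<phi>: "\<phi> \<in> test_functions"
  shows "half_conv \<kappa> (adjoint_op N a \<phi>) t = (\<Sum>n=0..N. a n * (-1) ^ n * half_conv \<kappa> ((deriv ^^ n) \<phi>) t)"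
proof -
  let ?T = "distr_of_fun (\<lambda>\<tau>. unit_step \<tau> * \<kappa> \<tau>)"
  have test: "(\<lambda>\<tau>. (deriv ^^ n) \<phi> (t + \<tau>)) \<in> test_functions" for n
    by (intro test_functions_translate test_functions_funpow_deriv \<phi>)
  have "half_conv \<kappa> (adjoint_op N a \<phi>) t = pairing ?T (\<lambda>\<tau>. \<Sum>n=0..N. a n * (-1) ^ n * (deriv ^^ n) \<phi> (t + \<tau>))"
    unfolding half_conv_eq_pairing[OF assms(1) test_functions_adjoint_op[OF \<phi>]] by (simp add: adjoint_op_def)
  also have "\<dots> = (\<Sum>n=0..N. pairing ?T (\<lambda>\<tau>. a n * (-1) ^ n * (deriv ^^ n) \<phi> (t + \<tau>)))"
    by (intro pairing_sum test_functions_cmult test)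
  also have "\<dots> = (\<Sum>n=0..N. a n * (-1) ^ n * half_conv \<kappa> ((deriv ^^ n) \<phi>) t)"
    unfolding half_conv_eq_pairing[OF assms(1) test_functions_funpow_deriv[OF \<phi>]]
    by (intro sum.cong refl pairing_cmult test)
  finally show ?thesis .
qed

text \<open>The boundary terms of the integrations by parts vanish except the one of order \<open>N\<close>; that is what
  the impulse initial values are chosen for.\<close>

lemma half_conv_impulse_adjoint:
  assumes N: "N \<ge> 1" "a N \<noteq> 0" and \<phi>: "\<phi> \<in> test_functions"
  shows "half_conv (impulse_sol N a 0) (adjoint_op N a \<phi>) = \<phi>"
proof
  fix t
  note cont = ode_sol_continuous[OF N(1)]
  have "half_conv (impulse_sol N a 0) (adjoint_op N a \<phi>) t
      = (\<Sum>n=0..N. a n * (-1) ^ n * ((-1) ^ n * (half_conv (impulse_sol N a n) \<phi> t + (if n = N then \<phi> t / a N else 0))))"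
    unfolding half_conv_adjoint_sum[OF cont \<phi>]
    by (intro sum.cong refl) (simp only: half_conv_impulse_funpow[OF N(1) \<phi>] atLeastAtMost_iff)
  also have "\<dots> = (\<Sum>n=0..N. a n * half_conv (impulse_sol N a n) \<phi> t + (if n = N then \<phi> t else 0))"
  proof (rule sum.cong)
    fix n
    have "(-1) ^ n * (-1) ^ n = (1::real)" by (simp add: power_mult_distrib[symmetric])
    then have "a n * (-1) ^ n * ((-1) ^ n * z) = a n * z" for z
      by (metis mult.assoc mult.right_neutral)
    then show "a n * (-1) ^ n * ((-1) ^ n * (half_conv (impulse_sol N a n) \<phi> t + (if n = N then \<phi> t / a N else 0)))
        = a n * half_conv (impulse_sol N a n) \<phi> t + (if n = N then \<phi> t else 0)"
      using N(2) by (simp add: distrib_left)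
  qed simp
  also have "\<dots> = (\<Sum>n=0..N. a n * half_conv (impulse_sol N a n) \<phi> t) + \<phi> t"
    by (simp add: sum.distrib)
  also have "(\<Sum>n=0..N. a n * half_conv (impulse_sol N a n) \<phi> t) = 0"
  proof -
    have "pairing (\<Sum>n\<in>{0..N}. a n *\<^sub>R distr_of_fun (\<lambda>\<tau>. unit_step \<tau> * impulse_sol N a n \<tau>)) (\<lambda>\<tau>. \<phi> (t + \<tau>)) = 0"
      by (simp only: unit_step_ode_sol_equation[where a = a, OF N] pairing_zero)
    then show ?thesis
      by (simp add: pairing_distr_sum pairing_scaleR half_conv_eq_pairing[OF cont \<phi>])
  qed
  finally show "half_conv (impulse_sol N a 0) (adjoint_op N a \<phi>) t = \<phi> t" by simp
qed

lemma half_conv_impulse_deriv: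
  assumes N: "N \<ge> 1" and \<phi>: "\<phi> \<in> test_functions"
  shows "(half_conv (impulse_sol N a 0) \<phi> has_real_derivative half_conv (impulse_sol N a 0) (deriv \<phi>) t) (at t)"
proof -
  define \<sigma> where "\<sigma> = companion_rate N a + 1"
  have \<kappa>: "decaying_kernel (\<sigma> - companion_rate N a) (initial_norm N (impulse N a)) (damped_kernel N a \<sigma>)"
    by (rule decaying_damped_kernel[OF N]) (simp add: \<sigma>_def)
  let ?H = "half_conv (damped_kernel N a \<sigma>)"
  define \<psi> where "\<psi> t = exp (\<sigma> * t) * \<phi> t" for t
  define \<psi>' where "\<psi>' t = exp (\<sigma> * t) * deriv \<phi> t" for t
  have S: "\<psi> \<in> schwartz" "\<psi>' \<in> schwartz"
    unfolding \<psi>_def[abs_def] \<psi>'_def[abs_def]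
    by (intro test_imp_schwartz test_functions_exp test_functions_deriv \<phi>)+
  have d: "deriv \<psi> = (\<lambda>t. \<sigma> * \<psi> t + \<psi>' t)"
    unfolding \<psi>_def[abs_def] \<psi>'_def
    by (intro ext DERIV_imp_deriv)
       (auto intro!: derivative_eq_intros smooth_has_deriv[OF test_smooth[OF \<phi>]])
  have "?H (deriv \<psi>) t = \<sigma> * ?H \<psi> t + ?H \<psi>' t"
    unfolding d half_conv_def distrib_left mult.left_commute[of _ \<sigma>]
    using half_conv_integrable[OF \<kappa> S(1), of t] half_conv_integrable[OF \<kappa> S(2), of t]
    by (subst set_integral_add(2)) auto
  moreover have "((\<lambda>t. exp (- \<sigma> * t) * ?H \<psi> t) has_real_derivative
      exp (- \<sigma> * t) * ?H (deriv \<psi>) t - \<sigma> * exp (- \<sigma> * t) * ?H \<psi> t) (at t)"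
    by (auto intro!: derivative_eq_intros half_conv_deriv[OF \<kappa> S(1)])
  ultimately have "((\<lambda>t. exp (- \<sigma> * t) * ?H \<psi> t) has_real_derivative exp (- \<sigma> * t) * ?H \<psi>' t) (at t)"
    by (simp add: algebra_simps)
  then show ?thesis
    unfolding half_conv_impulse_eq[of N a \<phi> \<sigma>] half_conv_impulse_eq[of N a "deriv \<phi>" \<sigma>] \<psi>_def[abs_def] \<psi>'_def[abs_def] .
qed

lemma funpow_deriv_half_conv_impulse:
  assumes N: "N \<ge> 1" and \<phi>: "\<phi> \<in> test_functions"
  shows "(deriv ^^ k) (half_conv (impulse_sol N a 0) \<phi>) = half_conv (impulse_sol N a 0) ((deriv ^^ k) \<phi>)"
proof (induction k)
  case (Suc k)
  have "deriv (half_conv (impulse_sol N a 0) ((deriv ^^ k) \<phi>)) = half_conv (impulse_sol N a 0) (deriv ((deriv ^^ k) \<phi>))"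
    by (intro ext DERIV_imp_deriv half_conv_impulse_deriv[OF N] test_functions_funpow_deriv \<phi>)
  then show ?case using Suc by simp
qed simp

lemma smooth_half_conv_impulse:
  assumes N: "N \<ge> 1" and \<phi>: "\<phi> \<in> test_functions" shows "smooth (half_conv (impulse_sol N a 0) \<phi>)"
  unfolding smooth_def funpow_deriv_half_conv_impulse[OF assms] real_differentiable_def
  using half_conv_impulse_deriv[OF N test_functions_funpow_deriv[OF \<phi>]] by blast

lemma adjoint_half_conv_impulse:
  assumes N: "N \<ge> 1" "a N \<noteq> 0" and \<phi>: "\<phi> \<in> test_functions"
  shows "adjoint_op N a (half_conv (impulse_sol N a 0) \<phi>) t = \<phi> t"
proof -
  have "adjoint_op N a (half_conv (impulse_sol N a 0) \<phi>) t
      = (\<Sum>n=0..N. a n * (-1) ^ n * half_conv (impulse_sol N a 0) ((deriv ^^ n) \<phi>) t)"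
    unfolding adjoint_op_def funpow_deriv_half_conv_impulse[OF N(1) \<phi>] ..
  also have "\<dots> = half_conv (impulse_sol N a 0) (adjoint_op N a \<phi>) t"
    by (rule half_conv_adjoint_sum[symmetric, OF ode_sol_continuous[OF N(1)] \<phi>])
  also have "\<dots> = \<phi> t" by (simp only: half_conv_impulse_adjoint[where a = a, OF N \<phi>])
  finally show ?thesis .
qed


section \<open>The evoked response\<close>

lemma test_cutoff_half_conv_impulse:
  assumes N: "N \<ge> 1" and \<phi>: "\<phi> \<in> test_functions"
  shows "(\<lambda>t. causal_cutoff t * half_conv (impulse_sol N a 0) \<phi> t) \<in> test_functions"
proof -
  obtain R where R: "R > 0" "\<And>t. \<bar>t\<bar> > R \<Longrightarrow> \<phi> t = 0"
    using test_functions_vanishE[OF \<phi>] by blast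
  show ?thesis
  proof (rule test_functions_vanishI[of _ "-1" R])
    show "smooth (\<lambda>t. causal_cutoff t * half_conv (impulse_sol N a 0) \<phi> t)"
      by (intro smooth_mult smooth_causal_cutoff smooth_half_conv_impulse N \<phi>)
    fix t :: real assume "t > R"
    then have "half_conv (impulse_sol N a 0) \<phi> t = 0" using R by (intro half_conv_vanish[of R]) auto
    then show "causal_cutoff t * half_conv (impulse_sol N a 0) \<phi> t = 0" by simp
  qed (simp add: causal_cutoff_eq_0)
qed

text \<open>The convolution of \<open>T\<close> with the fundamental solution. At each abscissa to the right of the growth
  rate of the kernel it is tempered, and the distribution that results does not depend on the abscissa.\<close>

lemma causal_solution_exists:
  assumes N: "N \<ge> 1" "a N \<noteq> 0" and T: "laplace_transformable T"
  shows "\<exists>Y. laplace_transformable Y \<and> diff_op N a Y = T"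
proof -
  let ?\<rho> = "companion_rate N a"
  let ?e = "impulse_sol N a 0"
  obtain \<sigma>\<^sub>0 where cT: "causal T" and ext: "\<And>\<sigma>. \<sigma> > \<sigma>\<^sub>0 \<Longrightarrow> \<exists>G. tempered_extension T \<sigma> G"
    using laplace_transformableE[OF T] by blast
  have key: "tempered_functional (\<lambda>\<psi>. G (half_conv (damped_kernel N a \<sigma>) \<psi>)) \<and>
      (\<forall>\<phi>\<in>test_functions. G (half_conv (damped_kernel N a \<sigma>) \<phi>)
        = pairing T (\<lambda>t. causal_cutoff t * half_conv ?e (\<lambda>t. exp (- \<sigma> * t) * \<phi> t) t))"
    if \<sigma>: "\<sigma> > ?\<rho>" and G: "tempered_extension T \<sigma> G" for \<sigma> G
  proof (intro conjI ballI)
    have \<kappa>: "decaying_kernel (\<sigma> - ?\<rho>) (initial_norm N (impulse N a)) (damped_kernel N a \<sigma>)"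
      by (rule decaying_damped_kernel[OF N(1) \<sigma>])
    show "tempered_functional (\<lambda>\<psi>. G (half_conv (damped_kernel N a \<sigma>) \<psi>))"
      by (rule tempered_functional_half_conv[OF tempered_extension_tempered[OF G] \<kappa>])
    fix \<phi> assume \<phi>: "\<phi> \<in> test_functions"
    define \<psi> where "\<psi> = half_conv (damped_kernel N a \<sigma>) \<phi>"
    have \<psi>: "\<psi> \<in> schwartz" unfolding \<psi>_def by (rule schwartz_half_conv[OF \<kappa> test_imp_schwartz[OF \<phi>]])
    have eq: "half_conv ?e (\<lambda>t. exp (- \<sigma> * t) * \<phi> t) t = exp (- \<sigma> * t) * \<psi> t" for t
      unfolding \<psi>_def by (rule half_conv_exp)
    have "(\<lambda>t. exp (\<sigma> * t) * (causal_cutoff t * half_conv ?e (\<lambda>t. exp (- \<sigma> * t) * \<phi> t) t)) \<in> test_functions"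
      by (intro test_functions_exp test_cutoff_half_conv_impulse N(1) \<phi>)
    moreover have "exp (\<sigma> * t) * (causal_cutoff t * half_conv ?e (\<lambda>t. exp (- \<sigma> * t) * \<phi> t) t)
        = causal_cutoff t * \<psi> t" for t
    proof -
      have "exp (\<sigma> * t) * exp (- \<sigma> * t) = 1" unfolding exp_add[symmetric] by simp
      then show ?thesis unfolding eq by (metis mult.assoc mult.commute mult.left_neutral)
    qed
    ultimately have test: "(\<lambda>t. causal_cutoff t * \<psi> t) \<in> test_functions" by (simp only:)
    have "G \<psi> = G (\<lambda>t. causal_cutoff t * \<psi> t)"
      by (rule tempered_extension_cong[OF cT G \<psi> test_imp_schwartz[OF test], of "1/2"])
         (auto simp: causal_cutoff_eq_1)
    also have "\<dots> = pairing T (\<lambda>t. exp (- \<sigma> * t) * (causal_cutoff t * \<psi> t))"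
      by (rule tempered_extension_test[OF G test])
    also have "\<dots> = pairing T (\<lambda>t. causal_cutoff t * half_conv ?e (\<lambda>t. exp (- \<sigma> * t) * \<phi> t) t)"
      unfolding eq by (simp add: mult.left_commute)
    finally show "G (half_conv (damped_kernel N a \<sigma>) \<phi>)
        = pairing T (\<lambda>t. causal_cutoff t * half_conv ?e (\<lambda>t. exp (- \<sigma> * t) * \<phi> t) t)"
      unfolding \<psi>_def .
  qed
  define \<sigma>\<^sub>1 where "\<sigma>\<^sub>1 = max \<sigma>\<^sub>0 ?\<rho> + 1"
  have "\<sigma>\<^sub>1 > \<sigma>\<^sub>0" and \<sigma>\<^sub>1: "\<sigma>\<^sub>1 > ?\<rho>" unfolding \<sigma>\<^sub>1_def by linarith+
  then obtain G\<^sub>1 where G\<^sub>1: "tempered_extension T \<sigma>\<^sub>1 G\<^sub>1" using ext by blast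
  define Y where "Y = distr_of_tempered \<sigma>\<^sub>1 (\<lambda>\<psi>. G\<^sub>1 (half_conv (damped_kernel N a \<sigma>\<^sub>1) \<psi>))"
  have Y: "pairing Y \<phi> = pairing T (\<lambda>t. causal_cutoff t * half_conv ?e \<phi> t)"
    if \<phi>: "\<phi> \<in> test_functions" for \<phi>
    using key[OF \<sigma>\<^sub>1 G\<^sub>1] test_functions_exp[OF \<phi>, of \<sigma>\<^sub>1]
    unfolding Y_def by (simp only: pairing_distr_of_tempered[OF _ \<phi>] exp_cancel)
  have cY: "causal Y"
  proof (rule causalI)
    fix \<phi> and \<epsilon> :: real
    assume \<phi>: "\<phi> \<in> test_functions" "\<epsilon> > 0" "\<And>t. t > - \<epsilon> \<Longrightarrow> \<phi> t = 0"
    have "pairing T (\<lambda>t. causal_cutoff t * half_conv ?e \<phi> t) = 0"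
    proof (rule causal_pairing_eq_0[OF cT test_cutoff_half_conv_impulse[OF N(1) \<phi>(1)] \<phi>(2)])
      fix t assume "t > - \<epsilon>"
      then have "half_conv ?e \<phi> t = 0" using \<phi>(3) by (rule half_conv_vanish[rotated])
      then show "causal_cutoff t * half_conv ?e \<phi> t = 0" by simp
    qed
    then show "pairing Y \<phi> = 0" by (simp add: Y \<phi>(1))
  qed
  have "laplace_transformable Y"
  proof (rule laplace_transformableI[OF cY])
    fix \<sigma> assume \<sigma>: "\<sigma> > max \<sigma>\<^sub>0 ?\<rho>"
    then obtain G where G: "tempered_extension T \<sigma> G" using ext[of \<sigma>] by auto
    have \<rho>: "\<sigma> > ?\<rho>" using \<sigma> by simp
    have "tempered_extension Y \<sigma> (\<lambda>\<psi>. G (half_conv (damped_kernel N a \<sigma>) \<psi>))"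
      unfolding tempered_extension_def
    proof (intro conjI ballI)
      show "tempered_functional (\<lambda>\<psi>. G (half_conv (damped_kernel N a \<sigma>) \<psi>))" using key[OF \<rho> G] by blast
      fix \<phi> assume \<phi>: "\<phi> \<in> test_functions"
      then have "G (half_conv (damped_kernel N a \<sigma>) \<phi>)
          = pairing T (\<lambda>t. causal_cutoff t * half_conv ?e (\<lambda>t. exp (- \<sigma> * t) * \<phi> t) t)"
        using key[OF \<rho> G] by blast
      also have "\<dots> = pairing Y (\<lambda>t. exp (- \<sigma> * t) * \<phi> t)"
        by (rule Y[OF test_functions_exp[OF \<phi>], symmetric])
      finally show "G (half_conv (damped_kernel N a \<sigma>) \<phi>) = pairing Y (\<lambda>t. exp (- \<sigma> * t) * \<phi> t)" .
    qed
    then show "\<exists>G. tempered_extension Y \<sigma> G" by blast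
  qed
  moreover have "diff_op N a Y = T"
  proof (rule distr_eqI)
    fix \<phi> assume \<phi>: "\<phi> \<in> test_functions"
    have "pairing (diff_op N a Y) \<phi> = pairing T (\<lambda>t. causal_cutoff t * \<phi> t)"
      by (simp only: pairing_diff_op[OF \<phi>] Y[OF test_functions_adjoint_op[OF \<phi>]]
          half_conv_impulse_adjoint[where a = a, OF N \<phi>])
    also have "\<dots> = pairing T \<phi>"
      by (rule causal_pairing_cong[OF cT test_functions_mult_smooth[OF smooth_causal_cutoff \<phi>] \<phi>, of "1/2"])
         (auto simp: causal_cutoff_eq_1)
    finally show "pairing (diff_op N a Y) \<phi> = pairing T \<phi>" .
  qed
  ultimately show ?thesis by blast
qed

lemma causal_solution_laplace:
  assumes N: "N \<ge> 1" "a N \<noteq> 0" and T: "laplace_pair T F"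
  shows "\<exists>Y. laplace_pair Y (\<lambda>s. F s / (\<Sum>n=0..N. of_real (a n) * s ^ n)) \<and> diff_op N a Y = T"
proof -
  obtain Y where Y: "laplace_transformable Y" "diff_op N a Y = T"
    using causal_solution_exists[where a = a, OF N laplace_pairD[OF T]] by blast
  have "laplace_pair T (\<lambda>s. (\<Sum>n=0..N. of_real (a n) * s ^ n) * laplace Y s)"
    using laplace_pair_diff_op[OF laplace_pair_self[OF Y(1)], where N = N and a = a] Y(2)
    by (simp add: diff_op_def)
  then have "\<forall>\<^sub>F s in far_right. laplace T s = (\<Sum>n=0..N. of_real (a n) * s ^ n) * laplace Y s"
    by (simp add: laplace_pair_iff)
  moreover have "\<forall>\<^sub>F s in far_right. laplace T s = F s" using T by (simp add: laplace_pair_iff)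
  moreover have "\<forall>\<^sub>F s in far_right. (\<Sum>n=0..N. of_real (a n) * s ^ n) \<noteq> (0::complex)"
    by (rule characteristic_poly_nonzero[where a = a, OF N(2)])
  ultimately have "\<forall>\<^sub>F s in far_right. laplace Y s = F s / (\<Sum>n=0..N. of_real (a n) * s ^ n)"
    by eventually_elim (simp add: field_simps)
  then show ?thesis using Y by (auto simp: laplace_pair_iff)
qed


section \<open>Homogeneous distributional solutions are classical\<close>

text \<open>Far to the left the half-line convolution of a test function \<open>\<phi>\<close> is a combination of solutions of the
  adjoint equation. Subtracting these, cut off on the right, leaves a test function whose image under the
  adjoint operator is \<open>\<phi>\<close> minus a combination of fixed test functions \<open>\<theta> j\<close>. The coefficients are the pairings of \<open>\<phi>\<close> with a basis of solutions, so a
  distribution that annihilates the range of the adjoint is determined by its values on the \<open>\<theta> j\<close>.\<close>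

lemma homogeneous_distr_solution:
  assumes N: "N \<ge> 1" "a N \<noteq> 0" and T: "diff_op N a T = 0"
  shows "\<exists>c. T = distr_of_fun (ode_sol N a c)"
proof -
  note cont = ode_sol_continuous[OF N(1)]
  let ?K = "half_conv (impulse_sol N a 0)"
  define \<zeta> where "\<zeta> t = 1 - causal_cutoff t" for t
  \<comment> \<open>chosen so that \<open>e (s - t) = (\<Sum>j<N. g j t * z\<^sub>j s)\<close> for the basis \<open>z\<^sub>j\<close> of solutions\<close>
  define g where "g j t = impulse_sol N a j (-1 * t + 0)" for j t
  define h where "h j t = \<zeta> t * g j t" for j t
  define \<theta> where "\<theta> j = adjoint_op N a (h j)" for j
  have smooth_h: "smooth (h j)" for j
    unfolding h_def[abs_def] \<zeta>_def g_def
    by (intro smooth_mult smooth_diff smooth_const smooth_causal_cutoff smooth_affine smooth_ode_sol N(1))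
  have test_\<theta>: "\<theta> j \<in> test_functions" for j
  proof (rule test_functions_vanishI[of _ "-1" 0])
    show "smooth (\<theta> j)" unfolding \<theta>_def by (rule smooth_adjoint_op[OF smooth_h])
  next
    fix t :: real assume t: "t > 0"
    have "(deriv ^^ n) (h j) t = (deriv ^^ n) (\<lambda>_. 0) t" for n
      by (rule funpow_deriv_eventually_cong[of "{0<..}"])
         (use t in \<open>auto simp: h_def \<zeta>_def causal_cutoff_eq_1\<close>)
    then show "\<theta> j t = 0" unfolding \<theta>_def adjoint_op_def by (simp add: funpow_deriv_const)
  next
    fix t :: real assume t: "t < -1"
    have deriv_h: "(deriv ^^ n) (h j) t = (-1) ^ n * ode_sol N a ((companion N a ^^ n) ((companion N a ^^ j) (impulse N a))) (- t)" for n
    proof -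
      have "(deriv ^^ n) (h j) t = (deriv ^^ n) (g j) t"
        by (rule funpow_deriv_eventually_cong[of "{..< -1}"])
           (use t in \<open>auto simp: h_def \<zeta>_def causal_cutoff_eq_0\<close>)
      also have "(deriv ^^ n) (g j) t
          = (-1) ^ n * ode_sol N a ((companion N a ^^ n) ((companion N a ^^ j) (impulse N a))) (-1 * t + 0)"
        unfolding g_def[abs_def] funpow_deriv_affine[OF smooth_ode_sol[OF N(1)]] funpow_deriv_ode_sol[OF N(1)] ..
      finally show ?thesis by simp
    qed
    have "\<theta> j t = (\<Sum>n=0..N. a n * ode_sol N a ((companion N a ^^ n) ((companion N a ^^ j) (impulse N a))) (- t))"
      unfolding \<theta>_def adjoint_op_def deriv_h
    proof (rule sum.cong)
      fix n
      have "(-1) ^ n * (-1) ^ n = (1::real)" by (simp add: power_mult_distrib[symmetric])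
      then show "a n * (-1) ^ n * ((-1) ^ n * z) = a n * z" for z
        by (metis mult.assoc mult.right_neutral)
    qed simp
    then show "\<theta> j t = 0" by (simp only: ode_sol_equation[where a = a, OF N])
  qed
  define c where "c j = pairing T (\<theta> j)" for j
  have "pairing T \<phi> = pairing (distr_of_fun (ode_sol N a c)) \<phi>" if \<phi>: "\<phi> \<in> test_functions" for \<phi>
  proof -
    define x where "x j = pairing (distr_of_fun (ode_sol N a (unit_vec j))) \<phi>" for j
    have comb: "(\<Sum>j<N. v j * x j) = pairing (distr_of_fun (ode_sol N a v)) \<phi>" for v
    proof -
      have eq: "ode_sol N a v = (\<lambda>t. \<Sum>j<N. v j * ode_sol N a (unit_vec j) t)"
        using ode_sol_basis[OF N(1)] by blast
      have "distr_of_fun (ode_sol N a v) = (\<Sum>j<N. v j *\<^sub>R distr_of_fun (ode_sol N a (unit_vec j)))"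
        unfolding eq
        by (rule distr_of_fun_lincomb[symmetric])
           (auto intro!: locally_integrable_continuous continuous_intros cont)
      then show ?thesis by (simp add: pairing_distr_sum pairing_scaleR x_def)
    qed
    define \<Phi> where "\<Phi> t = ?K \<phi> t + (\<Sum>j<N. (- x j) * h j t)" for t
    obtain R where R: "R > 0" "\<And>t. \<bar>t\<bar> > R \<Longrightarrow> \<phi> t = 0"
      using test_functions_vanishE[OF \<phi>] by blast
    have test_\<Phi>: "\<Phi> \<in> test_functions"
    proof (rule test_functions_vanishI[of _ "- max R 1" R])
      show "smooth \<Phi>"
        unfolding \<Phi>_def[abs_def]
        by (intro smooth_add smooth_half_conv_impulse[OF N(1) \<phi>], rule smooth_sum, rule smooth_cmult, rule smooth_h)
    next
      fix t assume t: "t > R"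
      then have "?K \<phi> t = 0" using R(2) by (intro half_conv_vanish[of R]) auto
      moreover have "h j t = 0" for j using t R(1) by (simp add: h_def \<zeta>_def causal_cutoff_eq_1)
      ultimately show "\<Phi> t = 0" by (simp add: \<Phi>_def)
    next
      fix t assume t: "t < - max R 1"
      have hg: "h j t = impulse_sol N a j (- t)" for j
        using t by (simp add: h_def \<zeta>_def g_def causal_cutoff_eq_0)
      have "?K \<phi> t = (LBINT \<tau>. impulse_sol N a 0 \<tau> * \<phi> (t + \<tau>))"
        unfolding half_conv_def set_lebesgue_integral_def
        by (rule Bochner_Integration.integral_cong) (use t R(2) in \<open>auto simp: indicator_def\<close>)
      also have "\<dots> = (LBINT s. impulse_sol N a 0 (- t + s) * \<phi> s)"
        by (subst lborel_integral_real_affine[of 1 _ t]) auto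
      also have "\<dots> = (LBINT s. ode_sol N a (\<lambda>j. impulse_sol N a j (- t)) s * \<phi> s)"
        by (simp only: ode_sol_translate[where a = a, OF N, of _ "- t"] funpow_0)
      also have "\<dots> = (\<Sum>j<N. impulse_sol N a j (- t) * x j)"
        unfolding comb by (simp add: pairing_distr_of_fun locally_integrable_continuous cont \<phi>)
      finally show "\<Phi> t = 0" by (simp add: \<Phi>_def hg sum_negf mult.commute)
    qed
    have adj: "adjoint_op N a \<Phi> = (\<lambda>t. \<phi> t + (\<Sum>j<N. (- x j) * \<theta> j t))"
    proof
      fix t
      have "adjoint_op N a \<Phi> t = adjoint_op N a (?K \<phi>) t + (\<Sum>j<N. (- x j) * adjoint_op N a (h j) t)"
        unfolding \<Phi>_def[abs_def]
        by (rule adjoint_op_lincomb[OF smooth_half_conv_impulse[OF N(1) \<phi>] finite_lessThan smooth_h])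
      then show "adjoint_op N a \<Phi> t = \<phi> t + (\<Sum>j<N. (- x j) * \<theta> j t)"
        by (simp only: adjoint_half_conv_impulse[where a = a, OF N \<phi>] \<theta>_def)
    qed
    have "0 = pairing T (\<lambda>t. \<phi> t + (\<Sum>j<N. (- x j) * \<theta> j t))"
      using pairing_diff_op[OF test_\<Phi>, of N a T] T by (simp add: pairing_zero adj)
    also have "\<dots> = pairing T \<phi> + pairing T (\<lambda>t. \<Sum>j<N. (- x j) * \<theta> j t)"
      by (intro pairing_add \<phi> test_functions_sum test_functions_cmult test_\<theta>)
    also have "pairing T (\<lambda>t. \<Sum>j<N. (- x j) * \<theta> j t) = (\<Sum>j<N. pairing T (\<lambda>t. (- x j) * \<theta> j t))"
      by (intro pairing_sum test_functions_cmult test_\<theta>)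
    also have "\<dots> = (\<Sum>j<N. (- x j) * c j)"
      unfolding c_def by (intro sum.cong refl pairing_cmult test_\<theta>)
    finally show ?thesis using comb[of c] by (simp add: sum_negf mult.commute)
  qed
  then show ?thesis by (intro exI[of _ c] distr_eqI)
qed


section \<open>The spontaneous response\<close>

text \<open>Differentiating \<open>u z\<close> produces an impulse weighted by \<open>z(0)\<close>, so the transforms of \<open>u z\<^sup>(\<^sup>k\<^sup>)\<close> are obtained
  from that of \<open>u z\<close> by \<open>k\<close> steps \<open>Z \<mapsto> s Z - z\<^sup>(\<^sup>i\<^sup>)(0)\<close>; the differential equation then is a linear equation
  for the first one.\<close>

lemma laplace_pair_initial_values:
  assumes N: "N \<ge> 1" "a N \<noteq> 0"
  shows "laplace_pair (distr_of_fun (\<lambda>t. unit_step t * ode_sol N a c t))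
    (\<lambda>s. (\<Sum>\<mu>=1..N. of_real (a \<mu>) * (\<Sum>\<nu>=0..\<mu>-1. of_real (c (\<mu> - 1 - \<nu>)) * s ^ \<nu>))
        / (\<Sum>n=0..N. of_real (a n) * s ^ n))"
proof -
  note cont = ode_sol_continuous[OF N(1)]
  let ?U = "\<lambda>k. distr_of_fun (\<lambda>t. unit_step t * ode_sol N a ((companion N a ^^ k) c) t)"
  let ?Z = "laplace (?U 0)"
  let ?P = "\<lambda>k s. \<Sum>\<nu><k. of_real (c (k - 1 - \<nu>)) * s ^ \<nu> :: complex"
  have pair: "laplace_pair (?U k) (\<lambda>s. s ^ k * ?Z s - ?P k s)" if "k \<le> N" for k
    using that
  proof (induction k)
    case 0
    have "laplace_transformable (?U 0)"
    proof (rule laplace_transformable_unit_step[OF cont])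
      fix t :: real assume "t \<ge> 0"
      then show "\<bar>ode_sol N a ((companion N a ^^ 0) c) t\<bar> \<le> initial_norm N c * exp (companion_rate N a * t)"
        using ode_sol_bound[OF N(1), of a c t] by simp
    qed
    then show ?case using laplace_pair_self by simp
  next
    case (Suc k)
    have c0: "ode_sol N a ((companion N a ^^ k) c) 0 = c k"
      using companion_funpow_low[of 0 k N a c] Suc.prems by (simp add: ode_sol_0)
    have "distr_deriv (?U k) = ?U (Suc k) + c k *\<^sub>R distr_delta"
      using distr_deriv_unit_step[OF ode_sol_deriv[OF N(1)] cont, of a "(companion N a ^^ k) c"] c0 by simp
    then have "?U (Suc k) = 1 *\<^sub>R distr_deriv (?U k) + (- c k) *\<^sub>R distr_delta" by simp
    moreover have "laplace_pair (1 *\<^sub>R distr_deriv (?U k) + (- c k) *\<^sub>R distr_delta)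
        (\<lambda>s. of_real 1 * (s * (s ^ k * ?Z s - ?P k s)) + of_real (- c k) * 1)"
      using Suc by (intro laplace_pair_lincomb laplace_pair_distr_deriv laplace_pair_delta) simp
    moreover have "of_real 1 * (s * (s ^ k * ?Z s - ?P k s)) + of_real (- c k) * 1 = s ^ Suc k * ?Z s - ?P (Suc k) s" for s
    proof -
      have "?P (Suc k) s = of_real (c k) + s * ?P k s"
        by (subst sum.lessThan_Suc_shift) (simp add: sum_distrib_left mult.left_commute)
      then show ?thesis by (simp add: algebra_simps)
    qed
    ultimately show ?case by (simp only:)
  qed
  have zero: "(\<Sum>n\<in>{0..N}. a n *\<^sub>R ?U n) = 0" by (rule unit_step_ode_sol_equation[where a = a, OF N])
  have "laplace_pair (\<Sum>n\<in>{0..N}. a n *\<^sub>R ?U n) (\<lambda>s. \<Sum>n\<in>{0..N}. of_real (a n) * (s ^ n * ?Z s - ?P n s))"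
    by (intro laplace_pair_sum laplace_pair_scaleR pair) simp
  then have "\<forall>\<^sub>F s in far_right. laplace 0 s = (\<Sum>n\<in>{0..N}. of_real (a n) * (s ^ n * ?Z s - ?P n s))"
    unfolding zero by (simp add: laplace_pair_iff)
  moreover have "\<forall>\<^sub>F s in far_right. laplace 0 s = 0"
    using laplace_pair_zero by (simp add: laplace_pair_iff)
  moreover have "\<forall>\<^sub>F s in far_right. (\<Sum>n=0..N. of_real (a n) * s ^ n) \<noteq> (0::complex)"
    by (rule characteristic_poly_nonzero[where a = a, OF N(2)])
  ultimately have "\<forall>\<^sub>F s in far_right. s ^ 0 * ?Z s - ?P 0 s =
      (\<Sum>\<mu>=1..N. of_real (a \<mu>) * (\<Sum>\<nu>=0..\<mu>-1. of_real (c (\<mu> - 1 - \<nu>)) * s ^ \<nu>)) / (\<Sum>n=0..N. of_real (a n) * s ^ n)"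
  proof eventually_elim
    case (elim s)
    have "0 = (\<Sum>n=0..N. of_real (a n) * s ^ n) * ?Z s - (\<Sum>n=0..N. of_real (a n) * ?P n s)"
      using elim(1,2) by (simp add: right_diff_distrib sum_subtractf sum_distrib_right mult.assoc)
    moreover have "(\<Sum>n=0..N. of_real (a n) * ?P n s)
        = (\<Sum>\<mu>=1..N. of_real (a \<mu>) * (\<Sum>\<nu>=0..\<mu>-1. of_real (c (\<mu> - 1 - \<nu>)) * s ^ \<nu>))"
    proof -
      have "(\<Sum>n=0..N. of_real (a n) * ?P n s) = (\<Sum>n=1..N. of_real (a n) * ?P n s)"
        by (simp add: sum.atLeast_Suc_atMost)
      also have "\<dots> = (\<Sum>\<mu>=1..N. of_real (a \<mu>) * (\<Sum>\<nu>=0..\<mu>-1. of_real (c (\<mu> - 1 - \<nu>)) * s ^ \<nu>))"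
      proof (rule sum.cong)
        fix \<mu> assume "\<mu> \<in> {1..N}"
        then have "{..<\<mu>} = {0..\<mu> - 1}" by auto
        then show "of_real (a \<mu>) * ?P \<mu> s = of_real (a \<mu>) * (\<Sum>\<nu>=0..\<mu>-1. of_real (c (\<mu> - 1 - \<nu>)) * s ^ \<nu>)" by simp
      qed simp
      finally show ?thesis .
    qed
    ultimately show ?case using elim(3) by (simp add: field_simps)
  qed
  then show ?thesis using laplace_pair_cong[OF pair[of 0]] by simp
qed

lemma ode_sol_homogeneous_ivp:
  assumes N: "N \<ge> 1" "a N \<noteq> 0" shows "homogeneous_ivp_solution N a c (ode_sol N a c)"
  unfolding homogeneous_ivp_solution_def funpow_deriv_ode_sol[OF N(1)]
proof (intro conjI allI impI)
  show "ode_sol N a ((companion N a ^^ k) c) differentiable (at t)" for k t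
    using ode_sol_deriv[OF N(1)] real_differentiable_def by blast
  show "(\<Sum>n=0..N. a n *\<^sub>R (distr_deriv ^^ n) (distr_of_fun (ode_sol N a c))) = 0"
    using diff_op_ode_sol[where a = a, OF N] by (simp add: diff_op_def)
  show "ode_sol N a ((companion N a ^^ \<nu>) c) 0 = c \<nu>" if "\<nu> < N" for \<nu>
    using companion_funpow_low[of 0 \<nu> N a c] that by (simp add: ode_sol_0)
qed

lemma homogeneous_ivp_unique:
  assumes N: "N \<ge> 1" "a N \<noteq> 0" and z: "homogeneous_ivp_solution N a c z"
  shows "z = ode_sol N a c"
proof -
  have diff: "(deriv ^^ k) z differentiable (at t)" if "k < N" for k t
    using z that by (simp add: homogeneous_ivp_solution_def)
  have "z differentiable (at t)" for t using diff[of 0 t] N(1) by simp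
  then have cz: "continuous_on UNIV z"
    by (meson continuous_at_imp_continuous_on differentiable_imp_continuous_within)
  have "diff_op N a (distr_of_fun z) = 0"
    using z by (simp add: homogeneous_ivp_solution_def diff_op_def)
  then obtain v where "distr_of_fun z = distr_of_fun (ode_sol N a v)"
    using homogeneous_distr_solution[where a = a, OF N] by blast
  then have zv: "z = ode_sol N a v"
    by (intro distr_of_fun_inject cz ode_sol_continuous N(1))
  have "v \<nu> = c \<nu>" if "\<nu> < N" for \<nu>
  proof -
    have "(deriv ^^ \<nu>) z 0 = c \<nu>" using z that by (simp add: homogeneous_ivp_solution_def)
    then show ?thesis
      using companion_funpow_low[of 0 \<nu> N a v] that
      by (simp add: zv funpow_deriv_ode_sol[OF N(1)] ode_sol_0)
  qed
  then show ?thesis unfolding zv by (rule ode_sol_cong[OF N(1)])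
qed

text \<open>A causal solution vanishes on the negative half-line, hence everywhere by analyticity.\<close>

lemma causal_ode_sol_eq_0:
  assumes N: "N \<ge> 1" and causal: "causal (distr_of_fun (ode_sol N a c))"
  shows "ode_sol N a c = (\<lambda>_. 0)"
proof
  fix t
  have "ode_sol N a c t = 0" if "t \<in> {..< -1}" for t
  proof (rule regular_eq_on_open[of "ode_sol N a c" "\<lambda>_. 0", OF _ _ _ that])
    fix \<phi> assume \<phi>: "\<phi> \<in> test_functions" "\<And>t. t \<notin> {..< -1} \<Longrightarrow> \<phi> t = 0"
    then show "pairing (distr_of_fun (ode_sol N a c)) \<phi> = pairing (distr_of_fun (\<lambda>_. 0)) \<phi>"
      using causal_pairing_eq_0[OF causal \<phi>(1), of 1] by (simp add: distr_of_fun_zero pairing_zero)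
  qed (auto intro!: locally_integrable_continuous ode_sol_continuous N)
  moreover have "-2 \<in> {..< (-1::real)}" by simp
  ultimately show "ode_sol N a c t = 0"
    using real_analytic_zero[OF real_analytic_ode_sol[OF N] open_lessThan] by blast
qed


section \<open>The total solution\<close>

theorem mainTheorem4:
  fixes N M :: nat and a b :: "nat \<Rightarrow> real" and x :: distr
  assumes "N \<ge> 1" and "a N \<noteq> 0" and "laplace_transformable x"
  defines "F \<equiv> \<lambda>s::complex.
      (\<Sum>m=0..M. of_real (b m) * s ^ m) / (\<Sum>n=0..N. of_real (a n) * s ^ n) * laplace x s"
    and "G \<equiv> \<lambda>(c :: nat \<Rightarrow> real) (s::complex).
      (\<Sum>\<mu>=1..N. of_real (a \<mu>) * (\<Sum>\<nu>=0..\<mu>-1. of_real (c (\<mu> - 1 - \<nu>)) * s ^ \<nu>))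
        / (\<Sum>n=0..N. of_real (a n) * s ^ n)"
    and "lhs \<equiv> \<lambda>y. \<Sum>n=0..N. a n *\<^sub>R (distr_deriv ^^ n) y"
    and "rhs \<equiv> \<Sum>m=0..M. b m *\<^sub>R (distr_deriv ^^ m) x"
  defines "y\<^sub>e \<equiv> inverse_laplace F"
    and "y\<^sub>s \<equiv> \<lambda>c. inverse_laplace_d (G c)"
  shows "
    \<comment> \<open>the total solution\<close>
    (\<forall>y. lhs y = rhs \<longleftrightarrow> (\<exists>c :: nat \<Rightarrow> real. y = y\<^sub>e + distr_of_fun (y\<^sub>s c))) \<and>
    \<comment> \<open>the evoked response is well defined and is the causal solution\<close>
    (\<exists>!T. laplace_pair T F) \<and> laplace_pair y\<^sub>e F \<and>
    causal y\<^sub>e \<and> lhs y\<^sub>e = rhs \<and> (\<forall>y. causal y \<and> lhs y = rhs \<longrightarrow> y = y\<^sub>e) \<and>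
    \<comment> \<open>the spontaneous response is well defined and is the solution of the initial value problem\<close>
    (\<forall>c.
      (\<exists>!T. laplace_pair T (G c)) \<and>
      (\<exists>!g. real_analytic g \<and>
         inverse_laplace (G c) = distr_of_fun (\<lambda>t. unit_step t * g t)) \<and>
      real_analytic (y\<^sub>s c) \<and>
      homogeneous_ivp_solution N a c (y\<^sub>s c) \<and>
      (\<forall>z. homogeneous_ivp_solution N a c z \<longrightarrow> z = y\<^sub>s c))"
proof -
  note N = assms(1,2)
  let ?A = "\<lambda>s::complex. \<Sum>n=0..N. of_real (a n) * s ^ n"
  let ?B = "\<lambda>s::complex. \<Sum>m=0..M. of_real (b m) * s ^ m"
  have lhs: "lhs y = diff_op N a y" for y by (simp add: lhs_def diff_op_def)
  have "laplace_pair rhs (\<lambda>s. ?B s * laplace x s)"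
    unfolding rhs_def by (rule laplace_pair_diff_op[OF laplace_pair_self[OF assms(3)]])
  then obtain Y where Y: "laplace_pair Y (\<lambda>s. ?B s * laplace x s / ?A s)" "diff_op N a Y = rhs"
    using causal_solution_laplace[where a = a, OF N] by blast
  have "F = (\<lambda>s. ?B s * laplace x s / ?A s)" by (simp add: F_def)
  then have YF: "laplace_pair Y F" using Y(1) by simp
  have ye: "y\<^sub>e = Y" unfolding y\<^sub>e_def by (rule inverse_laplace_eq[OF YF])
  have causal_Y: "causal Y" using laplace_pairD[OF YF] by (simp add: laplace_transformable_def)
  have pair_G: "laplace_pair (distr_of_fun (\<lambda>t. unit_step t * ode_sol N a c t)) (G c)" for c
    unfolding G_def by (rule laplace_pair_initial_values[where a = a, OF N])
  have inv_G: "inverse_laplace (G c) = distr_of_fun (\<lambda>t. unit_step t * ode_sol N a c t)" for c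
    by (rule inverse_laplace_eq[OF pair_G])
  have unique_g: "g = ode_sol N a c"
    if "real_analytic g" "inverse_laplace (G c) = distr_of_fun (\<lambda>t. unit_step t * g t)" for g c
    using that real_analytic_unit_step_inject[OF that(1) real_analytic_ode_sol[OF N(1)]] inv_G by simp
  have ys: "y\<^sub>s c = ode_sol N a c" for c
    unfolding y\<^sub>s_def inverse_laplace_d_def
    by (rule the_equality) (use unique_g inv_G real_analytic_ode_sol[OF N(1)] in auto)
  have total: "lhs y = rhs \<longleftrightarrow> (\<exists>c. y = y\<^sub>e + distr_of_fun (y\<^sub>s c))" for y
  proof
    assume "lhs y = rhs"
    then have "diff_op N a (y - Y) = 0" by (simp add: diff_op_minus Y(2) lhs)
    then obtain c where "y - Y = distr_of_fun (ode_sol N a c)"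
      using homogeneous_distr_solution[where a = a, OF N] by blast
    then have "y = y\<^sub>e + distr_of_fun (y\<^sub>s c)" by (simp add: ye ys algebra_simps)
    then show "\<exists>c. y = y\<^sub>e + distr_of_fun (y\<^sub>s c)" by blast
  next
    assume "\<exists>c. y = y\<^sub>e + distr_of_fun (y\<^sub>s c)"
    then show "lhs y = rhs"
      by (auto simp: lhs ye ys diff_op_plus Y(2) diff_op_ode_sol[where a = a, OF N])
  qed
  have causal_unique: "y = y\<^sub>e" if cy: "causal y" and ly: "lhs y = rhs" for y
  proof -
    obtain c where c: "y = Y + distr_of_fun (ode_sol N a c)"
      using total[of y] ly by (auto simp: ye ys)
    then have "distr_of_fun (ode_sol N a c) = y + (-1) *\<^sub>R Y" by simp
    then have "causal (distr_of_fun (ode_sol N a c))"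
      using causal_plus[OF cy causal_scaleR[OF causal_Y]] by (simp only:)
    then have "ode_sol N a c = (\<lambda>_. 0)" by (rule causal_ode_sol_eq_0[OF N(1)])
    then show ?thesis by (simp add: c ye distr_of_fun_zero)
  qed
  have "(\<exists>!T. laplace_pair T (G c)) \<and>
      (\<exists>!g. real_analytic g \<and> inverse_laplace (G c) = distr_of_fun (\<lambda>t. unit_step t * g t)) \<and>
      real_analytic (y\<^sub>s c) \<and> homogeneous_ivp_solution N a c (y\<^sub>s c) \<and>
      (\<forall>z. homogeneous_ivp_solution N a c z \<longrightarrow> z = y\<^sub>s c)" for c
  proof (intro conjI allI impI)
    show "\<exists>!T. laplace_pair T (G c)" by (rule laplace_pair_ex1[OF pair_G])
    show "\<exists>!g. real_analytic g \<and> inverse_laplace (G c) = distr_of_fun (\<lambda>t. unit_step t * g t)"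
      using unique_g inv_G real_analytic_ode_sol[OF N(1)] by (intro ex1I[of _ "ode_sol N a c"]) auto
    show "real_analytic (y\<^sub>s c)" unfolding ys by (rule real_analytic_ode_sol[OF N(1)])
    show "homogeneous_ivp_solution N a c (y\<^sub>s c)" unfolding ys by (rule ode_sol_homogeneous_ivp[where a = a, OF N])
    show "z = y\<^sub>s c" if "homogeneous_ivp_solution N a c z" for z
      unfolding ys by (rule homogeneous_ivp_unique[where a = a, OF N that])
  qed
  then show ?thesis
    using total causal_unique laplace_pair_ex1[OF YF] YF causal_Y Y(2) by (auto simp: ye lhs)
qed

end
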